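(* Let $\mathcal{M}=(M,g)$ be a harmonic space, let $P\in M$ and $\xi\in T_PM$. Let $\mathcal{H}_k(\xi)=\mathcal{H}_k(P;\xi)$ be the degree-$k$ homogeneous term of the Taylor series at $\xi=0$ of the volume density $\tilde\Theta_{\mathcal{M}}(P;\xi)$, and let $\mathcal{J}_k(\xi)=\nabla_\xi^k\mathcal{J}(\xi)$, where $\mathcal{J}=\mathcal{J}_0$ is the Jacobi operator (all defined in the context). Then $\mathcal{H}_{2k+1}(\xi)=0$ for all $k\ge1$, and: (1) $\mathcal{H}_2(\xi)=-\frac16\operatorname{Tr}\{\mathcal{J}(\xi)\}$. (2) $\mathcal{H}_4(\xi)=\frac1{72}\operatorname{Tr}\{\mathcal{J}(\xi)\}^2-\frac1{180}\operatorname{Tr}\{\mathcal{J}(\xi)^2\}$. (3) $\mathcal{H}_6(\xi)=-\frac{\operatorname{Tr}\{\mathcal{J}(\xi)\}^3}{1296}+\frac{\operatorname{Tr}\{\mathcal{J}(\xi)\}\operatorname{Tr}\{\mathcal{J}(\xi)^2\}}{1080}-\frac{\operatorname{Tr}\{\mathcal{J}(\xi)^3\}}{2835}+\frac{\operatorname{Tr}\{\mathcal{J}_1(\xi)^2\}}{10080}$. (4) $\mathcal{H}_8(\xi)=\frac{\operatorname{Tr}\{\mathcal{J}(\xi)\}^4}{31104}-\frac{\operatorname{Tr}\{\mathcal{J}(\xi)\}^2\operatorname{Tr}\{\mathcal{J}(\xi)^2\}}{12960}+\frac{\operatorname{Tr}\{\mathcal{J}(\xi)\}\operatorname{Tr}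\{\mathcal{J}(\xi)^3\}}{17010}-\frac{\operatorname{Tr}\{\mathcal{J}(\xi)\}\operatorname{Tr}\{\mathcal{J}_1(\xi)^2\}}{60480}+\frac{\operatorname{Tr}\{\mathcal{J}(\xi)^2\}^2}{64800}-\frac{\operatorname{Tr}\{\mathcal{J}(\xi)^4\}}{37800}-\frac{\operatorname{Tr}\{\mathcal{J}(\xi)^2\mathcal{J}_2(\xi)\}}{340200}+\frac{\operatorname{Tr}\{\mathcal{J}(\xi)\mathcal{J}_1(\xi)^2\}}{54432}-\frac{\operatorname{Tr}\{\mathcal{J}_2(\xi)^2\}}{907200}$.
   Context: Let $\mathcal{M}=(M,g)$ be a (smooth) Riemannian manifold of dimension $m$ with Riemannian measure $\operatorname{dvol}_{\mathcal{M}}$ and Levi-Civita connection $\nabla$. Identify a neighborhood of $P\in M$ with a neighborhood of $0\in T_PM$ via $\exp_P$, and let $d\xi$ be the Lebesgue measure of the inner product space $T_PM$. The density $\tilde\Theta_{\mathcal{M}}(P;\xi)$ is defined for $\xi$ near $0$ by $\exp_P^*\{\operatorname{dvol}_{\mathcal{M}}\}(\xi)=\tilde\Theta_{\mathcal{M}}(P;\xi)\,d\xi$; equivalently $\tilde\Theta_{\mathcal{M}}(P;\xi)=\sqrt{\det(g_{ij}(\xi))}$ in geodesic normal coordinates at $P$ given by an orthonormal basis of $T_PM$. Its formal Taylor series at $\xi=0$ is $\tilde\Theta_{\mathcal{M}}(P;\xi)\sim 1+\sum_{k=2}^\infty\mathcal{H}_k(P;\xi)$ with $\mathcal{H}_k(P;c\xi)=c^k\mathcal{H}_k(P;\xi)$.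 $\mathcal{M}$ is a harmonic space if $\tilde\Theta_{\mathcal{M}}(P;\xi)$ depends only on $\|\xi\|$ (for all $P$ and all sufficiently small $\xi$). No completeness is assumed. Curvature conventions: $R(\xi,\eta)=\nabla_\xi\nabla_\eta-\nabla_\eta\nabla_\xi-\nabla_{[\xi,\eta]}$ and $R(\xi_1,\xi_2,\xi_3,\xi_4)=g(R(\xi_1,\xi_2)\xi_3,\xi_4)$. The Jacobi operator is $\mathcal{J}(\xi)\eta=R(\eta,\xi)\xi$. For $k\ge0$, $\mathcal{J}_k(\xi)$ is the endomorphism of $T_PM$ defined by $g(\mathcal{J}_k(\xi)\xi_1,\xi_2)=(\nabla^kR)(\xi_1,\xi,\xi,\xi_2;\xi,\dots,\xi)$, with $k$ copies of $\xi$ after the semicolon; $\mathcal{J}_0=\mathcal{J}$. *)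

theory Defs
  imports "HOL-Analysis.Analysis"
begin

section \<open>Directional derivatives, smoothness, Taylor terms\<close>

definition dir_deriv ::
  "('a::real_normed_vector \<Rightarrow> 'b::real_normed_vector) \<Rightarrow> 'a \<Rightarrow> 'a \<Rightarrow> 'b"
  where "dir_deriv f x v = vector_derivative (\<lambda>t. f (x + t *\<^sub>R v)) (at 0)"

primrec Ck_on ::
  "nat \<Rightarrow> 'a::real_normed_vector set \<Rightarrow> ('a \<Rightarrow> 'b::real_normed_vector) \<Rightarrow> bool"
  where
    "Ck_on 0 S f \<longleftrightarrow> continuous_on S f"
  | "Ck_on (Suc k) S f \<longleftrightarrow>
       f differentiable_on S \<and> (\<forall>v. Ck_on k S (\<lambda>x. dir_deriv f x v))"

text \<open>Meant for open sets only.\<close>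

definition smooth_on ::
  "'a::real_normed_vector set \<Rightarrow> ('a \<Rightarrow> 'b::real_normed_vector) \<Rightarrow> bool"
  where "smooth_on S f \<longleftrightarrow> (\<forall>k. Ck_on k S f)"

text \<open>The degree-\<open>k\<close> homogeneous term of the Taylor series of \<open>f\<close> at \<open>0\<close>:
  \<open>(1/k!) (\<xi> \<cdot> \<partial>)\<^sup>k f\<close> at \<open>0\<close>.\<close>

definition taylor_term :: "nat \<Rightarrow> ('a::real_normed_vector \<Rightarrow> real) \<Rightarrow> 'a \<Rightarrow> real"
  where "taylor_term k f \<xi> = ((\<lambda>h x. dir_deriv h x \<xi>) ^^ k) f 0 / fact k"

section \<open>Riemannian manifolds\<close>

text \<open>A chart is a pair of its domain and its coordinate map (whose values outside the domain
  are irrelevant). The metric is given by its matrix of components in every chart.\<close>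

type_synonym ('a, 'n) chart = "'a set \<times> ('a \<Rightarrow> real ^ 'n)"

record ('a, 'n) manifold =
  mtop :: "'a topology"
  atlas :: "('a, 'n::finite) chart set"
  gmat :: "('a, 'n) chart \<Rightarrow> real ^ 'n \<Rightarrow> real ^ 'n ^ 'n"

abbreviation cdom :: "('a, 'n::finite) chart \<Rightarrow> 'a set" where "cdom \<equiv> fst"
abbreviation cmap :: "('a, 'n::finite) chart \<Rightarrow> 'a \<Rightarrow> real ^ 'n" where "cmap \<equiv> snd"

definition transition ::
  "('a, 'n::finite) chart \<Rightarrow> ('a, 'n) chart \<Rightarrow> real ^ 'n \<Rightarrow> real ^ 'n"
  where "transition c d = cmap d \<circ> inv_into (cdom c) (cmap c)"

definition ginner :: "(real ^ 'n \<Rightarrow> real ^ 'n ^ 'n) \<Rightarrow> real ^ 'n \<Rightarrow> real ^ 'n \<Rightarrow> real ^ 'n \<Rightarrow> real"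
  where "ginner G x v w = v \<bullet> (G x *v w)"

definition smooth_manifold :: "('a, 'n::finite, 'z) manifold_scheme \<Rightarrow> bool"
  where "smooth_manifold M \<longleftrightarrow>
    Hausdorff_space (mtop M) \<and> second_countable (mtop M) \<and>
    (\<Union>c\<in>atlas M. cdom c) = topspace (mtop M) \<and>
    (\<forall>c\<in>atlas M.
       openin (mtop M) (cdom c) \<and> open (cmap c ` cdom c) \<and>
       homeomorphic_map (subtopology (mtop M) (cdom c)) (top_of_set (cmap c ` cdom c)) (cmap c)) \<and>
    (\<forall>c\<in>atlas M. \<forall>d\<in>atlas M.
       smooth_on (cmap c ` (cdom c \<inter> cdom d)) (transition c d))"

definition riemannian_manifold :: "('a, 'n::finite, 'z) manifold_scheme \<Rightarrow> bool"
  where "riemannian_manifold M \<longleftrightarrow>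
    smooth_manifold M \<and>
    (\<forall>c\<in>atlas M.
       smooth_on (cmap c ` cdom c) (gmat M c) \<and>
       (\<forall>x\<in>cmap c ` cdom c.
          (\<forall>v w. ginner (gmat M c) x v w = ginner (gmat M c) x w v) \<and>
          (\<forall>v. v \<noteq> 0 \<longrightarrow> ginner (gmat M c) x v v > 0))) \<and>
    (\<forall>c\<in>atlas M. \<forall>d\<in>atlas M. \<forall>p\<in>cdom c \<inter> cdom d. \<forall>v w.
       ginner (gmat M d) (cmap d p)
         (dir_deriv (transition c d) (cmap c p) v) (dir_deriv (transition c d) (cmap c p) w)
       = ginner (gmat M c) (cmap c p) v w)"

text \<open>The charts around \<open>P\<close>. Such a chart \<open>c\<close> identifies the tangent space at \<open>P\<close> with
  \<open>real ^ 'n\<close>; below, a tangent vector \<open>\<xi>\<close> at \<open>P\<close> is given by its components in \<open>c\<close>, and its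
  length is \<open>gnorm M c P \<xi>\<close>.\<close>

definition charts_at :: "('a, 'n::finite, 'z) manifold_scheme \<Rightarrow> 'a \<Rightarrow> ('a, 'n) chart set"
  where "charts_at M P = {c \<in> atlas M. P \<in> cdom c}"

definition gnorm ::
  "('a, 'n::finite, 'z) manifold_scheme \<Rightarrow> ('a, 'n) chart \<Rightarrow> 'a \<Rightarrow> real ^ 'n \<Rightarrow> real"
  where "gnorm M c P \<xi> = sqrt (ginner (gmat M c) (cmap c P) \<xi> \<xi>)"

section \<open>Levi-Civita connection and curvature in a chart\<close>

text \<open>\<open>christoffel G x v w\<close> has components
  \<open>\<Gamma>\<^sup>k\<^sub>i\<^sub>j v\<^sup>i w\<^sup>j\<close> with
  \<open>\<Gamma>\<^sup>k\<^sub>i\<^sub>j = (1/2) g\<^sup>k\<^sup>l (\<partial>\<^sub>i g\<^sub>j\<^sub>l + \<partial>\<^sub>j g\<^sub>i\<^sub>l - \<partial>\<^sub>l g\<^sub>i\<^sub>j)\<close>.\<close>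

definition christoffel ::
  "(real ^ 'n \<Rightarrow> real ^ 'n ^ 'n) \<Rightarrow> real ^ 'n \<Rightarrow> real ^ 'n \<Rightarrow> real ^ 'n \<Rightarrow> real ^ 'n::finite"
  where "christoffel G x v w =
    matrix_inv (G x) *v
      (\<chi> l. (dir_deriv (\<lambda>y. ginner G y w (axis l 1)) x v
            + dir_deriv (\<lambda>y. ginner G y v (axis l 1)) x w
            - dir_deriv (\<lambda>y. ginner G y v w) x (axis l 1)) / 2)"

definition nabla ::
  "(real ^ 'n \<Rightarrow> real ^ 'n ^ 'n) \<Rightarrow> (real ^ 'n \<Rightarrow> real ^ 'n) \<Rightarrow> (real ^ 'n \<Rightarrow> real ^ 'n) \<Rightarrow>
   real ^ 'n \<Rightarrow> real ^ 'n::finite"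
  where "nabla G X Y x = dir_deriv Y x (X x) + christoffel G x (X x) (Y x)"

definition lie_bracket ::
  "(real ^ 'n \<Rightarrow> real ^ 'n) \<Rightarrow> (real ^ 'n \<Rightarrow> real ^ 'n) \<Rightarrow> real ^ 'n \<Rightarrow> real ^ 'n::finite"
  where "lie_bracket X Y x = dir_deriv Y x (X x) - dir_deriv X x (Y x)"

definition curvature_op ::
  "(real ^ 'n \<Rightarrow> real ^ 'n ^ 'n) \<Rightarrow> (real ^ 'n \<Rightarrow> real ^ 'n) \<Rightarrow> (real ^ 'n \<Rightarrow> real ^ 'n) \<Rightarrow>
   (real ^ 'n \<Rightarrow> real ^ 'n) \<Rightarrow> real ^ 'n \<Rightarrow> real ^ 'n::finite"
  where "curvature_op G X Y Z x =
    nabla G X (nabla G Y Z) x - nabla G Y (nabla G X Z) x - nabla G (lie_bracket X Y) Z x"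

text \<open>A covariant tensor field of rank \<open>r\<close> in a chart is a function \<open>T\<close> for which \<open>T x vs\<close> is the
  value at the point \<open>x\<close> on the list \<open>vs\<close> of \<open>r\<close> vectors. Vectors are evaluated by extending them
  to vector fields with constant components.\<close>

definition riemann_tensor ::
  "(real ^ 'n \<Rightarrow> real ^ 'n ^ 'n) \<Rightarrow> real ^ 'n \<Rightarrow> (real ^ 'n::finite) list \<Rightarrow> real"
  where "riemann_tensor G x vs =
    ginner G x (curvature_op G (\<lambda>_. vs ! 0) (\<lambda>_. vs ! 1) (\<lambda>_. vs ! 2) x) (vs ! 3)"

text \<open>\<open>\<nabla>T (v\<^sub>1, \<dots>, v\<^sub>r; u) = (\<nabla>\<^sub>u T) (v\<^sub>1, \<dots>, v\<^sub>r)\<close>: the direction of differentiation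
  comes last. For constant \<open>v\<^sub>i\<close>, \<open>\<nabla>\<^sub>u v\<^sub>i\<close> is the Christoffel term.\<close>

definition cov_deriv ::
  "(real ^ 'n \<Rightarrow> real ^ 'n ^ 'n) \<Rightarrow> (real ^ 'n \<Rightarrow> (real ^ 'n) list \<Rightarrow> real) \<Rightarrow>
   real ^ 'n \<Rightarrow> (real ^ 'n::finite) list \<Rightarrow> real"
  where "cov_deriv G T x vs =
    (let ws = butlast vs; u = last vs in
       dir_deriv (\<lambda>y. T y ws) x u
       - (\<Sum>i<length ws. T x (ws[i := christoffel G x u (ws ! i)])))"

text \<open>The matrix, in the chart \<open>c\<close>, of the endomorphism \<open>\<J>\<^sub>k(\<xi>)\<close> of the tangent space at
  \<open>P\<close>; \<open>k = 0\<close> is the Jacobi operator.\<close>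

definition jacobi_op ::
  "('a, 'n::finite, 'z) manifold_scheme \<Rightarrow> ('a, 'n) chart \<Rightarrow> 'a \<Rightarrow> nat \<Rightarrow> real ^ 'n \<Rightarrow> real ^ 'n ^ 'n"
  where "jacobi_op M c P k \<xi> =
    (THE A. \<forall>v w. ginner (gmat M c) (cmap c P) (A *v v) w =
       (cov_deriv (gmat M c) ^^ k) (riemann_tensor (gmat M c)) (cmap c P)
         ([v, \<xi>, \<xi>, w] @ replicate k \<xi>))"

section \<open>Exponential map, volume density, harmonic spaces\<close>

definition geodesic_on ::
  "('a, 'n::finite, 'z) manifold_scheme \<Rightarrow> real set \<Rightarrow> (real \<Rightarrow> 'a) \<Rightarrow> bool"
  where "geodesic_on M I \<gamma> \<longleftrightarrow>
    open I \<and> is_interval I \<and> continuous_map (top_of_set I) (mtop M) \<gamma> \<and>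
    (\<forall>c\<in>atlas M. \<exists>v. \<forall>t\<in>I. \<gamma> t \<in> cdom c \<longrightarrow>
       ((cmap c \<circ> \<gamma>) has_vector_derivative v t) (at t) \<and>
       (v has_vector_derivative - christoffel (gmat M c) (cmap c (\<gamma> t)) (v t) (v t)) (at t))"

text \<open>No completeness is assumed: \<open>exp_map M c P \<xi>\<close> is meaningful only if the geodesic with initial
  velocity \<open>\<xi>\<close> exists up to time \<open>1\<close>, in particular for all small \<open>\<xi>\<close>.\<close>

definition exp_map ::
  "('a, 'n::finite, 'z) manifold_scheme \<Rightarrow> ('a, 'n) chart \<Rightarrow> 'a \<Rightarrow> real ^ 'n \<Rightarrow> 'a"
  where "exp_map M c P \<xi> =
    (THE q. \<exists>I \<gamma>. geodesic_on M I \<gamma> \<and> {0..1} \<subseteq> I \<and> \<gamma> 0 = P \<and>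
       ((cmap c \<circ> \<gamma>) has_vector_derivative \<xi>) (at 0) \<and> q = \<gamma> 1)"

text \<open>In a chart with coordinates \<open>x\<close>, the Riemannian measure is \<open>sqrt (det g) dx\<close>.\<close>

definition vol_density ::
  "('a, 'n::finite, 'z) manifold_scheme \<Rightarrow> ('a, 'n) chart \<Rightarrow> 'a \<Rightarrow> real"
  where "vol_density M c p = sqrt (det (gmat M c (cmap c p)))"

text \<open>The factor by which the pull-back of the Riemannian measure under the exponential map at
  \<open>P\<close> differs from the Lebesgue measure of the inner product space of tangent vectors at \<open>P\<close>. With
  tangent vectors given by components \<open>v\<close> in the chart \<open>c\<close>, the latter is
  \<open>vol_density M c P dv\<close>, whence the denominator. The point \<open>exp_map M c P \<xi>\<close> lies in the
  domain of \<open>c\<close> for small \<open>\<xi>\<close>; only those are relevant.\<close>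

definition volume_density ::
  "('a, 'n::finite, 'z) manifold_scheme \<Rightarrow> ('a, 'n) chart \<Rightarrow> 'a \<Rightarrow> real ^ 'n \<Rightarrow> real"
  where "volume_density M c P \<xi> =
    vol_density M c (exp_map M c P \<xi>)
      * \<bar>det (matrix (dir_deriv (cmap c \<circ> exp_map M c P) \<xi>))\<bar> / vol_density M c P"

definition harmonic_space :: "('a, 'n::finite, 'z) manifold_scheme \<Rightarrow> bool"
  where "harmonic_space M \<longleftrightarrow>
    riemannian_manifold M \<and>
    (\<forall>P\<in>topspace (mtop M). \<forall>c\<in>charts_at M P. \<exists>\<epsilon>>0. \<exists>f. \<forall>\<xi>.
       gnorm M c P \<xi> < \<epsilon> \<longrightarrow> volume_density M c P \<xi> = f (gnorm M c P \<xi>))"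

definition taylor_H ::
  "('a, 'n::finite, 'z) manifold_scheme \<Rightarrow> ('a, 'n) chart \<Rightarrow> 'a \<Rightarrow> nat \<Rightarrow> real ^ 'n \<Rightarrow> real"
  where "taylor_H M c P k \<xi> = taylor_term k (volume_density M c P) \<xi>"

end

theory Submission
  imports Defs
begin

text \<open>Along the geodesic \<open>\<gamma>\<close> with initial velocity \<open>\<xi>\<close>, the differential of the exponential map at
  \<open>t \<xi>\<close> is \<open>A(t) / t\<close> in a parallel frame, where \<open>A'' + R A = 0\<close>, \<open>A(0) = 0\<close>, \<open>A'(0) = 1\<close> and \<open>R(t)\<close> is the
  matrix of the Jacobi operator of \<open>\<gamma>'(t)\<close>, so that \<open>R\<^sup>(\<^sup>k\<^sup>)(0)\<close> represents \<open>\<J>\<^sub>k(\<xi>)\<close>. Hence the density is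
  \<open>det (A(t) / t)\<close>, and the Riccati equation for its logarithmic derivative yields all Taylor coefficients
  as polynomials in traces of words in the derivatives of \<open>R\<close>. In a harmonic space the density is even in \<open>t\<close>
  at every point of \<open>\<gamma>\<close>, so the coefficients of degree 3, 5 and 7 vanish identically along \<open>\<gamma>\<close>:
  \<open>Tr R' = 0\<close>, \<open>Tr (R R') = 0\<close>, and one relation of degree 7. Differentiating these relations along
  \<open>\<gamma>\<close> eliminates all traces which do not occur in the theorem.\<close>

section \<open>Calculus of \<open>C\<^sup>k\<close> functions on open sets\<close>

text \<open>Only rays matter: a Taylor term iterates \<open>dir_deriv\<close> in one direction, so
  the density is studied on the multiples of one vector, and smoothness of \<open>exp_map\<close> as
  a function of the tangent vector is never established. What is needed is its differential at each
  point of the ray. This comes from differentiating the geodesic flow in the initial velocity, which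
  is why the flow of a C^1 field and its first variation are built from a contraction argument.
  Relations known at P alone could not be differentiated. The density is therefore computed from an
  arbitrary base point of the geodesic, but always in the parallel frame based at P, so that every
  relation concerns one and the same matrix curve R. Give the k-th derivative of R the weight k + 2.
  In weight 8, once the traces of single derivatives are gone, the unwanted traces are Tr (R R'''')
  and Tr (R' R'''). Two linear equations remove them: the third derivative of Tr (R R') = 0 and the
  first derivative of the relation of weight 7.\<close>

lemma dir_deriv_eq:
  assumes "(f has_derivative f') (at x)"
  shows "dir_deriv f x v = f' v"
proof -
  have "((\<lambda>t. f (x + t *\<^sub>R v)) has_derivative (\<lambda>t. f' (t *\<^sub>R v))) (at 0)"
    by (rule has_derivative_compose[where f="\<lambda>t. x + t *\<^sub>R v" and g=f])
       (auto intro!: derivative_eq_intros assms)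
  moreover have "f' (t *\<^sub>R v) = t *\<^sub>R f' v" for t
    using assms by (simp add: has_derivative_linear linear_cmul)
  ultimately have "((\<lambda>t. f (x + t *\<^sub>R v)) has_vector_derivative f' v) (at 0)"
    by (simp add: has_vector_derivative_def)
  then show ?thesis unfolding dir_deriv_def by (rule vector_derivative_at)
qed

lemma dir_deriv_cong:
  assumes "open S" "x \<in> S" "\<And>y. y \<in> S \<Longrightarrow> f y = g y"
  shows "dir_deriv f x v = dir_deriv g x v"
proof -
  have "continuous (at 0) (\<lambda>t. x + t *\<^sub>R v)" by (intro continuous_intros)
  then have "\<forall>\<^sub>F t in nhds 0. x + t *\<^sub>R v \<in> S"
    using topological_tendstoD[OF _ assms(1), of "\<lambda>t. x + t *\<^sub>R v" x "nhds 0"] assms(2)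
      tendsto_at_iff_tendsto_nhds[of "\<lambda>t. x + t *\<^sub>R v" 0]
    by (simp add: continuous_at)
  then have "\<forall>\<^sub>F t in nhds 0. f (x + t *\<^sub>R v) = g (x + t *\<^sub>R v)"
    by (rule eventually_mono) (rule assms(3))
  then show ?thesis unfolding dir_deriv_def
    by (intro vector_derivative_cong_eq) auto
qed

lemma has_derivative_dir_deriv:
  assumes "Ck_on (Suc k) S f" "open S" "x \<in> S"
  shows "(f has_derivative dir_deriv f x) (at x)"
proof -
  obtain f' where f': "(f has_derivative f') (at x)"
    using assms by (auto simp: differentiable_on_eq_differentiable_at differentiable_def)
  then have "dir_deriv f x = f'" by (intro ext dir_deriv_eq)
  with f' show ?thesis by simp
qed

lemma Ck_on_cong:
  assumes "open S" "Ck_on k S f" "\<And>x. x \<in> S \<Longrightarrow> f x = g x"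
  shows "Ck_on k S g"
  using assms(2,3)
proof (induction k arbitrary: f g)
  case 0
  then show ?case by (simp cong: continuous_on_cong)
next
  case (Suc k)
  have "g differentiable_on S"
    using Suc.prems has_derivative_transform_within_open[OF _ assms(1), where f=f and g=g]
    by (fastforce simp: differentiable_on_eq_differentiable_at[OF assms(1)] differentiable_def)
  moreover have "Ck_on k S (\<lambda>x. dir_deriv g x v)" for v
    by (rule Suc.IH[of "\<lambda>x. dir_deriv f x v"])
       (use Suc.prems in \<open>auto intro: dir_deriv_cong[OF assms(1)]\<close>)
  ultimately show ?case by simp
qed

text \<open>\<open>Ck_on\<close> speaks about \<open>dir_deriv\<close>; here any explicit formula
  for the derivative may take its place. The closure rules below share this pattern: exhibit the
  derivative and apply the induction hypothesis to it.\<close>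

lemma Ck_on_SucI:
  assumes "open S" "\<And>x. x \<in> S \<Longrightarrow> (f has_derivative f' x) (at x)"
    and "\<And>v. Ck_on k S (\<lambda>x. f' x v)"
  shows "Ck_on (Suc k) S f"
proof -
  have "f differentiable_on S"
    using assms(1,2) by (auto simp: differentiable_on_eq_differentiable_at differentiable_def)
  moreover have "Ck_on k S (\<lambda>x. dir_deriv f x v)" for v
    by (rule Ck_on_cong[OF assms(1) assms(3)[of v]]) (simp add: dir_deriv_eq[OF assms(2)])
  ultimately show ?thesis by simp
qed

lemma Ck_on_Suc_imp: "Ck_on (Suc k) S f \<Longrightarrow> Ck_on k S f"
proof (induction k arbitrary: f)
  case 0
  then show ?case by (auto intro: differentiable_imp_continuous_on)
qed auto

lemma Ck_on_const: "open S \<Longrightarrow> Ck_on k S (\<lambda>x. a)"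
proof (induction k arbitrary: a)
  case (Suc k)
  then show ?case by (intro Ck_on_SucI[where f'="\<lambda>_ _. 0"]) auto
qed simp

lemma Ck_on_bounded_linear:
  assumes "bounded_linear L" "open S" "Ck_on k S f"
  shows "Ck_on k S (\<lambda>x. L (f x))"
  using assms(3)
proof (induction k arbitrary: f)
  case 0
  then show ?case
    using bounded_linear.continuous_on[OF assms(1)] by auto
next
  case (Suc k)
  show ?case
    by (rule Ck_on_SucI[OF assms(2), where f'="\<lambda>x v. L (dir_deriv f x v)"])
       (use Suc in \<open>auto intro!: bounded_linear.has_derivative[OF assms(1)]
          has_derivative_dir_deriv[OF Suc.prems assms(2)]\<close>)
qed

lemma Ck_on_add:
  assumes "open S" "Ck_on k S f" "Ck_on k S g"
  shows "Ck_on k S (\<lambda>x. f x + g x)"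
  using assms(2,3)
proof (induction k arbitrary: f g)
  case 0
  then show ?case by (auto intro: continuous_intros)
next
  case (Suc k)
  show ?case
    by (rule Ck_on_SucI[OF assms(1), where f'="\<lambda>x v. dir_deriv f x v + dir_deriv g x v"])
       (use Suc in \<open>auto intro!: derivative_intros has_derivative_dir_deriv[OF _ assms(1), of k]\<close>)
qed

lemma Ck_on_sum:
  assumes "open S" "\<And>i. i \<in> A \<Longrightarrow> Ck_on k S (f i)"
  shows "Ck_on k S (\<lambda>x. \<Sum>i\<in>A. f i x)"
  using assms(2)
  by (induction A rule: infinite_finite_induct) (auto intro: Ck_on_const Ck_on_add assms(1))

text \<open>The product rule pairs each function with a derivative of the other, so the induction
  runs over both functions at once, and the undifferentiated factor is first weakened by one
  order.\<close>

lemma Ck_on_bilinear: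
  assumes "bounded_bilinear p" "open S" "Ck_on k S f" "Ck_on k S g"
  shows "Ck_on k S (\<lambda>x. p (f x) (g x))"
  using assms(3,4)
proof (induction k arbitrary: f g)
  case 0
  then show ?case using bounded_bilinear.continuous_on[OF assms(1)] by auto
next
  case (Suc k)
  have "Ck_on k S (\<lambda>x. p (f x) (dir_deriv g x v) + p (dir_deriv f x v) (g x))" for v
    using Suc.prems Ck_on_Suc_imp[OF Suc.prems(1)] Ck_on_Suc_imp[OF Suc.prems(2)]
    by (intro Ck_on_add[OF assms(2)] Suc.IH) auto
  then show ?case
    by (intro Ck_on_SucI[OF assms(2), where f'="\<lambda>x v. p (f x) (dir_deriv g x v) + p (dir_deriv f x v) (g x)"]
          bounded_bilinear.FDERIV[OF assms(1)] has_derivative_dir_deriv[OF Suc.prems(1) assms(2)]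
          has_derivative_dir_deriv[OF Suc.prems(2) assms(2)])
qed

lemma Ck_on_compose_linear:
  assumes "bounded_linear L" "open S" "Ck_on k S f"
  shows "Ck_on k (L -` S) (\<lambda>x. f (L x))"
  using assms(3)
proof (induction k arbitrary: f)
  case 0
  then show ?case
    using continuous_on_compose2[of S f "L -` S" L] linear_continuous_on[OF assms(1)] by auto
next
  case (Suc k)
  have o: "open (L -` S)"
    by (intro open_vimage assms(2) linear_continuous_on assms(1))
  show ?case
    by (rule Ck_on_SucI[OF o, where f'="\<lambda>x v. dir_deriv f (L x) (L v)"])
       (use Suc in \<open>auto intro!: has_derivative_compose[OF bounded_linear_imp_has_derivative[OF assms(1)]]
          has_derivative_dir_deriv[OF Suc.prems assms(2)]\<close>)
qed

text \<open>The derivative of \<open>inverse (f x)\<close> contains \<open>inverse (f x)\<close>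
  again, but one order lower, where the induction hypothesis applies.\<close>

lemma Ck_on_inverse:
  fixes f :: "'a::real_normed_vector \<Rightarrow> real"
  assumes "open S" "Ck_on k S f" "\<And>x. x \<in> S \<Longrightarrow> f x \<noteq> 0"
  shows "Ck_on k S (\<lambda>x. inverse (f x))"
  using assms(2)
proof (induction k)
  case 0
  then show ?case using assms(3) by (auto intro!: continuous_intros)
next
  case (Suc k)
  have i: "Ck_on k S (\<lambda>x. inverse (f x))" using Suc Ck_on_Suc_imp by blast
  have "Ck_on k S (\<lambda>x. - (inverse (f x) * dir_deriv f x v * inverse (f x)))" for v
    using Suc.prems i
    by (intro Ck_on_bounded_linear[OF bounded_linear_minus[OF bounded_linear_ident] assms(1)]
        Ck_on_bilinear[OF bounded_bilinear_mult assms(1)]) auto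
  then show ?case
    by (intro Ck_on_SucI[OF assms(1), where f'="\<lambda>x v. - (inverse (f x) * dir_deriv f x v * inverse (f x))"]
       Deriv.has_derivative_inverse has_derivative_dir_deriv[OF Suc.prems assms(1)] assms(3)) auto
qed

section \<open>Closure rules for smooth functions\<close>

lemma smooth_on_dir_deriv: "smooth_on S f \<Longrightarrow> smooth_on S (\<lambda>x. dir_deriv f x v)"
  unfolding smooth_on_def by (metis Ck_on.simps(2))

lemma smooth_on_has_derivative:
  "smooth_on S f \<Longrightarrow> open S \<Longrightarrow> x \<in> S \<Longrightarrow> (f has_derivative dir_deriv f x) (at x)"
  unfolding smooth_on_def using has_derivative_dir_deriv by blast

lemma smooth_on_linear_dir_deriv:
  "smooth_on S f \<Longrightarrow> open S \<Longrightarrow> x \<in> S \<Longrightarrow> linear (dir_deriv f x)"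
  using smooth_on_has_derivative has_derivative_linear by blast

lemma smooth_on_continuous: "smooth_on S f \<Longrightarrow> continuous_on S f"
  unfolding smooth_on_def by (metis Ck_on.simps(1))

lemma smooth_on_cong: "smooth_on S f \<Longrightarrow> open S \<Longrightarrow> (\<And>x. x \<in> S \<Longrightarrow> f x = g x) \<Longrightarrow> smooth_on S g"
  unfolding smooth_on_def by (intro allI, rule Ck_on_cong[of S _ f]) auto

lemma smooth_on_const: "open S \<Longrightarrow> smooth_on S (\<lambda>x. a)"
  unfolding smooth_on_def by (intro allI, rule Ck_on_const) auto

lemma smooth_on_bounded_linear:
  "bounded_linear L \<Longrightarrow> open S \<Longrightarrow> smooth_on S f \<Longrightarrow> smooth_on S (\<lambda>x. L (f x))"
  unfolding smooth_on_def by (intro allI, rule Ck_on_bounded_linear) auto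

lemma smooth_on_add:
  "open S \<Longrightarrow> smooth_on S f \<Longrightarrow> smooth_on S g \<Longrightarrow> smooth_on S (\<lambda>x. f x + g x)"
  unfolding smooth_on_def by (intro allI, rule Ck_on_add) auto

lemma smooth_on_minus: "open S \<Longrightarrow> smooth_on S f \<Longrightarrow> smooth_on S (\<lambda>x. - f x)"
  by (rule smooth_on_bounded_linear[OF bounded_linear_minus[OF bounded_linear_ident]])

lemma smooth_on_diff:
  "open S \<Longrightarrow> smooth_on S f \<Longrightarrow> smooth_on S g \<Longrightarrow> smooth_on S (\<lambda>x. f x - g x)"
  using smooth_on_add[of S f "\<lambda>x. - g x"] smooth_on_minus[of S g] by simp

lemma smooth_on_sum:
  "open S \<Longrightarrow> (\<And>i. i \<in> A \<Longrightarrow> smooth_on S (f i)) \<Longrightarrow> smooth_on S (\<lambda>x. \<Sum>i\<in>A. f i x)"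
  unfolding smooth_on_def by (intro allI, rule Ck_on_sum) auto

lemma smooth_on_bilinear:
  "bounded_bilinear p \<Longrightarrow> open S \<Longrightarrow> smooth_on S f \<Longrightarrow> smooth_on S g \<Longrightarrow> smooth_on S (\<lambda>x. p (f x) (g x))"
  unfolding smooth_on_def by (intro allI, rule Ck_on_bilinear) auto

lemma smooth_on_compose_linear:
  "bounded_linear L \<Longrightarrow> open S \<Longrightarrow> smooth_on S f \<Longrightarrow> smooth_on (L -` S) (\<lambda>x. f (L x))"
  unfolding smooth_on_def by (intro allI, rule Ck_on_compose_linear) auto

lemma smooth_on_inverse:
  fixes f :: "'a::real_normed_vector \<Rightarrow> real"
  shows "open S \<Longrightarrow> smooth_on S f \<Longrightarrow> (\<And>x. x \<in> S \<Longrightarrow> f x \<noteq> 0) \<Longrightarrow> smooth_on S (\<lambda>x. inverse (f x))"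
  unfolding smooth_on_def by (intro allI, rule Ck_on_inverse) auto

lemma smooth_on_mult:
  fixes f g :: "'a::real_normed_vector \<Rightarrow> real"
  shows "open S \<Longrightarrow> smooth_on S f \<Longrightarrow> smooth_on S g \<Longrightarrow> smooth_on S (\<lambda>x. f x * g x)"
  by (rule smooth_on_bilinear[OF bounded_bilinear_mult])

lemma smooth_on_prod:
  fixes f :: "'i \<Rightarrow> 'a::real_normed_vector \<Rightarrow> real"
  assumes "open S" "\<And>i. i \<in> A \<Longrightarrow> smooth_on S (f i)"
  shows "smooth_on S (\<lambda>x. \<Prod>i\<in>A. f i x)"
  using assms(2)
  by (induction A rule: infinite_finite_induct) (auto intro: smooth_on_const smooth_on_mult assms(1))

lemma smooth_on_vec:
  fixes f :: "'a::real_normed_vector \<Rightarrow> 'b::euclidean_space ^ 'n"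
  assumes "open S" "\<And>i. smooth_on S (\<lambda>x. f x $ i)"
  shows "smooth_on S f"
proof -
  have l: "bounded_linear (axis i :: 'b \<Rightarrow> 'b ^ 'n)" for i
    unfolding linear_conv_bounded_linear[symmetric] by (auto simp: linear_iff axis_def vec_eq_iff)
  have "smooth_on S (\<lambda>x. \<Sum>i\<in>UNIV. axis i (f x $ i))"
    by (intro smooth_on_sum smooth_on_bounded_linear[OF l] assms)
  moreover have "(\<Sum>i\<in>UNIV. axis i (f x $ i)) = f x" for x
    by (simp add: vec_eq_iff axis_def if_distrib sum.delta cong: if_cong)
  ultimately show ?thesis by simp
qed

lemma smooth_on_vec_nth:
  fixes f :: "'a::real_normed_vector \<Rightarrow> 'b::real_normed_vector ^ 'n"
  shows "open S \<Longrightarrow> smooth_on S f \<Longrightarrow> smooth_on S (\<lambda>x. f x $ i)"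
  by (rule smooth_on_bounded_linear[OF bounded_linear_vec_nth])

lemma smooth_on_det:
  fixes F :: "'a::real_normed_vector \<Rightarrow> real ^ 'n ^ 'n"
  assumes "open S" "\<And>i j. smooth_on S (\<lambda>x. F x $ i $ j)"
  shows "smooth_on S (\<lambda>x. det (F x))"
  unfolding det_def by (intro smooth_on_sum smooth_on_mult smooth_on_const smooth_on_prod assms)

text \<open>Two applications of the mean value theorem.\<close>

lemma second_difference:
  fixes f :: "'a::real_normed_vector \<Rightarrow> real"
  assumes S: "open S" and f: "smooth_on S f" and "s > 0"
    and sub: "\<And>p q. 0 \<le> p \<Longrightarrow> p \<le> s \<Longrightarrow> 0 \<le> q \<Longrightarrow> q \<le> s \<Longrightarrow> x + p *\<^sub>R v + q *\<^sub>R w \<in> S"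
  obtains p q where "0 \<le> p" "p \<le> s" "0 \<le> q" "q \<le> s"
    "f (x + s *\<^sub>R v + s *\<^sub>R w) - f (x + s *\<^sub>R v) - f (x + s *\<^sub>R w) + f x
      = s * s * dir_deriv (\<lambda>y. dir_deriv f y v) (x + p *\<^sub>R v + q *\<^sub>R w) w"
proof -
  have D: "((\<lambda>r. g (y + r *\<^sub>R u)) has_real_derivative dir_deriv g (y + r *\<^sub>R u) u) (at r)"
    if "smooth_on S g" "y + r *\<^sub>R u \<in> S" for g :: "'a \<Rightarrow> real" and y u r
  proof -
    have d: "(g has_derivative dir_deriv g (y + r *\<^sub>R u)) (at (y + r *\<^sub>R u))"
      using smooth_on_has_derivative[OF that(1) S that(2)] .
    have "((\<lambda>r. g (y + r *\<^sub>R u)) has_derivative (\<lambda>h. dir_deriv g (y + r *\<^sub>R u) (h *\<^sub>R u))) (at r)"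
      by (rule has_derivative_compose[where f="\<lambda>r. y + r *\<^sub>R u" and g=g])
         (auto intro!: derivative_eq_intros d)
    moreover have "dir_deriv g (y + r *\<^sub>R u) (h *\<^sub>R u) = dir_deriv g (y + r *\<^sub>R u) u * h" for h
      using linear_cmul[OF has_derivative_linear[OF d]] by simp
    ultimately show ?thesis by (simp add: has_field_derivative_def)
  qed
  have D1: "((\<lambda>r. f (x + r *\<^sub>R v + s *\<^sub>R w) - f (x + r *\<^sub>R v)) has_real_derivative
      dir_deriv f (x + r *\<^sub>R v + s *\<^sub>R w) v - dir_deriv f (x + r *\<^sub>R v) v) (at r)"
    if "0 \<le> r" "r \<le> s" for r
  proof (rule DERIV_diff)
    show "((\<lambda>r. f (x + r *\<^sub>R v + s *\<^sub>R w)) has_real_derivative dir_deriv f (x + r *\<^sub>R v + s *\<^sub>R w) v) (at r)"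
      using D[OF f, of "x + s *\<^sub>R w" r v] sub[of r s] that \<open>s > 0\<close> by (simp add: algebra_simps)
    show "((\<lambda>r. f (x + r *\<^sub>R v)) has_real_derivative dir_deriv f (x + r *\<^sub>R v) v) (at r)"
      using D[OF f, of x r v] sub[of r 0] that \<open>s > 0\<close> by simp
  qed
  obtain p where p: "0 < p" "p < s"
    and 1: "(f (x + s *\<^sub>R v + s *\<^sub>R w) - f (x + s *\<^sub>R v)) - (f (x + 0 *\<^sub>R v + s *\<^sub>R w) - f (x + 0 *\<^sub>R v))
       = (s - 0) * (dir_deriv f (x + p *\<^sub>R v + s *\<^sub>R w) v - dir_deriv f (x + p *\<^sub>R v) v)"
    using MVT2[OF \<open>s > 0\<close> D1] by blast
  have D2: "((\<lambda>r. dir_deriv f (x + p *\<^sub>R v + r *\<^sub>R w) v) has_real_derivative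
      dir_deriv (\<lambda>y. dir_deriv f y v) (x + p *\<^sub>R v + r *\<^sub>R w) w) (at r)"
    if "0 \<le> r" "r \<le> s" for r
    using D[OF smooth_on_dir_deriv[OF f], of "x + p *\<^sub>R v" r w v] sub[of p r] that p by simp
  obtain q where q: "0 < q" "q < s"
    and 2: "dir_deriv f (x + p *\<^sub>R v + s *\<^sub>R w) v - dir_deriv f (x + p *\<^sub>R v + 0 *\<^sub>R w) v
       = (s - 0) * dir_deriv (\<lambda>y. dir_deriv f y v) (x + p *\<^sub>R v + q *\<^sub>R w) w"
    using MVT2[OF \<open>s > 0\<close> D2] by blast
  show thesis
    by (rule that[of p q]) (use p q 1 2 in \<open>auto simp: algebra_simps\<close>)
qed

text \<open>The second difference over the parallelogram with sides s v and s w is symmetric in v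
  and w, and it equals s^2 times either mixed derivative at some point of the parallelogram.
  Continuity of both mixed derivatives at x then identifies them.\<close>

lemma dir_deriv_commute_real:
  fixes f :: "'a::real_normed_vector \<Rightarrow> real"
  assumes S: "open S" and f: "smooth_on S f" and x: "x \<in> S"
  shows "dir_deriv (\<lambda>y. dir_deriv f y v) x w = dir_deriv (\<lambda>y. dir_deriv f y w) x v"
proof -
  define a where "a = (\<lambda>z. dir_deriv (\<lambda>y. dir_deriv f y v) z w)"
  define b where "b = (\<lambda>z. dir_deriv (\<lambda>y. dir_deriv f y w) z v)"
  have "continuous_on S a" "continuous_on S b"
    unfolding a_def b_def by (intro smooth_on_continuous smooth_on_dir_deriv f)+
  then have ca: "isCont a x" "isCont b x"
    using S x continuous_on_eq_continuous_at by blast+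
  have "\<bar>a x - b x\<bar> \<le> e" if "e > 0" for e
  proof -
    obtain d1 where d1: "d1 > 0" "\<And>y. dist y x < d1 \<Longrightarrow> dist (a y) (a x) < e/2"
      using ca(1) \<open>e > 0\<close> unfolding continuous_at_eps_delta
      by (metis half_gt_zero)
    obtain d2 where d2: "d2 > 0" "\<And>y. dist y x < d2 \<Longrightarrow> dist (b y) (b x) < e/2"
      using ca(2) \<open>e > 0\<close> unfolding continuous_at_eps_delta
      by (metis half_gt_zero)
    obtain d3 where d3: "d3 > 0" "ball x d3 \<subseteq> S"
      using S x openE by blast
    define d where "d = min d1 (min d2 d3)"
    \<comment> \<open>Small enough to keep the parallelogram within d/2 of x; the summand 1 covers v
      = w = 0.\<close>
    define s where "s = d / (norm v + norm w + 1) / 2"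
    have n: "norm v + norm w + 1 > 0" by (simp add: add_nonneg_pos)
    have dpos: "d > 0" using d1(1) d2(1) d3(1) by (simp add: d_def)
    then have s: "s > 0" using n by (simp add: s_def)
    have near: "dist (x + p *\<^sub>R v' + q *\<^sub>R w') x < d"
      if "0 \<le> p" "p \<le> s" "0 \<le> q" "q \<le> s" "norm v' + norm w' = norm v + norm w" for p q v' w'
    proof -
      have "dist (x + p *\<^sub>R v' + q *\<^sub>R w') x = norm (p *\<^sub>R v' + q *\<^sub>R w')" by (simp add: dist_norm)
      also have "\<dots> \<le> p * norm v' + q * norm w'" using norm_triangle_ineq[of "p *\<^sub>R v'" "q *\<^sub>R w'"] that by simp
      also have "\<dots> \<le> s * norm v' + s * norm w'" using that by (intro add_mono mult_right_mono) auto
      also have "\<dots> = s * (norm v + norm w)" using that(5) by (simp flip: distrib_left)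
      also have "\<dots> \<le> s * (norm v + norm w + 1)" using s by simp
      also have "\<dots> = d / 2" using n unfolding s_def by (simp del: distrib_left_numeral distrib_right_numeral)
      finally show ?thesis using dpos by simp
    qed
    have inS: "y \<in> S" if "dist y x < d" for y
      using that d3 by (auto simp: d_def dist_commute)
    obtain p q where 1: "0 \<le> p" "p \<le> s" "0 \<le> q" "q \<le> s"
      "f (x + s *\<^sub>R v + s *\<^sub>R w) - f (x + s *\<^sub>R v) - f (x + s *\<^sub>R w) + f x = s * s * a (x + p *\<^sub>R v + q *\<^sub>R w)"
      using second_difference[OF S f s, of x v w] near[of _ _ v w] inS unfolding a_def by (smt (verit, best))
    obtain p' q' where 2: "0 \<le> p'" "p' \<le> s" "0 \<le> q'" "q' \<le> s"
      "f (x + s *\<^sub>R w + s *\<^sub>R v) - f (x + s *\<^sub>R w) - f (x + s *\<^sub>R v) + f x = s * s * b (x + p' *\<^sub>R w + q' *\<^sub>R v)"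
      using second_difference[OF S f s, of x w v] near[of _ _ w v] inS unfolding b_def by (smt (verit, best))
    have "x + s *\<^sub>R w + s *\<^sub>R v = x + s *\<^sub>R v + s *\<^sub>R w" by (simp add: algebra_simps)
    then have "s * s * a (x + p *\<^sub>R v + q *\<^sub>R w) = s * s * b (x + p' *\<^sub>R w + q' *\<^sub>R v)"
      using 1(5) 2(5) by (simp only:)
    then have eq: "a (x + p *\<^sub>R v + q *\<^sub>R w) = b (x + p' *\<^sub>R w + q' *\<^sub>R v)" using s by simp
    have "dist (a (x + p *\<^sub>R v + q *\<^sub>R w)) (a x) < e/2"
      using d1(2) near[of p q v w] 1 by (simp add: d_def)
    moreover have "dist (b (x + p' *\<^sub>R w + q' *\<^sub>R v)) (b x) < e/2"
      using d2(2) near[of p' q' w v] 2 by (simp add: d_def)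
    ultimately show ?thesis using eq unfolding dist_real_def by linarith
  qed
  then have "\<bar>a x - b x\<bar> \<le> 0" by (rule field_le_epsilon[where y=0, simplified])
  then show ?thesis by (simp add: a_def b_def)
qed

lemma dir_deriv_bounded_linear:
  assumes "bounded_linear L" "(f has_derivative f') (at x)"
  shows "dir_deriv (\<lambda>y. L (f y)) x v = L (dir_deriv f x v)"
  using dir_deriv_eq[OF bounded_linear.has_derivative[OF assms]] dir_deriv_eq[OF assms(2)] by simp

lemma dir_deriv_commute:
  fixes f :: "'a::real_normed_vector \<Rightarrow> 'b::euclidean_space"
  assumes S: "open S" and f: "smooth_on S f" and x: "x \<in> S"
  shows "dir_deriv (\<lambda>y. dir_deriv f y v) x w = dir_deriv (\<lambda>y. dir_deriv f y w) x v"
proof (rule euclidean_eqI)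
  fix b :: 'b assume "b \<in> Basis"
  have L: "bounded_linear (\<lambda>z::'b. z \<bullet> b)" by (rule bounded_linear_inner_left)
  have *: "dir_deriv (\<lambda>y. dir_deriv f y v) x w \<bullet> b = dir_deriv (\<lambda>y. dir_deriv (\<lambda>z. f z \<bullet> b) y v) x w" for v w
  proof -
    have "dir_deriv (\<lambda>y. dir_deriv f y v) x w \<bullet> b = dir_deriv (\<lambda>y. dir_deriv f y v \<bullet> b) x w"
      by (rule dir_deriv_bounded_linear[OF L, symmetric])
         (rule smooth_on_has_derivative[OF smooth_on_dir_deriv[OF f] S x])
    also have "\<dots> = dir_deriv (\<lambda>y. dir_deriv (\<lambda>z. f z \<bullet> b) y v) x w"
      by (intro dir_deriv_cong[OF S x] dir_deriv_bounded_linear[OF L smooth_on_has_derivative[OF f S], symmetric])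
    finally show ?thesis .
  qed
  show "dir_deriv (\<lambda>y. dir_deriv f y v) x w \<bullet> b = dir_deriv (\<lambda>y. dir_deriv f y w) x v \<bullet> b"
    unfolding * by (rule dir_deriv_commute_real[OF S smooth_on_bounded_linear[OF L S f] x])
qed

section \<open>Smooth curves and iterated derivatives\<close>

text \<open>The derivative is an existential witness rather than \<open>vector_derivative\<close>,
  so that a closure proof can hand over a formula, for instance the right side of a differential
  equation.\<close>

primrec kdiff :: "nat \<Rightarrow> real set \<Rightarrow> (real \<Rightarrow> 'b::real_normed_vector) \<Rightarrow> bool" where
  "kdiff 0 I h \<longleftrightarrow> True"
| "kdiff (Suc k) I h \<longleftrightarrow> (\<exists>h'. (\<forall>t\<in>I. (h has_vector_derivative h' t) (at t)) \<and> kdiff k I h')"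

definition smooth_curve :: "real set \<Rightarrow> (real \<Rightarrow> 'b::real_normed_vector) \<Rightarrow> bool" where
  "smooth_curve I h \<longleftrightarrow> (\<forall>k. kdiff k I h)"

lemma kdiff_cong:
  assumes "open I" "kdiff k I f" "\<And>t. t \<in> I \<Longrightarrow> f t = g t"
  shows "kdiff k I g"
  using assms(2,3)
proof (cases k)
  case (Suc j)
  then obtain h' where h': "\<forall>t\<in>I. (f has_vector_derivative h' t) (at t)" "kdiff j I h'"
    using assms(2) by auto
  have "\<forall>t\<in>I. (g has_vector_derivative h' t) (at t)"
    using h'(1) has_vector_derivative_transform_within_open[OF _ assms(1), of f _ _ g] assms(3) by blast
  with h'(2) Suc show ?thesis by auto
qed simp

lemma kdiff_SucD: "kdiff (Suc k) I h \<Longrightarrow> kdiff k I h"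
  by (induction k arbitrary: h) auto

lemma kdiff_subset: "kdiff k I h \<Longrightarrow> J \<subseteq> I \<Longrightarrow> kdiff k J h"
  by (induction k arbitrary: h) (simp, force)

lemma kdiff_const: "kdiff k I (\<lambda>t. a)"
proof (induction k arbitrary: a)
  case (Suc k)
  have "\<forall>t\<in>I. ((\<lambda>t. a) has_vector_derivative 0) (at t)" by (auto intro!: derivative_eq_intros)
  then show ?case using Suc[of 0] by (auto intro!: exI[of _ "\<lambda>_. 0"])
qed simp

lemma kdiff_id: "kdiff k I (\<lambda>t. t)"
proof (cases k)
  case (Suc k)
  have "\<forall>t\<in>I. ((\<lambda>t::real. t) has_vector_derivative 1) (at t)" by (auto intro!: derivative_eq_intros)
  then show ?thesis using kdiff_const[of k I 1] Suc by (auto intro!: exI[of _ "\<lambda>_. 1"])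
qed simp

lemma kdiff_add: "kdiff k I f \<Longrightarrow> kdiff k I g \<Longrightarrow> kdiff k I (\<lambda>t. f t + g t)"
proof (induction k arbitrary: f g)
  case (Suc k)
  then obtain f' g' where "\<forall>t\<in>I. (f has_vector_derivative f' t) (at t)" "kdiff k I f'"
    "\<forall>t\<in>I. (g has_vector_derivative g' t) (at t)" "kdiff k I g'" by auto
  then show ?case using Suc.IH
    by (auto intro!: exI[of _ "\<lambda>t. f' t + g' t"] derivative_intros)
qed simp

lemma kdiff_sum: "(\<And>i. i \<in> A \<Longrightarrow> kdiff k I (f i)) \<Longrightarrow> kdiff k I (\<lambda>t. \<Sum>i\<in>A. f i t)"
  by (induction A rule: infinite_finite_induct) (auto intro: kdiff_add kdiff_const)

lemma kdiff_bounded_linear: "bounded_linear L \<Longrightarrow> kdiff k I f \<Longrightarrow> kdiff k I (\<lambda>t. L (f t))"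
proof (induction k arbitrary: f)
  case (Suc k)
  then obtain f' where "\<forall>t\<in>I. (f has_vector_derivative f' t) (at t)" "kdiff k I f'" by auto
  then have "\<forall>t\<in>I. ((\<lambda>t. L (f t)) has_vector_derivative L (f' t)) (at t)" "kdiff k I (\<lambda>t. L (f' t))"
    using bounded_linear.has_vector_derivative[OF Suc.prems(1)] Suc by blast+
  then show ?case by auto
qed simp

lemma kdiff_bilinear:
  "bounded_bilinear p \<Longrightarrow> kdiff k I f \<Longrightarrow> kdiff k I g \<Longrightarrow> kdiff k I (\<lambda>t. p (f t) (g t))"
proof (induction k arbitrary: f g)
  case (Suc k)
  then obtain f' g' where "\<forall>t\<in>I. (f has_vector_derivative f' t) (at t)" "kdiff k I f'"
    "\<forall>t\<in>I. (g has_vector_derivative g' t) (at t)" "kdiff k I g'" by auto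
  then show ?case using Suc.IH[OF Suc.prems(1)] kdiff_SucD[OF Suc.prems(2)] kdiff_SucD[OF Suc.prems(3)] Suc.prems(1)
    by (auto intro!: exI[of _ "\<lambda>t. p (f t) (g' t) + p (f' t) (g t)"]
        bounded_bilinear.has_vector_derivative kdiff_add)
qed simp

lemma kdiff_inverse:
  fixes f :: "real \<Rightarrow> real"
  shows "kdiff k I f \<Longrightarrow> (\<And>t. t \<in> I \<Longrightarrow> f t \<noteq> 0) \<Longrightarrow> kdiff k I (\<lambda>t. inverse (f t))"
proof (induction k)
  case (Suc k)
  then obtain f' where f': "\<forall>t\<in>I. (f has_vector_derivative f' t) (at t)" "kdiff k I f'" by auto
  have i: "kdiff k I (\<lambda>t. inverse (f t))" using Suc kdiff_SucD by blast
  have "kdiff k I (\<lambda>t. - (inverse (f t) * f' t * inverse (f t)))"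
    using kdiff_bounded_linear[OF bounded_linear_minus[OF bounded_linear_ident]
     kdiff_bilinear[OF bounded_bilinear_mult kdiff_bilinear[OF bounded_bilinear_mult i f'(2)] i]] by simp
  moreover have "\<forall>t\<in>I. ((\<lambda>t. inverse (f t)) has_vector_derivative - (inverse (f t) * f' t * inverse (f t))) (at t)"
    using f'(1) Suc.prems(2)
    by (auto simp: has_real_derivative_iff_has_vector_derivative[symmetric] intro!: DERIV_inverse_fun[THEN DERIV_cong])
  ultimately show ?case by auto
qed simp

lemma has_vector_derivative_compose_dir:
  assumes "(f has_derivative f') (at (c t))" "(c has_vector_derivative c') (at t)"
  shows "((\<lambda>t. f (c t)) has_vector_derivative f' c') (at t)"
  using vector_derivative_diff_chain_within[of c c' t UNIV f f'] assms
  by (simp add: o_def has_derivative_at_withinI)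

text \<open>\<open>Ck_on\<close> controls directional derivatives in fixed directions, whereas the
  velocity of c varies. The derivative of \<open>f (c t)\<close> is therefore expanded over
  \<open>Basis\<close>, with the components of the velocity as coefficients.\<close>

lemma kdiff_compose:
  fixes c :: "real \<Rightarrow> 'a::euclidean_space"
  assumes "open S" "c ` I \<subseteq> S" "smooth_on S f" "kdiff k I c"
  shows "kdiff k I (\<lambda>t. f (c t))"
  using assms(3,4)
proof (induction k arbitrary: f)
  case (Suc k)
  obtain c' where c': "\<forall>t\<in>I. (c has_vector_derivative c' t) (at t)" "kdiff k I c'" using Suc.prems by auto
  have kc: "kdiff k I c" using Suc.prems kdiff_SucD by blast
  have 1: "kdiff k I (\<lambda>t. \<Sum>b\<in>Basis. (c' t \<bullet> b) *\<^sub>R dir_deriv f (c t) b)"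
    by (intro kdiff_sum kdiff_bilinear[OF bounded_bilinear_scaleR]
        kdiff_bounded_linear[OF bounded_linear_inner_left] c' Suc.IH smooth_on_dir_deriv Suc.prems kc)
  have "((\<lambda>t. f (c t)) has_vector_derivative (\<Sum>b\<in>Basis. (c' t \<bullet> b) *\<^sub>R dir_deriv f (c t) b)) (at t)" if "t \<in> I" for t
  proof -
    have d: "(f has_derivative dir_deriv f (c t)) (at (c t))"
      using that assms Suc.prems by (intro smooth_on_has_derivative) auto
    have "dir_deriv f (c t) (c' t) = (\<Sum>b\<in>Basis. (c' t \<bullet> b) *\<^sub>R dir_deriv f (c t) b)"
      by (subst euclidean_representation[of "c' t", symmetric])
         (simp only: linear_sum[OF has_derivative_linear[OF d]] linear_cmul[OF has_derivative_linear[OF d]])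
    then show ?thesis using has_vector_derivative_compose_dir[of f _ c t, OF d] c'(1) that by metis
  qed
  with 1 show ?case by (simp, intro exI[of _ "\<lambda>t. \<Sum>b\<in>Basis. (c' t \<bullet> b) *\<^sub>R dir_deriv f (c t) b"]) simp
qed simp

section \<open>Iterated derivatives of curves and the Leibniz rule\<close>

abbreviation vderiv :: "(real \<Rightarrow> 'b::real_normed_vector) \<Rightarrow> real \<Rightarrow> 'b" where
  "vderiv h \<equiv> (\<lambda>t. vector_derivative h (at t))"

definition nderiv :: "nat \<Rightarrow> (real \<Rightarrow> 'b::real_normed_vector) \<Rightarrow> real \<Rightarrow> 'b" where
  "nderiv k h = (vderiv ^^ k) h"

lemma nderiv_0 [simp]: "nderiv 0 h = h" by (simp add: nderiv_def)

lemma nderiv_Suc: "nderiv (Suc k) h = vderiv (nderiv k h)" by (simp add: nderiv_def)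

lemma nderiv_Suc': "nderiv (Suc k) h = nderiv k (vderiv h)"
  unfolding nderiv_def funpow_Suc_right by simp

lemma smooth_curve_imp:
  assumes "smooth_curve I h" "open I"
  shows "smooth_curve I (vderiv h)" "t \<in> I \<Longrightarrow> (h has_vector_derivative vderiv h t) (at t)"
proof -
  have *: "\<exists>h'. (\<forall>t\<in>I. (h has_vector_derivative h' t) (at t)) \<and> kdiff k I h'" for k
    using assms(1) unfolding smooth_curve_def kdiff.simps(2)[symmetric] by blast
  from *[of 0] show "t \<in> I \<Longrightarrow> (h has_vector_derivative vderiv h t) (at t)"
    by (metis vector_derivative_at)
  show "smooth_curve I (vderiv h)"
    unfolding smooth_curve_def
  proof
    fix k
    obtain h' where "\<forall>t\<in>I. (h has_vector_derivative h' t) (at t)" "kdiff k I h'" using * by blast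
    then show "kdiff k I (vderiv h)"
      using kdiff_cong[OF assms(2), of k h' "vderiv h"] vector_derivative_at by metis
  qed
qed

lemma smooth_curve_nderiv: "smooth_curve I h \<Longrightarrow> open I \<Longrightarrow> smooth_curve I (nderiv k h)"
  by (induction k) (auto simp: nderiv_Suc smooth_curve_imp)

lemma nderiv_has: "smooth_curve I h \<Longrightarrow> open I \<Longrightarrow> t \<in> I \<Longrightarrow>
   (nderiv k h has_vector_derivative nderiv (Suc k) h t) (at t)"
  unfolding nderiv_Suc by (rule smooth_curve_imp(2)[OF smooth_curve_nderiv])

lemma smooth_curve_cong: "smooth_curve I f \<Longrightarrow> open I \<Longrightarrow> (\<And>t. t \<in> I \<Longrightarrow> f t = g t) \<Longrightarrow> smooth_curve I g"
  unfolding smooth_curve_def by (intro allI, rule kdiff_cong[of I _ f]) auto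
lemma smooth_curve_subset: "smooth_curve I f \<Longrightarrow> J \<subseteq> I \<Longrightarrow> smooth_curve J f"
  unfolding smooth_curve_def by (intro allI, rule kdiff_subset[of _ I]) auto
lemma smooth_curve_const: "smooth_curve I (\<lambda>t. a)"
  unfolding smooth_curve_def by (intro allI kdiff_const)
lemma smooth_curve_id: "smooth_curve I (\<lambda>t. t)"
  unfolding smooth_curve_def by (intro allI kdiff_id)
lemma smooth_curve_add: "smooth_curve I f \<Longrightarrow> smooth_curve I g \<Longrightarrow> smooth_curve I (\<lambda>t. f t + g t)"
  unfolding smooth_curve_def by (intro allI, rule kdiff_add) auto
lemma smooth_curve_sum: "(\<And>i. i \<in> A \<Longrightarrow> smooth_curve I (f i)) \<Longrightarrow> smooth_curve I (\<lambda>t. \<Sum>i\<in>A. f i t)"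
  unfolding smooth_curve_def by (intro allI, rule kdiff_sum) auto
lemma smooth_curve_bounded_linear: "bounded_linear L \<Longrightarrow> smooth_curve I f \<Longrightarrow> smooth_curve I (\<lambda>t. L (f t))"
  unfolding smooth_curve_def by (intro allI, rule kdiff_bounded_linear) auto
lemma smooth_curve_bilinear: "bounded_bilinear p \<Longrightarrow> smooth_curve I f \<Longrightarrow> smooth_curve I g \<Longrightarrow> smooth_curve I (\<lambda>t. p (f t) (g t))"
  unfolding smooth_curve_def by (intro allI, rule kdiff_bilinear) auto
lemma smooth_curve_inverse:
  fixes f :: "real \<Rightarrow> real"
  shows "smooth_curve I f \<Longrightarrow> (\<And>t. t \<in> I \<Longrightarrow> f t \<noteq> 0) \<Longrightarrow> smooth_curve I (\<lambda>t. inverse (f t))"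
  unfolding smooth_curve_def by (intro allI, rule kdiff_inverse) auto
lemma smooth_curve_compose:
  fixes c :: "real \<Rightarrow> 'a::euclidean_space"
  shows "open S \<Longrightarrow> c ` I \<subseteq> S \<Longrightarrow> smooth_on S f \<Longrightarrow> smooth_curve I c \<Longrightarrow> smooth_curve I (\<lambda>t. f (c t))"
  unfolding smooth_curve_def by (intro allI, rule kdiff_compose[of S c I f]) auto
lemma smooth_curve_prod:
  fixes f :: "'i \<Rightarrow> real \<Rightarrow> real"
  shows "(\<And>i. i \<in> A \<Longrightarrow> smooth_curve I (f i)) \<Longrightarrow> smooth_curve I (\<lambda>t. \<Prod>i\<in>A. f i t)"
  by (induction A rule: infinite_finite_induct)
     (auto intro: smooth_curve_const smooth_curve_bilinear[OF bounded_bilinear_mult])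

lemma smooth_curve_continuous_on:
  assumes "smooth_curve I h" "open I"
  shows "continuous_on I h"
  using smooth_curve_imp(2)[OF assms] assms(2)
  by (meson continuous_at_imp_continuous_on has_vector_derivative_continuous)

lemma nderiv_cong:
  assumes "open I" "\<And>t. t \<in> I \<Longrightarrow> f t = g t" "t \<in> I"
  shows "nderiv k f t = nderiv k g t"
  using assms(3)
proof (induction k arbitrary: t)
  case 0
  then show ?case using assms(2) by simp
next
  case (Suc k)
  have "\<forall>\<^sub>F s in nhds t. s \<in> I" using assms(1) Suc.prems by (simp add: eventually_nhds) blast
  then have "\<forall>\<^sub>F s in nhds t. nderiv k f s = nderiv k g s" by (rule eventually_mono) (rule Suc.IH)
  then show ?case unfolding nderiv_Suc by (intro vector_derivative_cong_eq) auto
qed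

lemma nderiv_add:
  assumes "open I" "smooth_curve I f" "smooth_curve I g" "t \<in> I"
  shows "nderiv k (\<lambda>t. f t + g t) t = nderiv k f t + nderiv k g t"
  using assms(4)
proof (induction k arbitrary: t)
  case (Suc k)
  have "nderiv (Suc k) (\<lambda>t. f t + g t) t = vderiv (\<lambda>t. nderiv k f t + nderiv k g t) t"
    using nderiv_cong[OF assms(1) Suc.IH, of "\<lambda>t. t" t "Suc 0"] Suc.prems
    by (simp add: nderiv_Suc)
  also have "\<dots> = nderiv (Suc k) f t + nderiv (Suc k) g t"
    by (intro vector_derivative_at has_vector_derivative_add nderiv_has[OF _ assms(1)] assms Suc.prems)
  finally show ?case .
qed simp

lemma nderiv_bounded_linear:
  assumes "open I" "bounded_linear L" "smooth_curve I f" "t \<in> I"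
  shows "nderiv k (\<lambda>t. L (f t)) t = L (nderiv k f t)"
  using assms(4)
proof (induction k arbitrary: t)
  case (Suc k)
  have "nderiv (Suc k) (\<lambda>t. L (f t)) t = vderiv (\<lambda>t. L (nderiv k f t)) t"
    using nderiv_cong[OF assms(1) Suc.IH, of "\<lambda>t. t" t "Suc 0"] Suc.prems
    by (simp add: nderiv_Suc)
  also have "\<dots> = L (nderiv (Suc k) f t)"
    by (intro vector_derivative_at bounded_linear.has_vector_derivative[OF assms(2)] nderiv_has[OF _ assms(1)] assms Suc.prems)
  finally show ?case .
qed simp

lemma leibniz_bilinear:
  assumes "bounded_bilinear p" "open I" "smooth_curve I f" "smooth_curve I g" "t \<in> I"
  shows "nderiv k (\<lambda>t. p (f t) (g t)) t = (\<Sum>i\<le>k. of_nat (k choose i) *\<^sub>R p (nderiv i f t) (nderiv (k - i) g t))"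
  using assms(3-)
proof (induction k arbitrary: f g t)
  case (Suc k)
  note [simp] = smooth_curve_imp[OF Suc.prems(1) assms(2)] smooth_curve_imp[OF Suc.prems(2) assms(2)]
  have "nderiv (Suc k) (\<lambda>t. p (f t) (g t)) t = nderiv k (\<lambda>t. p (f t) (vderiv g t) + p (vderiv f t) (g t)) t"
    unfolding nderiv_Suc'
    by (rule nderiv_cong[OF assms(2) _ Suc.prems(3)])
       (auto intro!: vector_derivative_at bounded_bilinear.has_vector_derivative[OF assms(1)])
  also have "\<dots> = nderiv k (\<lambda>t. p (f t) (vderiv g t)) t + nderiv k (\<lambda>t. p (vderiv f t) (g t)) t"
    by (intro nderiv_add[OF assms(2)] smooth_curve_bilinear[OF assms(1)] Suc.prems) simp_all
  also have "\<dots> = (\<Sum>i\<le>k. of_nat (k choose i) *\<^sub>R p (nderiv i f t) (nderiv (Suc (k - i)) g t))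
      + (\<Sum>i\<le>k. of_nat (k choose i) *\<^sub>R p (nderiv (Suc i) f t) (nderiv (k - i) g t))"
    by (simp add: Suc.IH Suc.prems nderiv_Suc')
  \<comment> \<open>The added summand i = Suc k vanishes because \<open>k choose Suc k\<close> is 0;
    after the index shift, Pascal's rule merges both sums.\<close>
  also have "(\<Sum>i\<le>k. of_nat (k choose i) *\<^sub>R p (nderiv i f t) (nderiv (Suc (k - i)) g t))
     = (\<Sum>i\<le>Suc k. of_nat (k choose i) *\<^sub>R p (nderiv i f t) (nderiv (Suc k - i) g t))"
    by (simp add: Suc_diff_le)
  also have "\<dots> = p f' (nderiv (Suc k) g t) + (\<Sum>i\<le>k. of_nat (k choose Suc i) *\<^sub>R p (nderiv (Suc i) f t) (nderiv (k - i) g t))"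
    if "f' = f t" for f'
    unfolding that by (subst sum.atMost_Suc_shift) simp
  finally show ?case
    unfolding sum.atMost_Suc_shift by (simp add: sum.distrib[symmetric] scaleR_add_left[symmetric] add.commute)
qed simp

text \<open>No differentiability is assumed: both sides iterate the same operator, since
  \<open>dir_deriv\<close> at a point of the ray in the direction of the ray is the time derivative
  along it. This reduces Taylor terms to derivatives of a function of one variable.\<close>

lemma dir_deriv_iterate:
  fixes f :: "'a::real_normed_vector \<Rightarrow> real"
  shows "((\<lambda>h x. dir_deriv h x \<xi>) ^^ k) f (t *\<^sub>R \<xi>) = nderiv k (\<lambda>t. f (t *\<^sub>R \<xi>)) t"
proof (induction k arbitrary: t)
  case (Suc k)
  have "((\<lambda>h x. dir_deriv h x \<xi>) ^^ Suc k) f (t *\<^sub>R \<xi>)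
     = vector_derivative (\<lambda>s. nderiv k (\<lambda>t. f (t *\<^sub>R \<xi>)) (t + s)) (at 0)"
    unfolding funpow.simps o_def by (subst dir_deriv_def) (simp only: scaleR_add_left[symmetric] Suc)
  also have "\<dots> = vderiv (nderiv k (\<lambda>t. f (t *\<^sub>R \<xi>))) t"
  proof -
    have "((\<lambda>s. h (t + s)) has_vector_derivative D) (at 0) \<longleftrightarrow> (h has_vector_derivative D) (at t)" for h :: "real \<Rightarrow> real" and D
      using DERIV_shift[of h D 0 t] unfolding has_real_derivative_iff_has_vector_derivative
      by (simp add: add.commute)
    then show ?thesis unfolding vector_derivative_def by simp
  qed
  finally show ?case by (simp add: nderiv_Suc)
qed simp

lemma taylor_term_eq_nderiv: "taylor_term k f \<xi> = nderiv k (\<lambda>t. f (t *\<^sub>R \<xi>)) 0 / fact k"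
  using dir_deriv_iterate[where t=0 and f=f and k=k and \<xi>=\<xi>] by (simp add: taylor_term_def)

section \<open>Ordinary differential equations on short time intervals\<close>

text \<open>The integrals start at -d and the value at 0 is subtracted, so two images under the
  Picard operator differ by two integrals over length at most 2 d each; this is the source of the
  factor 4. The Lipschitz bound is global in z, which spares any control of the range.\<close>

lemma picard_existence:
  fixes f :: "real \<Rightarrow> 'e::euclidean_space \<Rightarrow> 'e"
  assumes d: "0 < d" and L: "0 \<le> L" "4 * d * L < 1"
    and cont: "continuous_on ({-d..d} \<times> UNIV) (\<lambda>(t, z). f t z)"
    and lip: "\<And>t z w. t \<in> {-d..d} \<Longrightarrow> norm (f t z - f t w) \<le> L * norm (z - w)"
  shows "\<exists>z. z 0 = z0 \<and> (\<forall>t\<in>{-d<..<d}. (z has_vector_derivative f t (z t)) (at t))"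
proof -
  \<comment> \<open>Clamping time to [-d, d] makes the Picard operator act on bounded continuous
    functions on the whole line, a complete metric space.\<close>
  define cl where "cl t = max (-d) (min d t)" for t :: real
  define F where "F z t = integral {-d..t} (\<lambda>s. f s (z s))" for z :: "real \<Rightarrow> 'e" and t
  define T where "T z t = z0 + F z (cl t) - F z 0" for z t
  have cl: "cl t \<in> {-d..d}" for t using d by (auto simp: cl_def)
  have c_f: "continuous_on {-d..d} (\<lambda>s. f s (z s))" if "continuous_on UNIV z" for z
    using continuous_on_compose2[OF cont, of "{-d..d}" "\<lambda>s. (s, z s)"]
      continuous_on_Pair[OF continuous_on_id continuous_on_subset[OF that subset_UNIV], of "{-d..d}"]
    by fastforce
  have c_F: "continuous_on {-d..d} (F z)" if "continuous_on UNIV z" for z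
    unfolding F_def by (rule indefinite_integral_continuous_1[OF integrable_continuous_real[OF c_f[OF that]]])
  have T_b: "T z \<in> bcontfun" if "continuous_on UNIV z" for z
  proof -
    have ccl: "continuous_on UNIV cl" unfolding cl_def by (intro continuous_intros)
    have "continuous_on UNIV (\<lambda>t. F z (cl t))"
      by (rule continuous_on_compose2[OF c_F[OF that] ccl]) (use cl in auto)
    moreover have "bounded (range (\<lambda>t. F z (cl t)))"
      by (rule bounded_subset[OF compact_imp_bounded[OF compact_continuous_image[OF c_F[OF that] compact_Icc]]])
         (use cl in auto)
    ultimately have "(\<lambda>t. F z (cl t)) \<in> bcontfun" by (simp add: bcontfun_def)
    then have "(\<lambda>t. (\<lambda>t. F z (cl t)) t + (\<lambda>t. z0 - F z 0) t) \<in> bcontfun"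
      by (intro plus_cont const_bcontfun)
    then show ?thesis unfolding T_def by (simp add: algebra_simps)
  qed
  define TT where "TT z = Bcontfun (T (apply_bcontfun z))" for z
  have TT: "apply_bcontfun (TT z) = T (apply_bcontfun z)" for z
    unfolding TT_def by (rule Bcontfun_inverse[OF T_b]) simp
  have F_diff: "norm (F z t - F w t) \<le> 2 * d * (L * B)"
    if "continuous_on UNIV z" "continuous_on UNIV w" "t \<in> {-d..d}" "\<And>t. norm (z t - w t) \<le> B" for z w t B
  proof -
    have B: "0 \<le> B" using that(4)[of 0] norm_ge_zero order_trans by blast
    have i: "(\<lambda>s. f s (x s)) integrable_on {-d..t}" if "continuous_on UNIV x" for x
      by (intro integrable_continuous_real continuous_on_subset[OF c_f[OF that]])
         (use \<open>t \<in> {-d..d}\<close> in auto)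
    have "F z t - F w t = integral {-d..t} (\<lambda>s. f s (z s) - f s (w s))"
      unfolding F_def using i that by (simp add: integral_diff)
    also have "norm \<dots> \<le> (L * B) * (t - (-d))"
    proof (rule integral_bound)
      show "continuous_on {-d..t} (\<lambda>s. f s (z s) - f s (w s))"
        by (intro continuous_intros continuous_on_subset[OF c_f]) (use that in auto)
      show "norm (f s (z s) - f s (w s)) \<le> L * B" if "s \<in> {-d..t}" for s
        using lip[of s "z s" "w s"] that \<open>t \<in> {-d..d}\<close> \<open>norm (z s - w s) \<le> B\<close> L(1)
        by (smt (verit, best) atLeastAtMost_iff mult_left_mono)
    qed (use that in auto)
    also have "\<dots> \<le> (L * B) * (2 * d)"
      using that(3) B L(1) by (intro mult_left_mono) auto
    finally show ?thesis by (simp add: ac_simps)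
  qed
  have "\<exists>!z. TT z = z"
  proof (rule banach_fix_type[of "4 * d * L"])
    show "0 \<le> 4 * d * L" using d L by simp
    show "4 * d * L < 1" by (rule L)
    show "\<forall>z w. dist (TT z) (TT w) \<le> 4 * d * L * dist z w"
    proof (intro allI dist_bound)
      fix z w :: "real \<Rightarrow>\<^sub>C 'e" and t
      have b: "norm (apply_bcontfun z t - apply_bcontfun w t) \<le> dist z w" for t
        using dist_bounded[of z t w] by (simp add: dist_norm)
      have 1: "norm (F z (cl t) - F w (cl t)) \<le> 2 * d * (L * dist z w)"
        by (rule F_diff) (use cl b in auto)
      have 2: "norm (F z 0 - F w 0) \<le> 2 * d * (L * dist z w)"
        by (rule F_diff) (use d b in auto)
      have "dist (TT z t) (TT w t) = norm ((F z (cl t) - F w (cl t)) - (F z 0 - F w 0))"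
        by (simp add: TT T_def dist_norm algebra_simps)
      also have "\<dots> \<le> 2 * d * (L * dist z w) + 2 * d * (L * dist z w)"
        using norm_triangle_ineq4[of "F z (cl t) - F w (cl t)" "F z 0 - F w 0"] 1 2 by linarith
      finally show "dist (TT z t) (TT w t) \<le> 4 * d * L * dist z w" by (simp add: algebra_simps)
    qed
  qed
  then obtain z where z: "TT z = z" by auto
  have zc: "continuous_on UNIV (apply_bcontfun z)" by simp
  have eq: "apply_bcontfun z t = z0 + F z (cl t) - F z 0" for t
    using TT[of z] unfolding z T_def by metis
  show ?thesis
  proof (intro exI[of _ "apply_bcontfun z"] conjI ballI)
    show "apply_bcontfun z 0 = z0" using eq[of 0] d by (simp add: cl_def)
    fix t assume t: "t \<in> {-d<..<d}"
    have "(F z has_vector_derivative f t (z t)) (at t within {-d..d})"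
      unfolding F_def by (rule integral_has_vector_derivative[OF c_f[OF zc]]) (use t in auto)
    then have "(F z has_vector_derivative f t (z t)) (at t)"
      using t at_within_interior[of t "{-d..d}"] by (simp add: interior_atLeastAtMost_real)
    then have "((\<lambda>t. z0 + F z t - F z 0) has_vector_derivative f t (z t)) (at t)"
      by (auto intro!: derivative_eq_intros)
    then show "(apply_bcontfun z has_vector_derivative f t (z t)) (at t)"
      by (rule has_vector_derivative_transform_within_open[of _ _ _ "{-d<..<d}"])
         (use t in \<open>auto simp: eq cl_def\<close>)
  qed
qed

lemma vector_mean_value_bound:
  fixes h :: "real \<Rightarrow> 'b::real_normed_vector"
  assumes "\<And>s. \<bar>s\<bar> \<le> \<bar>t\<bar> \<Longrightarrow> (h has_vector_derivative h' s) (at s)"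
    and "\<And>s. \<bar>s\<bar> \<le> \<bar>t\<bar> \<Longrightarrow> norm (h' s) \<le> B"
  shows "norm (h t - h 0) \<le> B * \<bar>t\<bar>"
proof -
  have "norm (h t - h 0) \<le> B * norm (t - 0)"
  proof (rule differentiable_bound[of "{-\<bar>t\<bar>..\<bar>t\<bar>}" h "\<lambda>s r. r *\<^sub>R h' s"])
    show "(h has_derivative (\<lambda>r. r *\<^sub>R h' s)) (at s within {-\<bar>t\<bar>..\<bar>t\<bar>})" if "s \<in> {-\<bar>t\<bar>..\<bar>t\<bar>}" for s
      using has_derivative_at_withinI[OF assms(1)[of s, unfolded has_vector_derivative_def]] that by auto
    show "onorm (\<lambda>r. r *\<^sub>R h' s) \<le> B" if "s \<in> {-\<bar>t\<bar>..\<bar>t\<bar>}" for s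
    proof (rule onorm_le)
      fix r
      have "norm (h' s) \<le> B" using assms(2)[of s] that by auto
      then show "norm (r *\<^sub>R h' s) \<le> B * norm r"
        by (simp add: mult.commute[of B] mult_left_mono)
    qed
  qed auto
  then show ?thesis by simp
qed

text \<open>On a time interval this short, taking suprema replaces Gronwall's inequality.\<close>

lemma short_time_bound:
  fixes h :: "real \<Rightarrow> 'b::real_normed_vector"
  assumes h: "\<And>t. \<bar>t\<bar> < d \<Longrightarrow> (h has_vector_derivative h' t) (at t)" and h0: "h 0 = 0"
    and b: "\<And>t. \<bar>t\<bar> < d \<Longrightarrow> norm (h' t) \<le> L * norm (h t) + e"
    and L: "0 \<le> L" "d * L \<le> 1/2" and e: "0 \<le> e" and t: "\<bar>t\<bar> < d"
  shows "norm (h t) \<le> 2 * d * e"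
proof -
  have cont: "continuous_on {-\<bar>t\<bar>..\<bar>t\<bar>} (\<lambda>s. norm (h s))"
  proof (intro continuous_on_norm continuous_at_imp_continuous_on ballI)
    fix s assume "s \<in> {-\<bar>t\<bar>..\<bar>t\<bar>}"
    then have "\<bar>s\<bar> < d" using t by auto
    from has_vector_derivative_continuous[OF h[OF this]] show "isCont h s" .
  qed
  have ne: "{-\<bar>t\<bar>..\<bar>t\<bar>} \<noteq> {}" by simp
  obtain s where s: "s \<in> {-\<bar>t\<bar>..\<bar>t\<bar>}" and max: "\<And>r. r \<in> {-\<bar>t\<bar>..\<bar>t\<bar>} \<Longrightarrow> norm (h r) \<le> norm (h s)"
    using continuous_attains_sup[OF compact_Icc ne cont] by auto
  have "norm (h s - h 0) \<le> (L * norm (h s) + e) * \<bar>s\<bar>"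
  proof (rule vector_mean_value_bound)
    fix r assume r: "\<bar>r\<bar> \<le> \<bar>s\<bar>"
    then have rd: "\<bar>r\<bar> < d" "r \<in> {-\<bar>t\<bar>..\<bar>t\<bar>}" using s t by auto
    show "(h has_vector_derivative h' r) (at r)" by (rule h[OF rd(1)])
    show "norm (h' r) \<le> L * norm (h s) + e"
      using b[OF rd(1)] mult_left_mono[OF max[OF rd(2)] L(1)] by linarith
  qed
  also have "\<dots> \<le> (L * norm (h s) + e) * d"
    using s t L(1) e by (intro mult_left_mono) auto
  also have "\<dots> = (d * L) * norm (h s) + d * e" by (simp add: algebra_simps)
  also have "\<dots> \<le> 1/2 * norm (h s) + d * e"
    using L(2) by (intro add_right_mono mult_right_mono) auto
  finally have "norm (h s) \<le> 2 * d * e" by (simp add: h0)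
  moreover have "norm (h t) \<le> norm (h s)" by (rule max) (auto simp: abs_if)
  ultimately show ?thesis by linarith
qed

lemma Ck_on_Suc0_derivative_bound:
  fixes f :: "'e::euclidean_space \<Rightarrow> 'b::real_normed_vector"
  assumes W: "open W" and f: "Ck_on (Suc 0) W f" and K: "compact K" "K \<subseteq> W"
  obtains L where "0 \<le> L" "\<And>x u. x \<in> K \<Longrightarrow> norm (dir_deriv f x u) \<le> L * norm u"
proof -
  have lin: "linear (dir_deriv f x)" if "x \<in> K" for x
    using has_derivative_dir_deriv[OF f W] K that has_derivative_linear by blast
  have cont: "continuous_on K (\<lambda>x. \<Sum>b\<in>Basis. norm (dir_deriv f x b))"
    using f K(2) by (intro continuous_intros) (auto intro: continuous_on_subset)
  obtain L where L: "\<forall>x\<in>K. \<bar>\<Sum>b\<in>Basis. norm (dir_deriv f x b)\<bar> \<le> L" "0 \<le> L"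
    using compact_imp_bounded[OF compact_continuous_image[OF cont K(1)]]
    unfolding bounded_iff by (metis abs_ge_zero order_trans image_eqI linear real_norm_def)
  have "norm (dir_deriv f x u) \<le> L * norm u" if "x \<in> K" for x u
  proof -
    have "dir_deriv f x u = (\<Sum>b\<in>Basis. (u \<bullet> b) *\<^sub>R dir_deriv f x b)"
      by (subst euclidean_representation[of u, symmetric])
         (simp only: linear_sum[OF lin[OF that]] linear_cmul[OF lin[OF that]])
    also have "norm \<dots> \<le> (\<Sum>b\<in>Basis. norm u * norm (dir_deriv f x b))"
      by (rule sum_norm_le) (auto intro!: mult_right_mono Basis_le_norm)
    also have "\<dots> = norm u * (\<Sum>b\<in>Basis. norm (dir_deriv f x b))" by (simp add: sum_distrib_left)
    also have "\<dots> \<le> norm u * L" using L(1) that by (intro mult_left_mono) auto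
    finally show ?thesis by (simp add: mult.commute)
  qed
  with L(2) that show thesis by blast
qed

text \<open>Uniform continuity of the derivative on K makes the first order remainder small
  uniformly in the base point. The differentiability of a flow needs this uniformity, because there
  the remainder is taken at all points of a trajectory at once.\<close>

lemma Ck_on_Suc0_uniform_remainder:
  fixes f :: "'e::euclidean_space \<Rightarrow> 'b::real_normed_vector"
  assumes W: "open W" and f: "Ck_on (Suc 0) W f" and K: "compact K" "convex K" "K \<subseteq> W" and "e > 0"
  obtains \<delta> where "\<delta> > 0"
    "\<And>x y. x \<in> K \<Longrightarrow> y \<in> K \<Longrightarrow> norm (y - x) < \<delta> \<Longrightarrow> norm (f y - f x - dir_deriv f x (y - x)) \<le> e * norm (y - x)"
proof -
  have lin: "linear (dir_deriv f x)" if "x \<in> K" for x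
    using has_derivative_dir_deriv[OF f W] K that has_derivative_linear by blast
  \<comment> \<open>Each of the n basis directions will contribute at most e / n to the operator
    norm.\<close>
  define n where "n = real DIM('e)"
  have n: "n > 0" by (simp add: n_def)
  have "\<exists>\<delta>>0. \<forall>x\<in>K. \<forall>y\<in>K. dist y x < \<delta> \<longrightarrow> dist (dir_deriv f y b) (dir_deriv f x b) < e / n" for b
  proof -
    have "continuous_on K (\<lambda>x. dir_deriv f x b)"
      using f K(3) by (auto intro: continuous_on_subset)
    then show ?thesis
      using compact_uniformly_continuous[OF _ K(1)] divide_pos_pos[OF \<open>e > 0\<close> n]
      unfolding uniformly_continuous_on_def by blast
  qed
  then obtain D where D: "\<And>b. D b > 0"
    "\<And>b x y. x \<in> K \<Longrightarrow> y \<in> K \<Longrightarrow> dist y x < D b \<Longrightarrow> dist (dir_deriv f y b) (dir_deriv f x b) < e / n"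
    by metis
  define \<delta> where "\<delta> = Min (D ` Basis)"
  have \<delta>: "\<delta> > 0" "\<And>b. b \<in> Basis \<Longrightarrow> \<delta> \<le> D b" using D(1) by (auto simp: \<delta>_def)
  have "norm (f y - f x - dir_deriv f x (y - x)) \<le> e * norm (y - x)"
    if x: "x \<in> K" and y: "y \<in> K" and xy: "norm (y - x) < \<delta>" for x y
  proof -
    define S where "S = closed_segment x y"
    have SK: "S \<subseteq> K" unfolding S_def using x y K(2) closed_segment_subset by blast
    have "norm (f y - f x - dir_deriv f x (y - x)) \<le> norm (y - x) * e"
    proof (rule differentiable_bound_linearization[where S=S])
      show "x + t *\<^sub>R (y - x) \<in> S" if "t \<in> {0..1}" for t
        using that unfolding S_def closed_segment_def by (auto simp: algebra_simps intro!: exI[of _ t])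
      show "(f has_derivative dir_deriv f z) (at z within S)" if "z \<in> S" for z
        using has_derivative_dir_deriv[OF f W, of z] SK K(3) that has_derivative_at_withinI by blast
      show "x \<in> S" by (simp add: S_def)
      show "onorm (dir_deriv f z - dir_deriv f x) \<le> e" if "z \<in> S" for z
      proof (rule onorm_le)
        fix u
        have z: "z \<in> K" "norm (z - x) \<le> norm (y - x)"
          using that SK segment_bound1[of z x y] by (auto simp: S_def)
        have "(dir_deriv f z - dir_deriv f x) u = dir_deriv f z u - dir_deriv f x u" by simp
        also have "\<dots> = (\<Sum>b\<in>Basis. (u \<bullet> b) *\<^sub>R (dir_deriv f z b - dir_deriv f x b))"
          by (subst (1 2) euclidean_representation[of u, symmetric])
             (simp only: linear_sum[OF lin[OF x]] linear_cmul[OF lin[OF x]] linear_sum[OF lin[OF z(1)]]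
               linear_cmul[OF lin[OF z(1)]] sum_subtractf[symmetric] scaleR_diff_right[symmetric])
        also have "norm \<dots> \<le> (\<Sum>b\<in>(Basis::'e set). norm u * (e / n))"
        proof (rule sum_norm_le)
          fix b :: 'e assume b: "b \<in> Basis"
          have "norm (dir_deriv f z b - dir_deriv f x b) < e / n"
            using D(2)[OF x z(1), of b] \<delta>(2)[OF b] z(2) xy by (simp add: dist_norm)
          then show "norm ((u \<bullet> b) *\<^sub>R (dir_deriv f z b - dir_deriv f x b)) \<le> norm u * (e / n)"
            using Basis_le_norm[OF b, of u] unfolding norm_scaleR by (intro mult_mono) auto
        qed
        also have "\<dots> = e * norm u" using n by (simp add: n_def)
        finally show "norm ((dir_deriv f z - dir_deriv f x) u) \<le> e * norm u" .
      qed
    qed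
    then show ?thesis by (simp add: mult.commute)
  qed
  with \<delta>(1) that show thesis by blast
qed

text \<open>The existence time d is uniform over initial values near p, and the derivative at p in
  direction u solves the linearised equation. Applied to the geodesic equation, this yields Jacobi
  fields as variations of geodesics.\<close>

lemma local_flow:
  fixes f :: "'e::euclidean_space \<Rightarrow> 'e"
  assumes W: "open W" and p: "p \<in> W" and f: "Ck_on (Suc 0) W f"
  obtains d e \<Phi> where "d > 0" "e > 0"
    "\<And>q. norm (q - p) < e \<Longrightarrow> \<Phi> q 0 = q"
    "\<And>q t. norm (q - p) < e \<Longrightarrow> \<bar>t\<bar> < d \<Longrightarrow> \<Phi> q t \<in> W"
    "\<And>q t. norm (q - p) < e \<Longrightarrow> \<bar>t\<bar> < d \<Longrightarrow> (\<Phi> q has_vector_derivative f (\<Phi> q t)) (at t)"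
    "\<And>u. \<exists>Z. Z 0 = u \<and> (\<forall>t. \<bar>t\<bar> < d \<longrightarrow> (Z has_vector_derivative dir_deriv f (\<Phi> p t) (Z t)) (at t) \<and>
        ((\<lambda>\<sigma>. \<Phi> (p + \<sigma> *\<^sub>R u) t) has_vector_derivative Z t) (at 0))"
proof -
  obtain r where r: "r > 0" "cball p r \<subseteq> W" using W p open_contains_cball by blast
  define K where "K = cball p r"
  have K: "compact K" "convex K" "K \<subseteq> W" "closed K" "K \<noteq> {}" "p \<in> K" using r by (auto simp: K_def)
  obtain L where L: "0 \<le> L" "\<And>x u. x \<in> K \<Longrightarrow> norm (dir_deriv f x u) \<le> L * norm u"
    using Ck_on_Suc0_derivative_bound[OF W f K(1,3)] by blast
  have fd: "(f has_derivative dir_deriv f x) (at x)" if "x \<in> W" for x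
    by (rule has_derivative_dir_deriv[OF f W that])
  have contf: "continuous_on W f"
    by (rule Ck_on_Suc_imp[OF f, unfolded Ck_on.simps(1)])
  obtain B where B: "\<And>x. x \<in> K \<Longrightarrow> norm (f x) \<le> B" "0 \<le> B"
    using compact_imp_bounded[OF compact_continuous_image[OF continuous_on_subset[OF contf K(3)] K(1)]] K(6)
    unfolding bounded_iff by (metis norm_ge_zero order_trans image_eqI)
  have flip: "norm (f x - f y) \<le> L * norm (x - y)" if "x \<in> K" "y \<in> K" for x y
    by (rule differentiable_bound[OF K(2) has_derivative_at_withinI[OF fd] _ that])
       (use K(3) L in \<open>auto intro!: onorm_le\<close>)
  \<comment> \<open>Projection to the convex ball does not increase distances, so g is bounded and
    Lipschitz on the whole space with the constants of f on K; its integral curves solve the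
    equation of f as long as they stay in K.\<close>
  define g where "g z = f (closest_point K z)" for z
  have cpK: "closest_point K z \<in> K" for z using closest_point_in_set K by blast
  have glip: "norm (g x - g y) \<le> L * norm (x - y)" for x y
  proof -
    have "norm (g x - g y) \<le> L * dist (closest_point K x) (closest_point K y)"
      unfolding g_def dist_norm by (rule flip[OF cpK cpK])
    also have "\<dots> \<le> L * norm (x - y)"
      using closest_point_lipschitz[OF K(2,4,5), of x y] L(1) by (auto simp: dist_norm intro: mult_left_mono)
    finally show ?thesis .
  qed
  have gB: "norm (g x) \<le> B" for x unfolding g_def by (rule B(1)[OF cpK])
  \<comment> \<open>The first bound gives the contraction and the hypothesis of
    \<open>short_time_bound\<close>; the second keeps curves that start within r/2 of p inside
    K.\<close>
  define D where "D = min (1 / (8 * (L + 1))) (r / (2 * (B + 1)))"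
  have D: "0 < D" "4 * D * L < 1" "D * L \<le> 1/2" "D * B < r / 2"
  proof -
    show "0 < D" using L(1) B(2) r by (simp add: D_def)
    have "D * (L + 1) \<le> 1 / (8 * (L + 1)) * (L + 1)" using L(1) by (intro mult_right_mono) (auto simp: D_def)
    also have "\<dots> = 1/8" using L(1) by (simp add: field_simps)
    finally have "D * L + D \<le> 1/8" by (simp add: algebra_simps)
    then show "4 * D * L < 1" "D * L \<le> 1/2" using \<open>0 < D\<close> by (simp_all add: algebra_simps)
    have "D * (B + 1) \<le> r / (2 * (B + 1)) * (B + 1)" using B(2) by (intro mult_right_mono) (auto simp: D_def)
    also have "\<dots> = r/2" using B(2) by (simp add: field_simps)
    finally show "D * B < r / 2" using \<open>0 < D\<close> by (simp add: algebra_simps)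
  qed
  have gcont: "continuous_on UNIV g"
  proof -
    have "continuous_on UNIV (closest_point K)"
      by (rule continuous_on_closest_point[OF K(2,4,5)])
    then show ?thesis unfolding g_def
      using continuous_on_compose2[OF continuous_on_subset[OF contf K(3)], of UNIV "closest_point K"] cpK by blast
  qed
  have "\<exists>z. z 0 = q \<and> (\<forall>t\<in>{-D<..<D}. (z has_vector_derivative g (z t)) (at t))" for q
    by (rule picard_existence[where f="\<lambda>_. g", OF D(1) L(1) D(2) _ glip])
       (auto simp: split_def intro!: continuous_on_compose2[OF gcont] continuous_intros)
  then obtain \<Phi> where \<Phi>0: "\<And>q. \<Phi> q 0 = q"
    and \<Phi>g: "\<And>q t. \<bar>t\<bar> < D \<Longrightarrow> (\<Phi> q has_vector_derivative g (\<Phi> q t)) (at t)"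
    by (metis abs_less_iff greaterThanLessThan_iff minus_less_iff)
  have \<Phi>K: "\<Phi> q t \<in> K" if "norm (q - p) < r/2" "\<bar>t\<bar> < D" for q t
  proof -
    have "norm (\<Phi> q t - \<Phi> q 0) \<le> B * \<bar>t\<bar>"
      by (rule vector_mean_value_bound[where h'="\<lambda>t. g (\<Phi> q t)"]) (use \<Phi>g gB that in auto)
    also have "\<dots> \<le> B * D" using that B(2) by (intro mult_left_mono) auto
    finally have "norm (\<Phi> q t - q) < r/2" using D(4) by (simp add: \<Phi>0 mult.commute)
    then have "norm ((\<Phi> q t - q) + (q - p)) < r"
      using norm_triangle_ineq[of "\<Phi> q t - q" "q - p"] that(1) by linarith
    then show ?thesis by (simp add: K_def dist_norm norm_minus_commute)
  qed
  have \<Phi>f: "(\<Phi> q has_vector_derivative f (\<Phi> q t)) (at t)" if "norm (q - p) < r/2" "\<bar>t\<bar> < D" for q t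
    using \<Phi>g[OF that(2), of q] closest_point_self[OF \<Phi>K[OF that]] by (simp add: g_def)
  \<comment> \<open>Halved because the coefficients of the linearised equation must be continuous on
    the closed interval from -d to d.\<close>
  define d where "d = D / 2"
  have d: "0 < d" "d < D" "4 * d * L < 1" "d * L \<le> 1/2"
    using D L by (auto simp: d_def field_simps)
  define z where "z = \<Phi> p"
  have p0: "norm (p - p) < r/2" using r by simp
  have zK: "z t \<in> K" if "\<bar>t\<bar> < D" for t using \<Phi>K[OF p0 that] by (simp add: z_def)
  have zW: "z t \<in> W" if "\<bar>t\<bar> < D" for t using zK[OF that] K by blast
  have zc: "continuous_on {-d..d} z"
  proof (rule continuous_at_imp_continuous_on, rule ballI)
    fix t assume "t \<in> {-d..d}"
    then have "\<bar>t\<bar> < D" using d by auto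
    from has_vector_derivative_continuous[OF \<Phi>f[OF p0 this]] show "isCont z t" by (simp add: z_def)
  qed
  have lin: "linear (dir_deriv f x)" if "x \<in> K" for x
    using fd that K has_derivative_linear by blast
  have Zex: "\<exists>Z. Z 0 = u \<and> (\<forall>t. \<bar>t\<bar> < d \<longrightarrow> (Z has_vector_derivative dir_deriv f (z t) (Z t)) (at t))" for u
  proof -
    have zz: "\<bar>t\<bar> < D" if "t \<in> {-d..d}" for t using that d by auto
    have "\<exists>Z. Z 0 = u \<and> (\<forall>t\<in>{-d<..<d}. (Z has_vector_derivative dir_deriv f (z t) (Z t)) (at t))"
    proof (rule picard_existence[OF d(1) L(1) d(3)])
      have c1: "continuous_on ({-d..d} \<times> UNIV) (\<lambda>x. dir_deriv f (z (fst x)) b)" for b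
      proof -
        have "continuous_on {-d..d} (\<lambda>t. dir_deriv f (z t) b)"
          by (rule continuous_on_compose2[OF _ zc, of W]) (use f zW zz in auto)
        then show ?thesis
          by (rule continuous_on_compose2) (auto intro!: continuous_intros)
      qed
      have "continuous_on ({-d..d} \<times> UNIV) (\<lambda>x. \<Sum>b\<in>Basis. (snd x \<bullet> b) *\<^sub>R dir_deriv f (z (fst x)) b)"
        by (intro continuous_intros c1)
      moreover have "dir_deriv f (z t) v = (\<Sum>b\<in>Basis. (v \<bullet> b) *\<^sub>R dir_deriv f (z t) b)" if "t \<in> {-d..d}" for t v
        by (subst euclidean_representation[of v, symmetric])
           (simp only: linear_sum[OF lin[OF zK[OF zz[OF that]]]] linear_cmul[OF lin[OF zK[OF zz[OF that]]]])
      ultimately show "continuous_on ({-d..d} \<times> UNIV) (\<lambda>(t, v). dir_deriv f (z t) v)"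
        by (subst continuous_on_cong[OF refl, of _ _ "\<lambda>x. \<Sum>b\<in>Basis. (snd x \<bullet> b) *\<^sub>R dir_deriv f (z (fst x)) b"]) auto
      show "norm (dir_deriv f (z t) v - dir_deriv f (z t) w) \<le> L * norm (v - w)" if "t \<in> {-d..d}" for t v w
        using L(2)[OF zK[OF zz[OF that]], of "v - w"] linear_diff[OF lin[OF zK[OF zz[OF that]]], of v w] by simp
    qed
    then show ?thesis by (auto simp: abs_less_iff minus_less_iff)
  qed
  show thesis
  proof (rule that[of d "r/2" \<Phi>])
    show "d > 0" "r/2 > 0" using d r by auto
    show "\<Phi> q 0 = q" for q by (rule \<Phi>0)
    show "\<Phi> q t \<in> W" if "norm (q - p) < r/2" "\<bar>t\<bar> < d" for q t
      using \<Phi>K[OF that(1), of t] that(2) d(2) K(3) by auto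
    show "(\<Phi> q has_vector_derivative f (\<Phi> q t)) (at t)" if "norm (q - p) < r/2" "\<bar>t\<bar> < d" for q t
      using \<Phi>f[OF that(1)] that(2) d by auto
    fix u
    obtain Z where Z0: "Z 0 = u" and Z: "\<And>t. \<bar>t\<bar> < d \<Longrightarrow> (Z has_vector_derivative dir_deriv f (z t) (Z t)) (at t)"
      using Zex[of u] by blast
    have der: "((\<lambda>\<sigma>. \<Phi> (p + \<sigma> *\<^sub>R u) t) has_vector_derivative Z t) (at 0)" if t: "\<bar>t\<bar> < d" for t
      unfolding has_vector_derivative_def has_derivative_at_alt
    proof (intro conjI allI impI)
      show "bounded_linear (\<lambda>x. x *\<^sub>R Z t)" by (rule bounded_linear_scaleR_left)
      fix e :: real assume e: "e > 0"
      define N where "N = norm u + 1"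
      have N: "N > 0" "norm u \<le> N" by (auto simp: N_def add_nonneg_pos)
      \<comment> \<open>Chosen so that the final bound 2 d \<epsilon> (2 |\<sigma>| N) equals e
        |\<sigma>|.\<close>
      define \<epsilon> where "\<epsilon> = e / (4 * d * N)"
      have \<epsilon>: "\<epsilon> > 0" using e N d by (simp add: \<epsilon>_def)
      obtain \<delta> where \<delta>: "\<delta> > 0" "\<And>x y. x \<in> K \<Longrightarrow> y \<in> K \<Longrightarrow> norm (y - x) < \<delta> \<Longrightarrow>
          norm (f y - f x - dir_deriv f x (y - x)) \<le> \<epsilon> * norm (y - x)"
        using Ck_on_Suc0_uniform_remainder[OF W f K(1-3) \<epsilon>] by blast
      show "\<exists>\<eta>>0. \<forall>\<sigma>. norm (\<sigma> - 0) < \<eta> \<longrightarrow>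
          norm (\<Phi> (p + \<sigma> *\<^sub>R u) t - \<Phi> (p + 0 *\<^sub>R u) t - (\<sigma> - 0) *\<^sub>R Z t) \<le> e * norm (\<sigma> - 0)"
      proof (intro exI[of _ "min (r / (2 * N)) (\<delta> / (2 * N))"] conjI allI impI)
        show "0 < min (r / (2 * N)) (\<delta> / (2 * N))" using r N \<delta> by simp
        fix \<sigma> :: real assume "norm (\<sigma> - 0) < min (r / (2 * N)) (\<delta> / (2 * N))"
        then have \<sigma>: "\<bar>\<sigma>\<bar> * N < r / 2" "2 * (\<bar>\<sigma>\<bar> * N) < \<delta>" using N by (auto simp: field_simps)
        have uN: "\<bar>\<sigma>\<bar> * norm u \<le> \<bar>\<sigma>\<bar> * N" using N by (intro mult_left_mono) auto
        define w where "w = \<Phi> (p + \<sigma> *\<^sub>R u)"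
        have q: "norm ((p + \<sigma> *\<^sub>R u) - p) < r/2" using \<sigma>(1) uN by simp
        have wK: "w s \<in> K" if "\<bar>s\<bar> < d" for s unfolding w_def using \<Phi>K[OF q] that d by auto
        have wd: "(w has_vector_derivative f (w s)) (at s)" if "\<bar>s\<bar> < d" for s
          unfolding w_def using \<Phi>f[OF q] that d by auto
        have zd: "(z has_vector_derivative f (z s)) (at s)" if "\<bar>s\<bar> < d" for s
          unfolding z_def using \<Phi>f[OF p0] that d by auto
        have zK': "z s \<in> K" if "\<bar>s\<bar> < d" for s using zK that d by auto
        \<comment> \<open>A crude bound first: trajectories that start at most |\<sigma>| N apart
          stay within twice that distance. It makes the uniform remainder estimate applicable along
          the whole curve.\<close>
        have bd1: "norm (w s - z s) \<le> 2 * (\<bar>\<sigma>\<bar> * N)" if s: "\<bar>s\<bar> < d" for s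
        proof -
          have "norm (w s - z s - \<sigma> *\<^sub>R u) \<le> 2 * d * (L * (\<bar>\<sigma>\<bar> * N))"
          proof (rule short_time_bound[where h'="\<lambda>s. f (w s) - f (z s)", OF _ _ _ L(1) d(4) _ s])
            show "((\<lambda>s. w s - z s - \<sigma> *\<^sub>R u) has_vector_derivative f (w t) - f (z t)) (at t)" if "\<bar>t\<bar> < d" for t
              using has_vector_derivative_diff[OF has_vector_derivative_diff[OF wd[OF that] zd[OF that]] has_vector_derivative_const]
              by simp
            show "w 0 - z 0 - \<sigma> *\<^sub>R u = 0" by (simp add: w_def z_def \<Phi>0)
            show "norm (f (w t) - f (z t)) \<le> L * norm (w t - z t - \<sigma> *\<^sub>R u) + L * (\<bar>\<sigma>\<bar> * N)" if "\<bar>t\<bar> < d" for t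
            proof -
              have "norm (w t - z t) \<le> norm (w t - z t - \<sigma> *\<^sub>R u) + \<bar>\<sigma>\<bar> * N"
                using norm_triangle_ineq[of "w t - z t - \<sigma> *\<^sub>R u" "\<sigma> *\<^sub>R u"] uN by simp
              then have "L * norm (w t - z t) \<le> L * (norm (w t - z t - \<sigma> *\<^sub>R u) + \<bar>\<sigma>\<bar> * N)"
                using L(1) by (rule mult_left_mono)
              then show ?thesis using flip[OF wK[OF that] zK'[OF that]] by (simp add: distrib_left)
            qed
            show "0 \<le> L * (\<bar>\<sigma>\<bar> * N)" using L(1) N by simp
          qed
          also have "\<dots> = 2 * (d * L) * (\<bar>\<sigma>\<bar> * N)" by simp
          also have "\<dots> \<le> 1 * (\<bar>\<sigma>\<bar> * N)" using d(4) N by (intro mult_right_mono) auto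
          finally have "norm (w s - z s - \<sigma> *\<^sub>R u) \<le> \<bar>\<sigma>\<bar> * N" by simp
          then show ?thesis
            using norm_triangle_ineq[of "w s - z s - \<sigma> *\<^sub>R u" "\<sigma> *\<^sub>R u"] uN by simp
        qed
        \<comment> \<open>The error of the linear approximation satisfies the linearised equation up
          to a remainder of size \<epsilon> times the crude bound.\<close>
        have "norm (w t - z t - \<sigma> *\<^sub>R Z t) \<le> 2 * d * (\<epsilon> * (2 * (\<bar>\<sigma>\<bar> * N)))"
        proof (rule short_time_bound[where h'="\<lambda>s. f (w s) - f (z s) - \<sigma> *\<^sub>R dir_deriv f (z s) (Z s)", OF _ _ _ L(1) d(4) _ t])
          show "((\<lambda>s. w s - z s - \<sigma> *\<^sub>R Z s) has_vector_derivative f (w t) - f (z t) - \<sigma> *\<^sub>R dir_deriv f (z t) (Z t)) (at t)" if "\<bar>t\<bar> < d" for t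
            by (intro has_vector_derivative_diff wd zd that
               bounded_linear.has_vector_derivative[OF bounded_linear_scaleR_right] Z)
          show "w 0 - z 0 - \<sigma> *\<^sub>R Z 0 = 0" by (simp add: w_def z_def \<Phi>0 Z0)
          show "0 \<le> \<epsilon> * (2 * (\<bar>\<sigma>\<bar> * N))" using \<epsilon> N by simp
          fix s assume s: "\<bar>s\<bar> < d"
          note l = lin[OF zK'[OF s]]
          have "f (w s) - f (z s) - \<sigma> *\<^sub>R dir_deriv f (z s) (Z s) =
             (f (w s) - f (z s) - dir_deriv f (z s) (w s - z s)) + dir_deriv f (z s) (w s - z s - \<sigma> *\<^sub>R Z s)"
            by (simp add: linear_diff[OF l] linear_cmul[OF l])
          also have "norm \<dots> \<le> \<epsilon> * norm (w s - z s) + L * norm (w s - z s - \<sigma> *\<^sub>R Z s)"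
            using bd1[OF s] \<sigma>(2)
            by (intro norm_triangle_mono \<delta>(2) L(2) zK' wK s) auto
          also have "\<dots> \<le> \<epsilon> * (2 * (\<bar>\<sigma>\<bar> * N)) + L * norm (w s - z s - \<sigma> *\<^sub>R Z s)"
            using bd1[OF s] \<epsilon> by (intro add_right_mono mult_left_mono) auto
          finally show "norm (f (w s) - f (z s) - \<sigma> *\<^sub>R dir_deriv f (z s) (Z s))
             \<le> L * norm (w s - z s - \<sigma> *\<^sub>R Z s) + \<epsilon> * (2 * (\<bar>\<sigma>\<bar> * N))" by simp
        qed
        also have "\<dots> = e * \<bar>\<sigma>\<bar>" using d(1) N by (simp add: \<epsilon>_def field_simps)
        finally show "norm (\<Phi> (p + \<sigma> *\<^sub>R u) t - \<Phi> (p + 0 *\<^sub>R u) t - (\<sigma> - 0) *\<^sub>R Z t) \<le> e * norm (\<sigma> - 0)"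
          by (simp add: w_def z_def)
      qed
    qed
    show "\<exists>Z. Z 0 = u \<and> (\<forall>t. \<bar>t\<bar> < d \<longrightarrow> (Z has_vector_derivative dir_deriv f (\<Phi> p t) (Z t)) (at t) \<and>
        ((\<lambda>\<sigma>. \<Phi> (p + \<sigma> *\<^sub>R u) t) has_vector_derivative Z t) (at 0))"
      using Z0 Z der unfolding z_def by blast
  qed
qed

text \<open>Near time 0 both solutions lie in a compact ball on which f is Lipschitz, and their
  difference satisfies \<open>short_time_bound\<close> with zero error.\<close>

lemma local_uniqueness:
  fixes f :: "'e::euclidean_space \<Rightarrow> 'e"
  assumes W: "open W" and f: "Ck_on (Suc 0) W f" and p: "z 0 \<in> W" "w 0 = z 0" and d: "d > 0"
    and z: "\<And>t. \<bar>t\<bar> < d \<Longrightarrow> (z has_vector_derivative f (z t)) (at t)"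
    and w: "\<And>t. \<bar>t\<bar> < d \<Longrightarrow> (w has_vector_derivative f (w t)) (at t)"
  obtains \<delta> where "\<delta> > 0" "\<And>t. \<bar>t\<bar> < \<delta> \<Longrightarrow> z t = w t"
proof -
  obtain r where r: "r > 0" "cball (z 0) r \<subseteq> W" using W p open_contains_cball by blast
  define K where "K = cball (z 0) r"
  have K: "compact K" "convex K" "K \<subseteq> W" using r by (auto simp: K_def)
  obtain L where L: "0 \<le> L" "\<And>x u. x \<in> K \<Longrightarrow> norm (dir_deriv f x u) \<le> L * norm u"
    using Ck_on_Suc0_derivative_bound[OF W f K(1,3)] by blast
  have fd: "(f has_derivative dir_deriv f x) (at x)" if "x \<in> W" for x
    by (rule has_derivative_dir_deriv[OF f W that])
  have flip: "norm (f x - f y) \<le> L * norm (x - y)" if "x \<in> K" "y \<in> K" for x y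
    by (rule differentiable_bound[OF K(2) has_derivative_at_withinI[OF fd] _ that])
       (use K(3) L in \<open>auto intro!: onorm_le\<close>)
  have cz: "isCont z 0" "isCont w 0" using z[of 0] w[of 0] d has_vector_derivative_continuous by auto
  obtain d1 where d1: "d1 > 0" "\<And>t. \<bar>t\<bar> < d1 \<Longrightarrow> z t \<in> K"
    using cz(1) r(1) unfolding continuous_at_eps_delta K_def
    by (metis dist_0_norm dist_commute less_imp_le mem_cball real_norm_def)
  obtain d2 where d2: "d2 > 0" "\<And>t. \<bar>t\<bar> < d2 \<Longrightarrow> w t \<in> K"
    using cz(2) r(1) p(2) unfolding continuous_at_eps_delta K_def
    by (metis dist_0_norm dist_commute less_imp_le mem_cball real_norm_def)
  define \<delta> where "\<delta> = min (min d (1 / (2 * (L + 1)))) (min d1 d2)"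
  have \<delta>: "\<delta> > 0" "\<delta> \<le> d" "\<delta> \<le> d1" "\<delta> \<le> d2" using d d1 d2 L by (auto simp: \<delta>_def)
  have "\<delta> * (L + 1) \<le> 1 / (2 * (L + 1)) * (L + 1)" using L(1) by (intro mult_right_mono) (auto simp: \<delta>_def)
  also have "\<dots> = 1/2" using L(1) by (simp add: field_simps)
  finally have \<delta>L: "\<delta> * L \<le> 1/2" using \<delta>(1) by (simp add: algebra_simps)
  have "z t = w t" if "\<bar>t\<bar> < \<delta>" for t
  proof -
    have "norm (z t - w t) \<le> 2 * \<delta> * 0"
      by (rule short_time_bound[where h'="\<lambda>t. f (z t) - f (w t)", OF _ _ _ L(1) \<delta>L _ that])
         (use z w \<delta> p d1 d2 flip in \<open>auto intro!: has_vector_derivative_diff\<close>)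
    then show ?thesis by simp
  qed
  with \<delta>(1) that show thesis by blast
qed

section \<open>Matrices\<close>

lemma bounded_bilinear_matrix_mult:
  "bounded_bilinear ((**) :: real^'n^'m \<Rightarrow> real^'p^'n \<Rightarrow> real^'p^'m)"
  unfolding bilinear_conv_bounded_bilinear[symmetric]
  by (auto simp: bilinear_def linear_iff matrix_matrix_mult_def vec_eq_iff sum.distrib algebra_simps sum_distrib_left)

lemma bounded_bilinear_matrix_vector_mult:
  "bounded_bilinear ((*v) :: real^'n^'m \<Rightarrow> real^'n \<Rightarrow> real^'m)"
  unfolding bilinear_conv_bounded_bilinear[symmetric]
  by (auto simp: bilinear_def linear_iff matrix_vector_mult_def vec_eq_iff sum.distrib algebra_simps sum_distrib_left)

lemma bounded_linear_trace: "bounded_linear (trace :: real^'n^'n \<Rightarrow> real)"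
  unfolding linear_conv_bounded_linear[symmetric]
  by (auto simp: linear_iff trace_def sum.distrib sum_distrib_left)

lemmas matrix_mult_linear_simps =
  bounded_bilinear.add_left[OF bounded_bilinear_matrix_mult]
  bounded_bilinear.add_right[OF bounded_bilinear_matrix_mult]
  bounded_bilinear.diff_left[OF bounded_bilinear_matrix_mult]
  bounded_bilinear.diff_right[OF bounded_bilinear_matrix_mult]
  bounded_bilinear.minus_left[OF bounded_bilinear_matrix_mult]
  bounded_bilinear.minus_right[OF bounded_bilinear_matrix_mult]
  bounded_bilinear.scaleR_left[OF bounded_bilinear_matrix_mult]
  bounded_bilinear.scaleR_right[OF bounded_bilinear_matrix_mult]
  bounded_bilinear.zero_left[OF bounded_bilinear_matrix_mult]
  bounded_bilinear.zero_right[OF bounded_bilinear_matrix_mult]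

lemmas trace_linear_simps =
  linear_add[OF bounded_linear.linear[OF bounded_linear_trace]]
  linear_diff[OF bounded_linear.linear[OF bounded_linear_trace]]
  linear_neg[OF bounded_linear.linear[OF bounded_linear_trace]]
  linear_cmul[OF bounded_linear.linear[OF bounded_linear_trace]]
  linear_0[OF bounded_linear.linear[OF bounded_linear_trace]]

lemma matrix_inv_mult:
  fixes A :: "real^'n^'n"
  assumes "det A \<noteq> 0"
  shows "A ** matrix_inv A = mat 1" "matrix_inv A ** A = mat 1"
proof -
  have "\<exists>A'. A ** A' = mat 1 \<and> A' ** A = mat 1"
    using assms by (simp add: invertible_det_nz[symmetric] invertible_def)
  from someI_ex[OF this] show "A ** matrix_inv A = mat 1" "matrix_inv A ** A = mat 1"
    unfolding matrix_inv_def by auto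
qed

text \<open>Cramer's rule exhibits the solution as a quotient of polynomials in the entries, which
  is how smoothness passes to inverse matrices and to the Christoffel symbols.\<close>

lemma matrix_inv_cramer:
  fixes A :: "real^'n^'n"
  assumes "det A \<noteq> 0"
  shows "(matrix_inv A *v b) $ k = det (\<chi> i j. if j = k then b $ i else A $ i $ j) * inverse (det A)"
proof -
  have "A *v (matrix_inv A *v b) = b"
    by (simp add: matrix_vector_mul_assoc matrix_inv_mult assms)
  then show ?thesis using cramer[OF assms, of "matrix_inv A *v b" b] by (simp add: divide_inverse)
qed

lemma matrix_inv_nth:
  fixes A :: "real^'n^'n"
  assumes "det A \<noteq> 0"
  shows "matrix_inv A $ k $ l = det (\<chi> i j. if j = k then axis l 1 $ i else A $ i $ j) * inverse (det A)"
  by (simp only: matrix_inv_cramer[OF assms, symmetric] matrix_vector_mul_component)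
     (simp add: inner_axis)

section \<open>Smooth matrix curves, and derivatives of determinant and inverse\<close>

lemma smooth_curve_vec_nth:
  fixes f :: "real \<Rightarrow> 'b::real_normed_vector ^ 'n"
  shows "smooth_curve I f \<Longrightarrow> smooth_curve I (\<lambda>t. f t $ i)"
  by (rule smooth_curve_bounded_linear[OF bounded_linear_vec_nth])

lemma smooth_curve_vec:
  fixes f :: "real \<Rightarrow> 'b::euclidean_space ^ 'n"
  assumes "\<And>i. smooth_curve I (\<lambda>x. f x $ i)"
  shows "smooth_curve I f"
proof -
  have l: "bounded_linear (axis i :: 'b \<Rightarrow> 'b ^ 'n)" for i
    unfolding linear_conv_bounded_linear[symmetric] by (auto simp: linear_iff axis_def vec_eq_iff)
  have "smooth_curve I (\<lambda>x. \<Sum>i\<in>UNIV. axis i (f x $ i))"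
    by (intro smooth_curve_sum smooth_curve_bounded_linear[OF l] assms)
  moreover have "(\<Sum>i\<in>UNIV. axis i (f x $ i)) = f x" for x
    by (simp add: vec_eq_iff axis_def if_distrib sum.delta cong: if_cong)
  ultimately show ?thesis by simp
qed

lemma smooth_curve_det:
  fixes F :: "real \<Rightarrow> real ^ 'n ^ 'n"
  assumes "\<And>i j. smooth_curve I (\<lambda>x. F x $ i $ j)"
  shows "smooth_curve I (\<lambda>x. det (F x))"
  unfolding det_def
  by (intro smooth_curve_sum smooth_curve_bilinear[OF bounded_bilinear_mult] smooth_curve_const smooth_curve_prod assms)

lemma smooth_curve_matrix_inv:
  fixes F :: "real \<Rightarrow> real ^ 'n ^ 'n"
  assumes "open I" "smooth_curve I F" "\<And>t. t \<in> I \<Longrightarrow> det (F t) \<noteq> 0"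
  shows "smooth_curve I (\<lambda>t. matrix_inv (F t))"
proof (intro smooth_curve_vec)
  fix k l
  have nth: "smooth_curve I (\<lambda>t. F t $ i $ j)" for i j
    by (intro smooth_curve_vec_nth assms)
  have "smooth_curve I (\<lambda>t. det ((\<chi> i j. if j = k then axis l 1 $ i else F t $ i $ j) :: real^'n^'n) * inverse (det (F t)))"
  proof (intro smooth_curve_bilinear[OF bounded_bilinear_mult] smooth_curve_inverse smooth_curve_det nth assms)
    fix i j
    show "smooth_curve I (\<lambda>x. (\<chi> i j. if j = k then axis l 1 $ i else F x $ i $ j) $ i $ j)"
      by (cases "j = k") (simp_all add: smooth_curve_const nth)
  qed
  then show "smooth_curve I (\<lambda>t. matrix_inv (F t) $ k $ l)"
    by (rule smooth_curve_cong[OF _ assms(1)]) (simp add: matrix_inv_nth assms(3))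
qed

text \<open>A permutation other than the identity moves at least two indices, so when one factor has
  been differentiated, another off-diagonal entry of the identity matrix remains and annihilates the
  product.\<close>

lemma det_derivative_at_mat1:
  fixes F :: "real \<Rightarrow> real^'n^'n"
  assumes F: "(F has_vector_derivative X) (at t)" and F1: "F t = mat 1"
  shows "((\<lambda>s. det (F s)) has_vector_derivative trace X) (at t)"
proof -
  have e: "((\<lambda>s. F s $ i $ j) has_real_derivative X $ i $ j) (at t)" for i j
    unfolding has_real_derivative_iff_has_vector_derivative
    by (intro bounded_linear.has_vector_derivative[OF bounded_linear_vec_nth] F)
  have "((\<lambda>s. det (F s)) has_real_derivative
     (\<Sum>p | p permutes (UNIV :: 'n set). of_int (sign p) *
         (\<Sum>i\<in>UNIV. X $ i $ p i * (\<Prod>j\<in>UNIV - {i}. F t $ j $ p j)))) (at t)"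
    unfolding det_def by (intro DERIV_sum DERIV_cmult has_field_derivative_prod e)
  also have "(\<Sum>p | p permutes (UNIV :: 'n set). of_int (sign p) *
         (\<Sum>i\<in>UNIV. X $ i $ p i * (\<Prod>j\<in>UNIV - {i}. F t $ j $ p j)))
     = (\<Sum>p\<in>{p. p permutes (UNIV :: 'n set)}. if p = id then trace X else 0)"
  proof (rule sum.cong[OF refl])
    fix p assume "p \<in> {p. p permutes (UNIV :: 'n set)}"
    then have p: "p permutes UNIV" by simp
    show "of_int (sign p) * (\<Sum>i\<in>UNIV. X $ i $ p i * (\<Prod>j\<in>UNIV - {i}. F t $ j $ p j)) = (if p = id then trace X else 0)"
    proof (cases "p = id")
      case True
      then show ?thesis by (simp add: F1 mat_def trace_def sign_id)
    next
      case False
      have "(\<Prod>j\<in>UNIV - {i}. F t $ j $ p j) = 0" for i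
      proof -
        have "\<exists>j. j \<noteq> i \<and> p j \<noteq> j"
        proof (rule ccontr)
          assume "\<nexists>j. j \<noteq> i \<and> p j \<noteq> j"
          then have *: "\<And>j. j \<noteq> i \<Longrightarrow> p j = j" by blast
          have "p i = i" using * permutes_inj[OF p] by (metis injD)
          with * have "p = id" by (metis eq_id_iff)
          with False show False by simp
        qed
        then obtain j where "j \<noteq> i" "p j \<noteq> j" by blast
        then show ?thesis by (intro prod_zero) (auto simp: F1 mat_def intro!: bexI[of _ j])
      qed
      then have "(\<Sum>i\<in>UNIV. X $ i $ p i * (\<Prod>j\<in>UNIV - {i}. F t $ j $ p j)) = 0"
        by (intro sum.neutral) (simp only: mult_zero_right simp_thms ball_simps)
      with False show ?thesis by simp
    qed
  qed
  also have "\<dots> = trace X" by (simp add: sum.delta permutes_id finite_permutations)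
  finally show ?thesis unfolding has_real_derivative_iff_has_vector_derivative .
qed

text \<open>Multiplication by the inverse of \<open>F t\<close> moves the base point to the identity
  matrix; multiplicativity of the determinant moves it back.\<close>

lemma det_derivative:
  fixes F :: "real \<Rightarrow> real^'n^'n"
  assumes F: "(F has_vector_derivative X) (at t)" and nz: "det (F t) \<noteq> 0"
  shows "((\<lambda>s. det (F s)) has_vector_derivative det (F t) * trace (X ** matrix_inv (F t))) (at t)"
proof -
  let ?G = "\<lambda>s. F s ** matrix_inv (F t)"
  have b: "bounded_linear (\<lambda>A. A ** matrix_inv (F t))"
    by (rule bounded_bilinear.bounded_linear_left[OF bounded_bilinear_matrix_mult])
  have "((\<lambda>s. det (?G s)) has_vector_derivative trace (X ** matrix_inv (F t))) (at t)"
    by (rule det_derivative_at_mat1[OF bounded_linear.has_vector_derivative[OF b F] matrix_inv_mult(1)[OF nz]])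
  then have "((\<lambda>s. det (F t) * det (?G s)) has_vector_derivative det (F t) * trace (X ** matrix_inv (F t))) (at t)"
    by (rule bounded_linear.has_vector_derivative[OF bounded_linear_mult_right])
  moreover have "det (F t) * det (?G s) = det (F s)" for s
  proof -
    have "det (F t) * det (?G s) = det (?G s ** F t)" by (simp add: det_mul)
    also have "?G s ** F t = F s" by (simp add: matrix_mul_assoc[symmetric] matrix_inv_mult nz)
    finally show ?thesis .
  qed
  ultimately show ?thesis by simp
qed

text \<open>Smoothness already provides some derivative Y; its value follows by differentiating
  \<open>F s ** matrix_inv (F s) = mat 1\<close>.\<close>

lemma matrix_inv_derivative:
  fixes F :: "real \<Rightarrow> real^'n^'n"
  assumes I: "open I" "t \<in> I" and F: "smooth_curve I F" and nz: "\<And>t. t \<in> I \<Longrightarrow> det (F t) \<noteq> 0"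
    and X: "(F has_vector_derivative X) (at t)"
  shows "((\<lambda>s. matrix_inv (F s)) has_vector_derivative - (matrix_inv (F t) ** X ** matrix_inv (F t))) (at t)"
proof -
  obtain Y where Y: "((\<lambda>s. matrix_inv (F s)) has_vector_derivative Y) (at t)"
    using smooth_curve_imp(2)[OF smooth_curve_matrix_inv[OF I(1) F nz] I(1,2)] by blast
  have "((\<lambda>s. F s ** matrix_inv (F s)) has_vector_derivative F t ** Y + X ** matrix_inv (F t)) (at t)"
    by (rule bounded_bilinear.has_vector_derivative[OF bounded_bilinear_matrix_mult X Y])
  moreover have "((\<lambda>s. F s ** matrix_inv (F s)) has_vector_derivative 0) (at t)"
    by (rule has_vector_derivative_transform_within_open[OF has_vector_derivative_const[of "mat 1"] I])
       (simp add: matrix_inv_mult nz)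
  ultimately have "F t ** Y + X ** matrix_inv (F t) = 0"
    by (rule vector_derivative_unique_at)
  then have "matrix_inv (F t) ** (F t ** Y + X ** matrix_inv (F t)) = 0"
    by (simp add: matrix_mult_linear_simps)
  then have "Y + matrix_inv (F t) ** X ** matrix_inv (F t) = 0"
    by (simp add: matrix_mult_linear_simps matrix_mul_assoc matrix_inv_mult nz I)
  then have "Y = - (matrix_inv (F t) ** X ** matrix_inv (F t))" by (simp add: eq_neg_iff_add_eq_0)
  with Y show ?thesis by simp
qed

text \<open>\<open>B t\<close> is the integral of \<open>A' (s t)\<close> over \<open>0 \<le> s \<le> 1\<close>.\<close>

lemma smooth_curve_divide_by_time:
  fixes A :: "real \<Rightarrow> 'b::euclidean_space"
  assumes A: "smooth_curve {-d<..<d} A" and A0: "A 0 = 0" and d: "d > 0"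
  obtains B where "smooth_curve {-d<..<d} B" "\<And>t. \<bar>t\<bar> < d \<Longrightarrow> A t = t *\<^sub>R B t"
proof -
  define I where "I = {-d<..<d}"
  have I: "open I" "convex I" by (auto simp: I_def)
  have sI: "s * t \<in> I" if "t \<in> I" "s \<in> {0..1}" for s t
  proof -
    have "\<bar>s * t\<bar> \<le> 1 * \<bar>t\<bar>" using that unfolding abs_mult by (intro mult_right_mono) auto
    then show ?thesis using that unfolding I_def by auto
  qed
  \<comment> \<open>\<open>B k\<close> is the k-th derivative of \<open>B 0\<close>, by
    differentiation under the integral sign. The formula is regular at t = 0, so the quotient A(t) /
    t needs no separate treatment there.\<close>
  define B where "B k t = integral (cbox 0 1) (\<lambda>s. s ^ k *\<^sub>R nderiv (Suc k) A (s * t))" for k and t :: real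
  have A': "smooth_curve I A" using A by (simp add: I_def)
  have contn: "continuous_on I (nderiv k A)" for k
    by (rule smooth_curve_continuous_on[OF smooth_curve_nderiv[OF A' I(1)] I(1)])
  have dB: "(B k has_vector_derivative B (Suc k) t) (at t)" if t: "t \<in> I" for k t
  proof -
    have "((\<lambda>x. integral (cbox 0 1) (\<lambda>s. s ^ k *\<^sub>R nderiv (Suc k) A (s * x))) has_vector_derivative
        integral (cbox 0 1) (\<lambda>s. s ^ Suc k *\<^sub>R nderiv (Suc (Suc k)) A (s * t))) (at t within I)"
    proof (rule leibniz_rule_vector_derivative[OF _ _ _ t I(2)])
      fix x s :: real assume x: "x \<in> I" and s: "s \<in> cbox 0 1"
      have xs: "s * x \<in> I" using sI x s by auto
      have "((\<lambda>x. nderiv (Suc k) A (s * x)) has_vector_derivative s *\<^sub>R nderiv (Suc (Suc k)) A (s * x)) (at x)"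
        using vector_diff_chain_at[of "\<lambda>x. s * x" s x "nderiv (Suc k) A" "nderiv (Suc (Suc k)) A (s * x)"]
          nderiv_has[OF A' I(1) xs, of "Suc k"] has_vector_derivative_mult_right[OF has_vector_derivative_id, of s "at x"]
        by (simp add: o_def)
      from bounded_linear.has_vector_derivative[OF bounded_linear_scaleR_right[of "s ^ k"] this]
      show "((\<lambda>x. s ^ k *\<^sub>R nderiv (Suc k) A (s * x)) has_vector_derivative
          s ^ Suc k *\<^sub>R nderiv (Suc (Suc k)) A (s * x)) (at x within I)"
        by (simp add: mult.commute has_vector_derivative_at_within)
    next
      fix x assume x: "x \<in> I"
      show "(\<lambda>s. s ^ k *\<^sub>R nderiv (Suc k) A (s * x)) integrable_on cbox 0 1"
        by (intro integrable_continuous continuous_intros continuous_on_compose2[OF contn])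
           (use sI x in auto)
    next
      show "continuous_on (I \<times> cbox 0 1) (\<lambda>(x, s). s ^ Suc k *\<^sub>R nderiv (Suc (Suc k)) A (s * x))"
        unfolding split_def
        by (intro continuous_intros continuous_on_compose2[OF contn]) (use sI in auto)
    qed
    then show ?thesis
      unfolding has_vector_derivative_within_open[OF t I(1)] B_def[symmetric] .
  qed
  have "kdiff j I (B k)" for j k
  proof (induction j arbitrary: k)
    case (Suc j)
    then show ?case using dB by auto
  qed simp
  then have sB: "smooth_curve I (B 0)" by (simp add: smooth_curve_def)
  have "A t = t *\<^sub>R B 0 t" if t: "t \<in> I" for t
  proof -
    have "((\<lambda>s. t *\<^sub>R nderiv (Suc 0) A (s * t)) has_integral A (1 * t) - A (0 * t)) {0..1}"
    proof (rule fundamental_theorem_of_calculus)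
      fix s :: real assume s: "s \<in> {0..1}"
      have "((\<lambda>s. A (s * t)) has_vector_derivative t *\<^sub>R nderiv (Suc 0) A (s * t)) (at s)"
        using vector_diff_chain_at[of "\<lambda>s. s * t" t s A "nderiv (Suc 0) A (s * t)"]
          nderiv_has[OF A' I(1) sI[OF t s], of 0] has_vector_derivative_mult_left[OF has_vector_derivative_id, of t "at s"]
        by (simp add: o_def)
      then show "((\<lambda>s. A (s * t)) has_vector_derivative t *\<^sub>R nderiv (Suc 0) A (s * t)) (at s within {0..1})"
        by (rule has_vector_derivative_at_within)
    qed simp
    from integral_unique[OF this] have "integral {0..1} (\<lambda>s. t *\<^sub>R nderiv (Suc 0) A (s * t)) = A t"
      by (simp add: A0)
    then show ?thesis by (simp add: B_def)
  qed
  with sB show thesis by (intro that[of "B 0"]) (auto simp: I_def abs_less_iff minus_less_iff)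
qed

section \<open>The Levi-Civita connection in a chart\<close>

lemma linear_axis_expansion:
  fixes f :: "real^'n \<Rightarrow> 'b::real_vector"
  assumes "linear f"
  shows "f v = (\<Sum>k\<in>UNIV. (v $ k) *\<^sub>R f (axis k 1))"
proof -
  have "v = (\<Sum>k\<in>UNIV. (v $ k) *\<^sub>R axis k 1)"
    by (simp add: vec_eq_iff axis_def if_distrib sum.delta cong: if_cong)
  then have "f v = f (\<Sum>k\<in>UNIV. (v $ k) *\<^sub>R axis k 1)" by simp
  also have "\<dots> = (\<Sum>k\<in>UNIV. (v $ k) *\<^sub>R f (axis k 1))"
    by (simp only: linear_sum[OF assms] linear_cmul[OF assms])
  finally show ?thesis .
qed

lemma dir_deriv_const [simp]: "dir_deriv (\<lambda>_. a) x v = 0"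
  by (rule dir_deriv_eq) (rule has_derivative_const)

lemma dir_deriv_zero [simp]: "dir_deriv f x 0 = 0"
  unfolding dir_deriv_def by (simp add: vector_derivative_at)

lemma ginner_linear_left: "linear (\<lambda>v. ginner G x v w)"
  by (rule linearI) (auto simp: ginner_def inner_add_left)

lemma ginner_linear_right: "linear (ginner G x v)"
  by (rule linearI) (auto simp: ginner_def inner_add_right matrix_vector_right_distrib matrix_vector_mult_scaleR)

lemmas ginner_simps =
  linear_add[OF ginner_linear_left] linear_add[OF ginner_linear_right]
  linear_diff[OF ginner_linear_left] linear_diff[OF ginner_linear_right]
  linear_neg[OF ginner_linear_left] linear_neg[OF ginner_linear_right]
  linear_cmul[OF ginner_linear_left] linear_cmul[OF ginner_linear_right]
  linear_0[OF ginner_linear_left] linear_0[OF ginner_linear_right]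

lemma bounded_linear_ginner: "bounded_linear (\<lambda>A. v \<bullet> (A *v w :: real^'n))"
  by (intro bounded_linear_compose[OF bounded_linear_inner_right]
      bounded_bilinear.bounded_linear_left[OF bounded_bilinear_matrix_vector_mult])

text \<open>The image of a single chart with its metric. Local computations take place here; the
  manifold returns when charts are changed.\<close>

locale chart_metric =
  fixes U :: "(real^'n::finite) set" and G :: "real^'n \<Rightarrow> real^'n^'n"
  assumes openU: "open U" and smoothG: "smooth_on U G"
    and symG: "x \<in> U \<Longrightarrow> ginner G x v w = ginner G x w v"
    and posG: "x \<in> U \<Longrightarrow> v \<noteq> 0 \<Longrightarrow> ginner G x v v > 0"
begin

abbreviation "g \<equiv> ginner G"
abbreviation "\<Gamma> \<equiv> christoffel G"

definition dg :: "real^'n \<Rightarrow> real^'n \<Rightarrow> real^'n \<Rightarrow> real^'n \<Rightarrow> real" where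
  "dg x u v w = dir_deriv (\<lambda>y. g y v w) x u"

definition d\<Gamma> :: "real^'n \<Rightarrow> real^'n \<Rightarrow> real^'n \<Rightarrow> real^'n \<Rightarrow> real^'n" where
  "d\<Gamma> x u v w = dir_deriv (\<lambda>y. \<Gamma> y v w) x u"

lemma det_G_nonzero: "x \<in> U \<Longrightarrow> det (G x) \<noteq> 0"
proof -
  assume x: "x \<in> U"
  have "v = 0" if "G x *v v = 0" for v
  proof (rule ccontr)
    assume "v \<noteq> 0"
    from posG[OF x this] that show False by (simp add: ginner_def)
  qed
  then have "invertible (G x)"
    by (simp add: invertible_left_inverse matrix_left_invertible_ker)
  then show "det (G x) \<noteq> 0" by (simp add: invertible_det_nz)
qed

lemma g_nondegenerate:
  assumes "x \<in> U" "\<And>u. g x a u = g x b u"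
  shows "a = b"
proof (rule ccontr)
  assume "a \<noteq> b"
  then have "g x (a - b) (a - b) > 0" using posG assms(1) by simp
  moreover have "g x (a - b) (a - b) = 0" using assms(2)[of "a - b"] by (simp add: ginner_simps)
  ultimately show False by simp
qed

lemma dg_eq: "x \<in> U \<Longrightarrow> dg x u v w = v \<bullet> (dir_deriv G x u *v w)"
  unfolding dg_def ginner_def
  by (rule dir_deriv_bounded_linear[OF bounded_linear_ginner smooth_on_has_derivative[OF smoothG openU]])

lemma smooth_g: "smooth_on U (\<lambda>x. g x v w)"
  unfolding ginner_def by (rule smooth_on_bounded_linear[OF bounded_linear_ginner openU smoothG])

lemma dg_linear:
  assumes "x \<in> U"
  shows "linear (\<lambda>u. dg x u v w)" "linear (\<lambda>v. dg x u v w)" "linear (\<lambda>w. dg x u v w)"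
proof -
  show "linear (\<lambda>u. dg x u v w)" unfolding dg_def by (rule smooth_on_linear_dir_deriv[OF smooth_g openU assms])
  show "linear (\<lambda>v. dg x u v w)" "linear (\<lambda>w. dg x u v w)"
    unfolding dg_eq[OF assms]
    by (auto intro!: linearI simp: inner_add_left inner_add_right matrix_vector_right_distrib matrix_vector_mult_scaleR)
qed

lemma dg_sym: "x \<in> U \<Longrightarrow> dg x u v w = dg x u w v"
  unfolding dg_def by (rule dir_deriv_cong[OF openU]) (auto intro: symG)

lemma dg_simps:
  assumes "x \<in> U"
  shows "dg x (a + b) v w = dg x a v w + dg x b v w" "dg x u (a + b) w = dg x u a w + dg x u b w"
    "dg x u v (a + b) = dg x u v a + dg x u v b" "dg x (r *\<^sub>R a) v w = r * dg x a v w"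
    "dg x u (r *\<^sub>R a) w = r * dg x u a w" "dg x u v (r *\<^sub>R a) = r * dg x u v a"
  by (simp_all add: linear_add[OF dg_linear(1)[OF assms]] linear_add[OF dg_linear(2)[OF assms]]
      linear_add[OF dg_linear(3)[OF assms]] linear_cmul[OF dg_linear(1)[OF assms]]
      linear_cmul[OF dg_linear(2)[OF assms]] linear_cmul[OF dg_linear(3)[OF assms]])

text \<open>Koszul's formula: the definition prescribes it for coordinate vectors, and both sides
  are linear in u. Since the metric is nondegenerate, it characterises \<Gamma>, so symmetry and
  linearity can be read off without the inverse matrix.\<close>

lemma g_christoffel:
  assumes x: "x \<in> U"
  shows "g x (\<Gamma> x v w) u = (dg x v w u + dg x w v u - dg x u v w) / 2"
proof -
  let ?h = "\<lambda>u. (dg x v w u + dg x w v u - dg x u v w) / 2"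
  have lin: "linear ?h"
    by (rule linearI) (simp_all add: dg_simps[OF x] algebra_simps add_divide_distrib diff_divide_distrib)
  have "G x *v \<Gamma> x v w = (\<chi> l. ?h (axis l 1))"
    unfolding christoffel_def dg_def by (simp add: matrix_vector_mul_assoc matrix_inv_mult det_G_nonzero[OF x])
  then have "g x u (\<Gamma> x v w) = u \<bullet> (\<chi> l. ?h (axis l 1))" by (simp add: ginner_def)
  also have "\<dots> = (\<Sum>l\<in>UNIV. (u $ l) *\<^sub>R ?h (axis l 1))" by (simp add: inner_vec_def)
  also have "\<dots> = ?h u" by (rule linear_axis_expansion[OF lin, symmetric])
  finally show ?thesis using symG[OF x] by metis
qed

lemma christoffel_eqI:
  assumes "x \<in> U" "\<And>u. g x z u = (dg x v w u + dg x w v u - dg x u v w) / 2"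
  shows "\<Gamma> x v w = z"
  by (rule g_nondegenerate[OF assms(1)]) (simp only: g_christoffel[OF assms(1)] assms(2))

lemma christoffel_sym: "x \<in> U \<Longrightarrow> \<Gamma> x v w = \<Gamma> x w v"
  by (rule christoffel_eqI) (auto simp only: g_christoffel dg_sym[of x _ w v] add.commute)

lemma christoffel_linear_right: "x \<in> U \<Longrightarrow> linear (\<Gamma> x v)"
  by (rule linearI; rule christoffel_eqI)
     (simp_all add: g_christoffel ginner_simps dg_simps algebra_simps add_divide_distrib diff_divide_distrib)

lemma christoffel_linear_left: "x \<in> U \<Longrightarrow> linear (\<lambda>v. \<Gamma> x v w)"
  by (subst christoffel_sym) (auto intro: christoffel_linear_right)

lemma christoffel_simps:
  assumes "x \<in> U"
  shows "\<Gamma> x (a + b) w = \<Gamma> x a w + \<Gamma> x b w" "\<Gamma> x v (a + b) = \<Gamma> x v a + \<Gamma> x v b"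
    "\<Gamma> x (r *\<^sub>R a) w = r *\<^sub>R \<Gamma> x a w" "\<Gamma> x v (r *\<^sub>R a) = r *\<^sub>R \<Gamma> x v a"
    "\<Gamma> x (- a) w = - \<Gamma> x a w" "\<Gamma> x v (- a) = - \<Gamma> x v a" "\<Gamma> x 0 w = 0" "\<Gamma> x v 0 = 0"
    "\<Gamma> x (a - b) w = \<Gamma> x a w - \<Gamma> x b w" "\<Gamma> x v (a - b) = \<Gamma> x v a - \<Gamma> x v b"
  by (simp_all add: linear_add[OF christoffel_linear_right[OF assms]] linear_add[OF christoffel_linear_left[OF assms]]
      linear_cmul[OF christoffel_linear_right[OF assms]] linear_cmul[OF christoffel_linear_left[OF assms]]
      linear_neg[OF christoffel_linear_right[OF assms]] linear_neg[OF christoffel_linear_left[OF assms]]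
      linear_0[OF christoffel_linear_right[OF assms]] linear_0[OF christoffel_linear_left[OF assms]]
      linear_diff[OF christoffel_linear_right[OF assms]] linear_diff[OF christoffel_linear_left[OF assms]])

text \<open>In the sum of the two instances of Koszul's formula, the terms that differentiate in
  direction v or w cancel by symmetry of the metric.\<close>

lemma metric_compatible:
  assumes x: "x \<in> U"
  shows "dg x u v w = g x (\<Gamma> x u v) w + g x v (\<Gamma> x u w)"
  unfolding symG[OF x, of v "\<Gamma> x u w"] g_christoffel[OF x]
  using dg_sym[OF x, of u v w] dg_sym[OF x, of v u w] dg_sym[OF x, of w u v] by (simp add: field_simps)

lemma smooth_christoffel: "smooth_on U (\<lambda>x. \<Gamma> x v w)"
proof (rule smooth_on_vec[OF openU])
  fix k
  define b where "b y = (\<chi> l. (dg y v w (axis l 1) + dg y w v (axis l 1) - dg y (axis l 1) v w) / 2)" for y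
  have sb: "smooth_on U (\<lambda>y. b y $ l)" for l
  proof -
    have "smooth_on U (\<lambda>y. (1/2) * (dg y v w (axis l 1) + dg y w v (axis l 1) - dg y (axis l 1) v w))"
      unfolding dg_def
      by (intro smooth_on_mult smooth_on_const smooth_on_diff smooth_on_add smooth_on_dir_deriv smooth_g openU)
    then show ?thesis by (simp add: b_def)
  qed
  have nth: "smooth_on U (\<lambda>t. G t $ i $ j)" for i j
    by (intro smooth_on_vec_nth openU smoothG)
  have "smooth_on U (\<lambda>y. det ((\<chi> i j. if j = k then b y $ i else G y $ i $ j) :: real^'n^'n) * inverse (det (G y)))"
  proof (intro smooth_on_mult smooth_on_inverse smooth_on_det nth openU det_G_nonzero)
    fix i j
    show "smooth_on U (\<lambda>y. (\<chi> i j. if j = k then b y $ i else G y $ i $ j) $ i $ j)"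
      by (cases "j = k") (simp_all add: sb nth)
  qed
  then show "smooth_on U (\<lambda>y. \<Gamma> y v w $ k)"
    by (rule smooth_on_cong[OF _ openU]) (simp add: christoffel_def b_def[unfolded dg_def, symmetric] matrix_inv_cramer det_G_nonzero)
qed

lemma christoffel_expansion:
  assumes "x \<in> U"
  shows "\<Gamma> x v w = (\<Sum>i\<in>UNIV. \<Sum>j\<in>UNIV. (v $ i) *\<^sub>R (w $ j) *\<^sub>R \<Gamma> x (axis i 1) (axis j 1))"
  using linear_axis_expansion[OF christoffel_linear_left[OF assms], of v w]
    linear_axis_expansion[OF christoffel_linear_right[OF assms], of _ w]
  by (simp add: scaleR_sum_right)

lemma dchristoffel_sym: "x \<in> U \<Longrightarrow> d\<Gamma> x u v w = d\<Gamma> x u w v"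
  unfolding d\<Gamma>_def by (rule dir_deriv_cong[OF openU]) (auto intro: christoffel_sym)

lemma dchristoffel_linear:
  assumes x: "x \<in> U"
  shows "linear (\<lambda>u. d\<Gamma> x u v w)" "linear (\<lambda>v. d\<Gamma> x u v w)" "linear (\<lambda>w. d\<Gamma> x u v w)"
proof -
  show "linear (\<lambda>u. d\<Gamma> x u v w)" unfolding d\<Gamma>_def by (rule smooth_on_linear_dir_deriv[OF smooth_christoffel openU x])
  have D: "((\<lambda>y. \<Gamma> y v w) has_derivative (\<lambda>u. d\<Gamma> x u v w)) (at x)" for v w
    unfolding d\<Gamma>_def by (rule smooth_on_has_derivative[OF smooth_christoffel openU x])
  have l2: "linear (\<lambda>v. d\<Gamma> x u v w)" for w
  proof (rule linearI)
    fix a b r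
    show "d\<Gamma> x u (a + b) w = d\<Gamma> x u a w + d\<Gamma> x u b w"
      using dir_deriv_cong[OF openU x, of "\<lambda>y. \<Gamma> y (a + b) w" "\<lambda>y. \<Gamma> y a w + \<Gamma> y b w"] christoffel_simps
        dir_deriv_eq[OF has_derivative_add[OF D D]] by (simp add: d\<Gamma>_def)
    show "d\<Gamma> x u (r *\<^sub>R a) w = r *\<^sub>R d\<Gamma> x u a w"
      using dir_deriv_cong[OF openU x, of "\<lambda>y. \<Gamma> y (r *\<^sub>R a) w" "\<lambda>y. r *\<^sub>R \<Gamma> y a w"] christoffel_simps
        dir_deriv_eq[OF has_derivative_scaleR_right[OF D]] by (simp add: d\<Gamma>_def)
  qed
  then show "linear (\<lambda>v. d\<Gamma> x u v w)" .
  show "linear (\<lambda>w. d\<Gamma> x u v w)"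
    by (subst dchristoffel_sym[OF x]) (rule l2)
qed

lemma dchristoffel_simps:
  assumes "x \<in> U"
  shows "d\<Gamma> x (a + b) v w = d\<Gamma> x a v w + d\<Gamma> x b v w" "d\<Gamma> x u (a + b) w = d\<Gamma> x u a w + d\<Gamma> x u b w"
    "d\<Gamma> x u v (a + b) = d\<Gamma> x u v a + d\<Gamma> x u v b" "d\<Gamma> x (r *\<^sub>R a) v w = r *\<^sub>R d\<Gamma> x a v w"
    "d\<Gamma> x u (r *\<^sub>R a) w = r *\<^sub>R d\<Gamma> x u a w" "d\<Gamma> x u v (r *\<^sub>R a) = r *\<^sub>R d\<Gamma> x u v a"
  by (simp_all add: linear_add[OF dchristoffel_linear(1)[OF assms]] linear_add[OF dchristoffel_linear(2)[OF assms]]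
      linear_add[OF dchristoffel_linear(3)[OF assms]] linear_cmul[OF dchristoffel_linear(1)[OF assms]]
      linear_cmul[OF dchristoffel_linear(2)[OF assms]] linear_cmul[OF dchristoffel_linear(3)[OF assms]])

text \<open>\<open>d\<Gamma>\<close> is defined for constant arguments, so moving arguments are
  expanded in coordinates and the product rule is applied to their coefficients.\<close>

lemma christoffel_along:
  assumes I: "open I" "t \<in> I" and xU: "\<And>s. s \<in> I \<Longrightarrow> x s \<in> U"
    and x: "(x has_vector_derivative x') (at t)"
    and v: "(v has_vector_derivative v') (at t)" and w: "(w has_vector_derivative w') (at t)"
  shows "((\<lambda>s. \<Gamma> (x s) (v s) (w s)) has_vector_derivative
     d\<Gamma> (x t) x' (v t) (w t) + \<Gamma> (x t) v' (w t) + \<Gamma> (x t) (v t) w') (at t)"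
proof -
  let ?e = "\<lambda>i. axis i 1 :: real^'n"
  have xt: "x t \<in> U" using I xU by blast
  have nth: "((\<lambda>s. f s $ i) has_real_derivative f' $ i) (at t)"
    if "(f has_vector_derivative f') (at t)" for f :: "real \<Rightarrow> real^'n" and f' i
    using bounded_linear.has_vector_derivative[OF bounded_linear_vec_nth that]
    by (simp add: has_real_derivative_iff_has_vector_derivative)
  have d: "((\<lambda>s. \<Gamma> (x s) (?e i) (?e j)) has_vector_derivative d\<Gamma> (x t) x' (?e i) (?e j)) (at t)" for i j
    unfolding d\<Gamma>_def by (rule has_vector_derivative_compose_dir[of "\<lambda>y. \<Gamma> y (?e i) (?e j)" _ x,
          OF smooth_on_has_derivative[OF smooth_christoffel openU xt] x])
  have "((\<lambda>s. \<Sum>i\<in>UNIV. \<Sum>j\<in>UNIV. (v s $ i) *\<^sub>R (w s $ j) *\<^sub>R \<Gamma> (x s) (?e i) (?e j)) has_vector_derivative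
     (\<Sum>i\<in>UNIV. \<Sum>j\<in>UNIV. (v t $ i) *\<^sub>R ((w t $ j) *\<^sub>R d\<Gamma> (x t) x' (?e i) (?e j) + (w' $ j) *\<^sub>R \<Gamma> (x t) (?e i) (?e j))
        + (v' $ i) *\<^sub>R (w t $ j) *\<^sub>R \<Gamma> (x t) (?e i) (?e j))) (at t)"
    by (intro has_vector_derivative_sum has_vector_derivative_scaleR nth d v w)
  also have "(\<Sum>i\<in>UNIV. \<Sum>j\<in>UNIV. (v t $ i) *\<^sub>R ((w t $ j) *\<^sub>R d\<Gamma> (x t) x' (?e i) (?e j) + (w' $ j) *\<^sub>R \<Gamma> (x t) (?e i) (?e j))
        + (v' $ i) *\<^sub>R (w t $ j) *\<^sub>R \<Gamma> (x t) (?e i) (?e j))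
     = (\<Sum>i\<in>UNIV. \<Sum>j\<in>UNIV. (v t $ i) *\<^sub>R (w t $ j) *\<^sub>R d\<Gamma> (x t) x' (?e i) (?e j))
       + \<Gamma> (x t) v' (w t) + \<Gamma> (x t) (v t) w'"
    unfolding christoffel_expansion[OF xt, of v'] christoffel_expansion[OF xt, of "v t"]
    by (simp add: sum.distrib scaleR_add_right)
  also have "(\<Sum>i\<in>UNIV. \<Sum>j\<in>UNIV. (v t $ i) *\<^sub>R (w t $ j) *\<^sub>R d\<Gamma> (x t) x' (?e i) (?e j)) = d\<Gamma> (x t) x' (v t) (w t)"
    using linear_axis_expansion[OF dchristoffel_linear(2)[OF xt], of x' "v t" "w t"]
      linear_axis_expansion[OF dchristoffel_linear(3)[OF xt], of x' _ "w t"]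
    by (simp add: scaleR_sum_right)
  finally show ?thesis
    by (rule has_vector_derivative_transform_within_open[OF _ I]) (simp only: christoffel_expansion[OF xU, symmetric])
qed

lemma g_along:
  assumes xt: "x t \<in> U"
    and x: "(x has_vector_derivative x') (at t)"
    and v: "(v has_vector_derivative v') (at t)" and w: "(w has_vector_derivative w') (at t)"
  shows "((\<lambda>s. g (x s) (v s) (w s)) has_vector_derivative
     dg (x t) x' (v t) (w t) + g (x t) v' (w t) + g (x t) (v t) w') (at t)"
proof -
  have G: "((\<lambda>s. G (x s)) has_vector_derivative dir_deriv G (x t) x') (at t)"
    by (rule has_vector_derivative_compose_dir[of G _ x, OF smooth_on_has_derivative[OF smoothG openU xt] x])
  have "((\<lambda>s. v s \<bullet> (G (x s) *v w s)) has_vector_derivative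
     v t \<bullet> (G (x t) *v w' + dir_deriv G (x t) x' *v w t) + v' \<bullet> (G (x t) *v w t)) (at t)"
    by (intro bounded_bilinear.has_vector_derivative[OF bounded_bilinear_inner]
       bounded_bilinear.has_vector_derivative[OF bounded_bilinear_matrix_vector_mult] v w G)
  then show ?thesis unfolding dg_eq[OF xt] unfolding ginner_def by (simp add: inner_add_right algebra_simps)
qed

section \<open>Curvature and covariant derivatives of tensors along geodesics\<close>

text \<open>This is \<open>curvature_op\<close> on fields with constant components: their bracket
  vanishes, and each second covariant derivative leaves one derivative of \<Gamma> and one quadratic
  term.\<close>

definition Rc :: "real^'n \<Rightarrow> real^'n \<Rightarrow> real^'n \<Rightarrow> real^'n \<Rightarrow> real^'n" where
  "Rc x u v w = d\<Gamma> x u v w + \<Gamma> x u (\<Gamma> x v w) - d\<Gamma> x v u w - \<Gamma> x v (\<Gamma> x u w)"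

lemma curvature_op_const:
  assumes "x \<in> U"
  shows "curvature_op G (\<lambda>_. u) (\<lambda>_. v) (\<lambda>_. w) x = Rc x u v w"
  by (simp add: curvature_op_def nabla_def[abs_def] lie_bracket_def[abs_def] Rc_def d\<Gamma>_def christoffel_simps[OF assms])

lemma Rc_linear:
  assumes x: "x \<in> U"
  shows "linear (\<lambda>u. Rc x u v w)" "linear (\<lambda>v. Rc x u v w)" "linear (\<lambda>w. Rc x u v w)"
  unfolding Rc_def
  by (rule linearI; simp add: dchristoffel_simps[OF x] christoffel_simps[OF x] algebra_simps)+

lemma smooth_christoffel_compose:
  assumes "smooth_on U z"
  shows "smooth_on U (\<lambda>x. \<Gamma> x u (z x))"
proof -
  have "smooth_on U (\<lambda>x. \<Sum>k\<in>UNIV. (z x $ k) *\<^sub>R \<Gamma> x u (axis k 1))"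
    by (intro smooth_on_sum smooth_on_bilinear[OF bounded_bilinear_scaleR] smooth_on_vec_nth smooth_christoffel openU assms)
  then show ?thesis
    by (rule smooth_on_cong[OF _ openU]) (rule linear_axis_expansion[OF christoffel_linear_right, symmetric])
qed

lemma smooth_Rc: "smooth_on U (\<lambda>x. Rc x u v w)"
  unfolding Rc_def d\<Gamma>_def
  by (intro smooth_on_diff smooth_on_add smooth_on_dir_deriv smooth_christoffel_compose smooth_christoffel openU)

text \<open>Smoothness is asked for constant arguments; with linearity in each slot it extends to
  moving arguments by expansion in coordinates.\<close>

definition tensor_field :: "nat \<Rightarrow> (real^'n \<Rightarrow> (real^'n) list \<Rightarrow> real) \<Rightarrow> bool" where
  "tensor_field r T \<longleftrightarrow> (\<forall>vs. length vs = r \<longrightarrow> smooth_on U (\<lambda>x. T x vs)) \<and>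
     (\<forall>x\<in>U. \<forall>vs i. length vs = r \<longrightarrow> i < r \<longrightarrow> linear (\<lambda>v. T x (vs[i := v])))"

lemma riemann_tensor_eq:
  "x \<in> U \<Longrightarrow> riemann_tensor G x vs = g x (Rc x (vs ! 0) (vs ! 1) (vs ! 2)) (vs ! 3)"
  by (simp add: riemann_tensor_def curvature_op_const)

lemma tensor_field_riemann: "tensor_field 4 (riemann_tensor G)"
  unfolding tensor_field_def
proof (intro conjI allI impI ballI)
  fix vs :: "(real^'n) list"
  have "smooth_on U (\<lambda>x. Rc x (vs ! 0) (vs ! 1) (vs ! 2) \<bullet> (G x *v (vs ! 3)))"
    by (intro smooth_on_bilinear[OF bounded_bilinear_inner] smooth_Rc openU
        smooth_on_bounded_linear[OF bounded_bilinear.bounded_linear_left[OF bounded_bilinear_matrix_vector_mult]] smoothG)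
  then show "smooth_on U (\<lambda>x. riemann_tensor G x vs)"
    by (rule smooth_on_cong[OF _ openU]) (simp add: riemann_tensor_eq ginner_def)
next
  fix x and i :: nat and vs :: "(real^'n) list" assume x: "x \<in> U" and vs: "length vs = 4" and "i < 4"
  then consider "i = 0" | "i = 1" | "i = 2" | "i = 3" by linarith
  then show "linear (\<lambda>v. riemann_tensor G x (vs[i := v]))"
  proof cases
    case 1
    then show ?thesis using vs linear_compose[OF Rc_linear(1)[OF x] ginner_linear_left]
      by (simp add: riemann_tensor_eq[OF x] o_def)
  next
    case 2
    then show ?thesis using vs linear_compose[OF Rc_linear(2)[OF x] ginner_linear_left]
      by (simp add: riemann_tensor_eq[OF x] o_def)
  next
    case 3
    then show ?thesis using vs linear_compose[OF Rc_linear(3)[OF x] ginner_linear_left]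
      by (simp add: riemann_tensor_eq[OF x] o_def)
  next
    case 4
    then show ?thesis using vs ginner_linear_right
      by (simp add: riemann_tensor_eq[OF x])
  qed
qed

lemma tensor_field_slot_derivative_linear:
  assumes T: "tensor_field r T" and x: "x \<in> U" and vs: "length vs = r" "i < r"
  shows "linear (\<lambda>v. dir_deriv (\<lambda>y. T y (vs[i := v])) x u)"
proof (rule linearI)
  fix a b :: "real^'n" and c :: real
  have D: "((\<lambda>y. T y (vs[i := v])) has_derivative dir_deriv (\<lambda>y. T y (vs[i := v])) x) (at x)" for v
    using T vs by (intro smooth_on_has_derivative[OF _ openU x]) (auto simp: tensor_field_def)
  have lin: "linear (\<lambda>v. T y (vs[i := v]))" if "y \<in> U" for y using T vs that by (auto simp: tensor_field_def)
  show "dir_deriv (\<lambda>y. T y (vs[i := a + b])) x u = dir_deriv (\<lambda>y. T y (vs[i := a])) x u + dir_deriv (\<lambda>y. T y (vs[i := b])) x u"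
    using dir_deriv_cong[OF openU x, of "\<lambda>y. T y (vs[i := a + b])" "\<lambda>y. T y (vs[i := a]) + T y (vs[i := b])"]
      linear_add[OF lin] dir_deriv_eq[OF has_derivative_add[OF D D]] by simp
  show "dir_deriv (\<lambda>y. T y (vs[i := c *\<^sub>R a])) x u = c *\<^sub>R dir_deriv (\<lambda>y. T y (vs[i := a])) x u"
    using dir_deriv_cong[OF openU x, of "\<lambda>y. T y (vs[i := c *\<^sub>R a])" "\<lambda>y. c *\<^sub>R T y (vs[i := a])"]
      linear_cmul[OF lin] dir_deriv_eq[OF has_derivative_scaleR_right[OF D]] by simp
qed

text \<open>In the new last slot, the direction of differentiation, linearity comes from
  \<open>dir_deriv\<close> and from \<Gamma>. For an old slot i, one term of the correction sum lets
  \<Gamma> act on the varied vector itself, and the other terms merely carry it along.\<close>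

lemma tensor_field_cov_deriv:
  assumes T: "tensor_field r T"
  shows "tensor_field (Suc r) (cov_deriv G T)"
  unfolding tensor_field_def
proof (intro conjI allI impI ballI)
  fix vs :: "(real^'n) list" assume vs: "length vs = Suc r"
  define ws where "ws = butlast vs"
  define u where "u = last vs"
  have ws: "length ws = r" using vs by (simp add: ws_def)
  have lin: "linear (\<lambda>v. T x (ws[i := v]))" if "x \<in> U" "i < r" for x i
    using T ws that by (auto simp: tensor_field_def)
  have sm: "smooth_on U (\<lambda>x. T x (ws[i := v]))" for i v using T ws by (auto simp: tensor_field_def)
  have s1: "smooth_on U (\<lambda>x. T x (ws[i := \<Gamma> x u (ws ! i)]))" if "i < r" for i
  proof -
    have "smooth_on U (\<lambda>x. \<Sum>k\<in>UNIV. (\<Gamma> x u (ws ! i) $ k) *\<^sub>R T x (ws[i := axis k 1]))"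
      by (intro smooth_on_sum smooth_on_bilinear[OF bounded_bilinear_scaleR] smooth_on_vec_nth smooth_christoffel openU sm)
    then show ?thesis
      by (rule smooth_on_cong[OF _ openU]) (rule linear_axis_expansion[OF lin[OF _ that], symmetric])
  qed
  have "smooth_on U (\<lambda>y. T y ws)" using T ws by (auto simp: tensor_field_def)
  then have "smooth_on U (\<lambda>x. dir_deriv (\<lambda>y. T y ws) x u - (\<Sum>i<length ws. T x (ws[i := \<Gamma> x u (ws ! i)])))"
    using s1 ws by (intro smooth_on_diff smooth_on_sum smooth_on_dir_deriv openU) auto
  then show "smooth_on U (\<lambda>x. cov_deriv G T x vs)"
    by (simp add: cov_deriv_def Let_def ws_def u_def)
next
  fix x i and vs :: "(real^'n) list" assume x: "x \<in> U" and vs: "length vs = Suc r" and i: "i < Suc r"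
  define ws where "ws = butlast vs"
  define u where "u = last vs"
  have ws: "length ws = r" using vs by (simp add: ws_def)
  have vs_eq: "vs = ws @ [u]" using vs by (auto simp: ws_def u_def intro!: append_butlast_last_id[symmetric])
  have lin: "linear (\<lambda>v. T x (ws'[i := v]))" if "i < r" "length ws' = r" for i ws'
    using T that x by (auto simp: tensor_field_def)
  show "linear (\<lambda>v. cov_deriv G T x (vs[i := v]))"
  proof (cases "i = r")
    case True
    have "cov_deriv G T x (vs[i := v]) = dir_deriv (\<lambda>y. T y ws) x v - (\<Sum>j<r. T x (ws[j := \<Gamma> x v (ws ! j)]))" for v
      using True ws by (simp add: cov_deriv_def Let_def vs_eq list_update_append)
    moreover have "linear (dir_deriv (\<lambda>y. T y ws) x)"
      using T ws by (intro smooth_on_linear_dir_deriv[OF _ openU x]) (auto simp: tensor_field_def)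
    moreover have "linear (\<lambda>v. \<Sum>j<r. T x (ws[j := \<Gamma> x v (ws ! j)]))"
      using ws linear_compose[OF christoffel_linear_left[OF x] lin]
      by (intro linear_compose_sum ballI) (auto simp: o_def)
    ultimately show ?thesis using linear_compose_sub by simp
  next
    case False
    then have ir: "i < r" using i by simp
    have "cov_deriv G T x (vs[i := v]) = dir_deriv (\<lambda>y. T y (ws[i := v])) x u
       - (\<Sum>j<r. T x (ws[i := v, j := \<Gamma> x u (ws[i := v] ! j)]))" for v
      using ir ws by (simp add: cov_deriv_def Let_def vs_eq list_update_append)
    moreover have "linear (\<lambda>v. dir_deriv (\<lambda>y. T y (ws[i := v])) x u)"
      by (rule tensor_field_slot_derivative_linear[OF T x ws ir])
    moreover have "linear (\<lambda>v. \<Sum>j<r. T x (ws[i := v, j := \<Gamma> x u (ws[i := v] ! j)]))"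
    proof (intro linear_compose_sum ballI)
      fix j assume j: "j \<in> {..<r}"
      show "linear (\<lambda>v. T x (ws[i := v, j := \<Gamma> x u (ws[i := v] ! j)]))"
      proof (cases "j = i")
        case True
        then show ?thesis using linear_compose[OF christoffel_linear_right[OF x] lin[OF ir ws]] ws ir
          by (simp add: o_def)
      next
        case False
        then have "(\<lambda>v. T x (ws[i := v, j := \<Gamma> x u (ws[i := v] ! j)])) = (\<lambda>v. T x ((ws[j := \<Gamma> x u (ws ! j)])[i := v]))"
          by (auto simp: list_update_swap)
        then show ?thesis using lin[OF ir, of "ws[j := \<Gamma> x u (ws ! j)]"] ws by simp
      qed
    qed
    ultimately show ?thesis using linear_compose_sub by simp
  qed
qed

lemma tensor_along:
  assumes T: "tensor_field r T" and I: "open I" "t \<in> I" and xU: "\<And>s. s \<in> I \<Longrightarrow> x s \<in> U"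
    and x: "(x has_vector_derivative x') (at t)"
    and Ws: "length Ws = r" "length Ws' = r"
    and W: "\<And>i. i < r \<Longrightarrow> (Ws ! i has_vector_derivative Ws' ! i) (at t)"
  shows "((\<lambda>s. T (x s) (map (\<lambda>W. W s) Ws)) has_vector_derivative
     dir_deriv (\<lambda>y. T y (map (\<lambda>W. W t) Ws)) (x t) x'
       + (\<Sum>i<r. T (x t) ((map (\<lambda>W. W t) Ws)[i := Ws' ! i]))) (at t)"
proof -
  \<comment> \<open>The first j slots move with time and the others are frozen at \<open>vs\<close>.
    The induction on j releases one slot at a time, expanding the released vector in
    coordinates.\<close>
  define L where "L j vs s = map (\<lambda>W. W s) (take j Ws) @ drop j vs" for j vs s
  have xt: "x t \<in> U" using I xU by blast
  have "((\<lambda>s. T (x s) (L j vs s)) has_vector_derivative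
     dir_deriv (\<lambda>y. T y (L j vs t)) (x t) x' + (\<Sum>i<j. T (x t) ((L j vs t)[i := Ws' ! i]))) (at t)"
    if "j \<le> r" "length vs = r" for j vs
    using that
  proof (induction j arbitrary: vs)
    case 0
    have "smooth_on U (\<lambda>y. T y vs)" using T 0 by (auto simp: tensor_field_def)
    from has_vector_derivative_compose_dir[of "\<lambda>y. T y vs" _ x, OF smooth_on_has_derivative[OF this openU xt] x]
    show ?case by (simp add: L_def)
  next
    case (Suc j)
    then have j: "j < r" by simp
    let ?e = "\<lambda>k. axis k 1 :: real^'n"
    define W where "W = Ws ! j"
    define W' where "W' = Ws' ! j"
    have lenL: "length (L j vs s) = r" for s using Suc.prems Ws by (simp add: L_def)
    have upd: "(L j vs s)[j := v] = L j (vs[j := v]) s" for v s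
      using Suc.prems Ws by (simp add: L_def list_update_append drop_update_swap)
    have LS: "L (Suc j) vs s = (L j vs s)[j := W s]" for s
    proof (rule nth_equalityI)
      show "length (L (Suc j) vs s) = length ((L j vs s)[j := W s])" using Suc.prems Ws by (simp add: L_def)
      fix i assume "i < length (L (Suc j) vs s)"
      then show "L (Suc j) vs s ! i = (L j vs s)[j := W s] ! i"
        using Suc.prems Ws by (auto simp: L_def nth_append nth_list_update W_def less_Suc_eq)
    qed
    have lin: "linear (\<lambda>v. T y (vs'[i := v]))" if "y \<in> U" "length vs' = r" "i < r" for y vs' i
      using T that by (auto simp: tensor_field_def)
    have nth: "((\<lambda>s. W s $ k) has_real_derivative W' $ k) (at t)" for k
      using bounded_linear.has_vector_derivative[OF bounded_linear_vec_nth assms(8)[OF j]]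
      by (simp add: has_real_derivative_iff_has_vector_derivative W_def W'_def)
    have IH: "((\<lambda>s. T (x s) ((L j vs s)[j := ?e k])) has_vector_derivative
       dir_deriv (\<lambda>y. T y ((L j vs t)[j := ?e k])) (x t) x' + (\<Sum>i<j. T (x t) ((L j vs t)[j := ?e k, i := Ws' ! i]))) (at t)" for k
      unfolding upd using Suc.IH[of "vs[j := ?e k]"] Suc.prems by simp
    have "((\<lambda>s. \<Sum>k\<in>UNIV. (W s $ k) *\<^sub>R T (x s) ((L j vs s)[j := ?e k])) has_vector_derivative
        (\<Sum>k\<in>UNIV. (W t $ k) *\<^sub>R (dir_deriv (\<lambda>y. T y ((L j vs t)[j := ?e k])) (x t) x' + (\<Sum>i<j. T (x t) ((L j vs t)[j := ?e k, i := Ws' ! i])))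
          + (W' $ k) *\<^sub>R T (x t) ((L j vs t)[j := ?e k]))) (at t)"
      by (intro has_vector_derivative_sum has_vector_derivative_scaleR nth IH)
    also have "(\<Sum>k\<in>UNIV. (W t $ k) *\<^sub>R (dir_deriv (\<lambda>y. T y ((L j vs t)[j := ?e k])) (x t) x' + (\<Sum>i<j. T (x t) ((L j vs t)[j := ?e k, i := Ws' ! i])))
          + (W' $ k) *\<^sub>R T (x t) ((L j vs t)[j := ?e k]))
      = (\<Sum>k\<in>UNIV. (W t $ k) *\<^sub>R dir_deriv (\<lambda>y. T y ((L j vs t)[j := ?e k])) (x t) x')
        + (\<Sum>i<j. \<Sum>k\<in>UNIV. (W t $ k) *\<^sub>R T (x t) ((L j vs t)[j := ?e k, i := Ws' ! i]))
        + (\<Sum>k\<in>UNIV. (W' $ k) *\<^sub>R T (x t) ((L j vs t)[j := ?e k]))"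
      by (simp add: sum.distrib scaleR_add_right distrib_left sum_distrib_left) (rule sum.swap)
    also have "(\<Sum>k\<in>UNIV. (W t $ k) *\<^sub>R dir_deriv (\<lambda>y. T y ((L j vs t)[j := ?e k])) (x t) x')
       = dir_deriv (\<lambda>y. T y ((L j vs t)[j := W t])) (x t) x'"
      by (rule linear_axis_expansion[OF tensor_field_slot_derivative_linear[OF T xt lenL j], symmetric])
    also have "(\<Sum>k\<in>UNIV. (W' $ k) *\<^sub>R T (x t) ((L j vs t)[j := ?e k])) = T (x t) ((L j vs t)[j := W'])"
      by (rule linear_axis_expansion[OF lin[OF xt lenL j], symmetric])
    also have "(\<Sum>i<j. \<Sum>k\<in>UNIV. (W t $ k) *\<^sub>R T (x t) ((L j vs t)[j := ?e k, i := Ws' ! i]))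
       = (\<Sum>i<j. T (x t) ((L j vs t)[j := W t, i := Ws' ! i]))"
    proof (rule sum.cong[OF refl])
      fix i assume "i \<in> {..<j}"
      then have sw: "(L j vs t)[j := v, i := Ws' ! i] = (L j vs t)[i := Ws' ! i, j := v]" for v
        by (simp add: list_update_swap)
      show "(\<Sum>k\<in>UNIV. (W t $ k) *\<^sub>R T (x t) ((L j vs t)[j := ?e k, i := Ws' ! i])) = T (x t) ((L j vs t)[j := W t, i := Ws' ! i])"
        unfolding sw by (rule linear_axis_expansion[OF lin[OF xt _ j], symmetric]) (simp add: lenL)
    qed
    finally have "((\<lambda>s. \<Sum>k\<in>UNIV. (W s $ k) *\<^sub>R T (x s) ((L j vs s)[j := ?e k])) has_vector_derivative
       dir_deriv (\<lambda>y. T y (L (Suc j) vs t)) (x t) x' + (\<Sum>i<Suc j. T (x t) ((L (Suc j) vs t)[i := Ws' ! i]))) (at t)"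
      by (simp add: LS W'_def add.assoc)
    then show ?case
      by (rule has_vector_derivative_transform_within_open[OF _ I])
         (simp only: LS linear_axis_expansion[OF lin[OF xU lenL j], symmetric])
  qed
  from this[of r "replicate r 0"] show ?thesis using Ws by (simp add: L_def)
qed

text \<open>For parallel arguments the derivatives of the slots are exactly the Christoffel
  corrections in \<open>cov_deriv\<close>. Differentiating the scalar along the curve thus appends
  one direction to the covariant derivative.\<close>

lemma tensor_along_parallel:
  assumes T: "tensor_field r T" and I: "open I" "t \<in> I" and xU: "\<And>s. s \<in> I \<Longrightarrow> x s \<in> U"
    and x: "(x has_vector_derivative x') (at t)" and Ws: "length Ws = r"
    and W: "\<And>i. i < r \<Longrightarrow> (Ws ! i has_vector_derivative - \<Gamma> (x t) x' ((Ws ! i) t)) (at t)"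
  shows "((\<lambda>s. T (x s) (map (\<lambda>W. W s) Ws)) has_vector_derivative
     cov_deriv G T (x t) (map (\<lambda>W. W t) Ws @ [x'])) (at t)"
proof -
  let ?ws = "map (\<lambda>W. W t) Ws"
  have xt: "x t \<in> U" using I xU by blast
  have "T (x t) (?ws[i := - \<Gamma> (x t) x' (?ws ! i)]) = - T (x t) (?ws[i := \<Gamma> (x t) x' (?ws ! i)])" if "i < r" for i
    using T xt Ws that linear_neg[of "\<lambda>v. T (x t) (?ws[i := v])"] by (auto simp: tensor_field_def)
  then have "(\<Sum>i<r. T (x t) (?ws[i := (map (\<lambda>W. - \<Gamma> (x t) x' (W t)) Ws) ! i])) = - (\<Sum>i<r. T (x t) (?ws[i := \<Gamma> (x t) x' (?ws ! i)]))"
    using Ws by (simp add: sum_negf[symmetric])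
  then show ?thesis
    using tensor_along[OF T I xU x Ws, of "map (\<lambda>W. - \<Gamma> (x t) x' (W t)) Ws"] W Ws
    by (simp add: cov_deriv_def Let_def)
qed

section \<open>The geodesic vector field\<close>

text \<open>The geodesic spray: the second order equation as a first order system for position and
  velocity.\<close>

definition geo :: "(real^'n) \<times> (real^'n) \<Rightarrow> (real^'n) \<times> (real^'n)" where
  "geo z = (snd z, - \<Gamma> (fst z) (snd z) (snd z))"

lemma smooth_geo: "smooth_on (U \<times> UNIV) geo"
proof -
  let ?e = "\<lambda>i. axis i 1 :: real^'n"
  have W: "fst -` U = U \<times> (UNIV :: (real^'n) set)" by auto
  have oW: "open (U \<times> (UNIV :: (real^'n) set))" by (simp add: open_Times openU)
  have W2: "smooth_on (U \<times> UNIV) (\<lambda>z::(real^'n) \<times> (real^'n). snd z)"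
    unfolding smooth_on_def
  proof
    fix k
    show "Ck_on k (U \<times> UNIV) (\<lambda>z::(real^'n) \<times> (real^'n). snd z)"
    proof (cases k)
      case (Suc j)
      show ?thesis unfolding Suc
        by (rule Ck_on_SucI[OF oW, where f'="\<lambda>_. snd"])
           (auto intro!: Ck_on_const oW bounded_linear_imp_has_derivative bounded_linear_snd)
    qed (auto intro!: continuous_intros)
  qed
  have bf: "bounded_linear (fst :: (real^'n) \<times> (real^'n) \<Rightarrow> real^'n)" by (rule bounded_linear_fst)
  have W1: "smooth_on (U \<times> UNIV) (\<lambda>z::(real^'n) \<times> (real^'n). \<Gamma> (fst z) (?e i) (?e j))" for i j
    using smooth_on_compose_linear[OF bf openU smooth_christoffel] unfolding W .
  have "smooth_on (U \<times> UNIV) (\<lambda>z::(real^'n) \<times> (real^'n). \<Sum>i\<in>UNIV. \<Sum>j\<in>UNIV. (snd z $ i) *\<^sub>R (snd z $ j) *\<^sub>R \<Gamma> (fst z) (?e i) (?e j))"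
    by (intro smooth_on_sum smooth_on_bilinear[OF bounded_bilinear_scaleR] oW smooth_on_vec_nth W1 W2)
  then have s: "smooth_on (U \<times> UNIV) (\<lambda>z. \<Gamma> (fst z) (snd z) (snd z))"
    by (rule smooth_on_cong[OF _ oW]) (rule christoffel_expansion[symmetric], auto)
  have b1: "bounded_linear (\<lambda>v::real^'n. (v, 0::real^'n))" "bounded_linear (\<lambda>v::real^'n. (0::real^'n, - v))"
    by (intro bounded_linear_Pair bounded_linear_ident bounded_linear_zero bounded_linear_minus)+
  have "smooth_on (U \<times> UNIV) (\<lambda>z. (snd z, 0) + (0, - \<Gamma> (fst z) (snd z) (snd z)))"
    by (intro smooth_on_add oW smooth_on_bounded_linear[OF b1(1)] smooth_on_bounded_linear[OF b1(2)] W2 s)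
  then show ?thesis by (simp add: geo_def[abs_def])
qed

text \<open>This linearisation is the Jacobi equation in coordinates, before covariant derivatives
  are introduced; the factor 2 merges the two equal terms that come from varying the
  velocity.\<close>

lemma dir_deriv_geo:
  assumes x: "x \<in> U"
  shows "dir_deriv geo (x, y) (a, b) = (b, - (d\<Gamma> x a y y + 2 *\<^sub>R \<Gamma> x y b))"
proof -
  define I where "I = (\<lambda>s::real. x + s *\<^sub>R a) -` U"
  have I: "open I" "0 \<in> I" using x by (auto simp: I_def intro!: open_vimage openU continuous_intros)
  have lin: "((\<lambda>s. p + s *\<^sub>R q) has_vector_derivative q) (at 0)" for p q :: "real^'n"
    by (auto intro!: derivative_eq_intros)
  have "((\<lambda>s. \<Gamma> (x + s *\<^sub>R a) (y + s *\<^sub>R b) (y + s *\<^sub>R b)) has_vector_derivative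
      d\<Gamma> x a y y + \<Gamma> x b y + \<Gamma> x y b) (at 0)"
    using christoffel_along[OF I _ lin lin lin, of x a y b y b] by (simp add: I_def)
  then have "((\<lambda>s. - \<Gamma> (x + s *\<^sub>R a) (y + s *\<^sub>R b) (y + s *\<^sub>R b)) has_vector_derivative
      - (d\<Gamma> x a y y + 2 *\<^sub>R \<Gamma> x y b)) (at 0)"
    using christoffel_sym[OF x, of b y] by (auto intro!: derivative_eq_intros simp: scaleR_2)
  from has_vector_derivative_Pair[OF lin[of y b] this]
  have "((\<lambda>s. geo ((x, y) + s *\<^sub>R (a, b))) has_vector_derivative (b, - (d\<Gamma> x a y y + 2 *\<^sub>R \<Gamma> x y b))) (at 0)"
    by (simp add: geo_def)
  then show ?thesis unfolding dir_deriv_def by (rule vector_derivative_at)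
qed

end

section \<open>Change of charts and the exponential map\<close>

lemma has_vector_derivative_time_shift:
  assumes "(h has_vector_derivative h') (at (t + s))"
  shows "((\<lambda>s. h (t + s)) has_vector_derivative h') (at s)"
  using vector_diff_chain_at[of "\<lambda>s. t + s" 1 s h h'] assms
    has_vector_derivative_add[OF has_vector_derivative_const has_vector_derivative_id, of t "at s"]
  by (simp add: o_def)

lemma has_vector_derivative_time_scale:
  assumes "(h has_vector_derivative h') (at (s * t))"
  shows "((\<lambda>t. h (s * t)) has_vector_derivative s *\<^sub>R h') (at t)"
  using vector_diff_chain_at[of "\<lambda>t. s * t" s t h h'] assms
     has_vector_derivative_mult_right[OF has_vector_derivative_id, of s "at t"] by (simp add: o_def)

lemma dir_deriv_slot_linear:
  assumes D: "open D" and T: "smooth_on D T" and x: "x \<in> D"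
  shows "linear (\<lambda>v. dir_deriv (\<lambda>y. dir_deriv T y v) x u)"
proof (rule linearI)
  have d: "((\<lambda>y. dir_deriv T y v) has_derivative dir_deriv (\<lambda>y. dir_deriv T y v) x) (at x)" for v
    by (rule smooth_on_has_derivative[OF smooth_on_dir_deriv[OF T] D x])
  note lin = smooth_on_linear_dir_deriv[OF T D]
  fix a b c
  show "dir_deriv (\<lambda>y. dir_deriv T y (a + b)) x u = dir_deriv (\<lambda>y. dir_deriv T y a) x u + dir_deriv (\<lambda>y. dir_deriv T y b) x u"
    using dir_deriv_cong[OF D x, of "\<lambda>y. dir_deriv T y (a + b)" "\<lambda>y. dir_deriv T y a + dir_deriv T y b"]
      linear_add[OF lin] dir_deriv_eq[OF has_derivative_add[OF d d]] by simp
  show "dir_deriv (\<lambda>y. dir_deriv T y (c *\<^sub>R a)) x u = c *\<^sub>R dir_deriv (\<lambda>y. dir_deriv T y a) x u"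
    using dir_deriv_cong[OF D x, of "\<lambda>y. dir_deriv T y (c *\<^sub>R a)" "\<lambda>y. c *\<^sub>R dir_deriv T y a"]
      linear_cmul[OF lin] dir_deriv_eq[OF has_derivative_scaleR_right[OF d]] by simp
qed

lemma dir_deriv_along:
  fixes T :: "real^'n \<Rightarrow> 'b::real_normed_vector"
  assumes D: "open D" and T: "smooth_on D T" and I: "open I" "t \<in> I" and xD: "\<And>s. s \<in> I \<Longrightarrow> x s \<in> D"
    and x: "(x has_vector_derivative x') (at t)" and v: "(v has_vector_derivative v') (at t)"
  shows "((\<lambda>s. dir_deriv T (x s) (v s)) has_vector_derivative
      dir_deriv (\<lambda>y. dir_deriv T y (v t)) (x t) x' + dir_deriv T (x t) v') (at t)"
proof -
  let ?e = "\<lambda>i. axis i 1 :: real^'n"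
  have xt: "x t \<in> D" using I xD by blast
  note lin = smooth_on_linear_dir_deriv[OF T D]
  have nth: "((\<lambda>s. v s $ k) has_real_derivative v' $ k) (at t)" for k
    using bounded_linear.has_vector_derivative[OF bounded_linear_vec_nth v]
    by (simp add: has_real_derivative_iff_has_vector_derivative)
  have d: "((\<lambda>s. dir_deriv T (x s) (?e k)) has_vector_derivative dir_deriv (\<lambda>y. dir_deriv T y (?e k)) (x t) x') (at t)" for k
    by (rule has_vector_derivative_compose_dir[of "\<lambda>y. dir_deriv T y (?e k)" _ x,
          OF smooth_on_has_derivative[OF smooth_on_dir_deriv[OF T] D xt] x])
  have "((\<lambda>s. \<Sum>k\<in>UNIV. (v s $ k) *\<^sub>R dir_deriv T (x s) (?e k)) has_vector_derivative
     (\<Sum>k\<in>UNIV. (v t $ k) *\<^sub>R dir_deriv (\<lambda>y. dir_deriv T y (?e k)) (x t) x' + (v' $ k) *\<^sub>R dir_deriv T (x t) (?e k))) (at t)"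
    by (intro has_vector_derivative_sum has_vector_derivative_scaleR nth d)
  then have "((\<lambda>s. \<Sum>k\<in>UNIV. (v s $ k) *\<^sub>R dir_deriv T (x s) (?e k)) has_vector_derivative
      dir_deriv (\<lambda>y. dir_deriv T y (v t)) (x t) x' + dir_deriv T (x t) v') (at t)"
    by (simp only: sum.distrib linear_axis_expansion[OF dir_deriv_slot_linear[OF D T xt], symmetric]
        linear_axis_expansion[OF lin[OF xt], symmetric])
  then show ?thesis
    by (rule has_vector_derivative_transform_within_open[OF _ I])
       (simp only: linear_axis_expansion[OF lin[OF xD], symmetric])
qed

text \<open>Symmetry of the second derivative of \<open>T\<close> makes its unwanted terms cancel in Koszul's formula.\<close>

lemma christoffel_transformation:
  fixes U1 U2 D :: "(real^'n::finite) set"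
  assumes 1: "chart_metric U1 G1" and 2: "chart_metric U2 G2"
    and D: "open D" "D \<subseteq> U1" and T: "smooth_on D T" "T ` D \<subseteq> U2"
    and iso: "\<And>x v w. x \<in> D \<Longrightarrow> ginner G2 (T x) (dir_deriv T x v) (dir_deriv T x w) = ginner G1 x v w"
    and x: "x \<in> D"
  shows "dir_deriv (\<lambda>y. dir_deriv T y v) x v + christoffel G2 (T x) (dir_deriv T x v) (dir_deriv T x v)
     = dir_deriv T x (christoffel G1 x v v)"
proof -
  interpret c1: chart_metric U1 G1 by (rule 1)
  interpret c2: chart_metric U2 G2 by (rule 2)
  define T2 where "T2 u v = dir_deriv (\<lambda>y. dir_deriv T y v) x u" for u v
  define L where "L = dir_deriv T x"
  have lin: "linear L" unfolding L_def by (rule smooth_on_linear_dir_deriv[OF T(1) D(1) x])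
  have xU: "x \<in> U1" "T x \<in> U2" using D T x by auto
  \<comment> \<open>An isometry of definite forms is injective, hence onto in equal dimension, so
    every test vector below has the form L e.\<close>
  have "inj L"
  proof (rule linear_injective_0[OF lin, THEN iffD2], intro allI impI)
    fix a assume "L a = 0"
    then have "ginner G1 x a a = 0" using iso[OF x, of a a] by (simp add: L_def ginner_simps)
    then show "a = 0" using c1.posG[OF xU(1), of a] by fastforce
  qed
  then have surj: "surj L" using linear_injective_imp_surjective[OF lin] by blast
  \<comment> \<open>The isometry identity differentiated in direction u; \<open>T2\<close> collects
    the second derivatives of the transition map.\<close>
  have key: "c1.dg x u a b = c2.dg (T x) (L u) (L a) (L b) + c2.g (T x) (T2 u a) (L b) + c2.g (T x) (L a) (T2 u b)" for u a b
  proof -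
    define I where "I = (\<lambda>s::real. x + s *\<^sub>R u) -` D"
    have I: "open I" "0 \<in> I" using x by (auto simp: I_def intro!: open_vimage D continuous_intros)
    have l: "((\<lambda>s. x + s *\<^sub>R u) has_vector_derivative u) (at 0)"
      by (auto intro!: derivative_eq_intros)
    have IT: "((\<lambda>s. T (x + s *\<^sub>R u)) has_vector_derivative L u) (at 0)"
      using has_vector_derivative_compose_dir[of T _ "\<lambda>s. x + s *\<^sub>R u" 0 u] l
        smooth_on_has_derivative[OF T(1) D(1) x] by (simp add: L_def)
    have ID: "((\<lambda>s. dir_deriv T (x + s *\<^sub>R u) w) has_vector_derivative T2 u w) (at 0)" for w
      using has_vector_derivative_compose_dir[of "\<lambda>y. dir_deriv T y w" _ "\<lambda>s. x + s *\<^sub>R u" 0 u] l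
        smooth_on_has_derivative[OF smooth_on_dir_deriv[OF T(1)] D(1) x] by (simp add: T2_def)
    have "((\<lambda>s. c2.g (T (x + s *\<^sub>R u)) (dir_deriv T (x + s *\<^sub>R u) a) (dir_deriv T (x + s *\<^sub>R u) b)) has_vector_derivative
        c2.dg (T x) (L u) (L a) (L b) + c2.g (T x) (T2 u a) (L b) + c2.g (T x) (L a) (T2 u b)) (at 0)"
      using c2.g_along[of "\<lambda>s. T (x + s *\<^sub>R u)" 0, OF _ IT ID ID] xU by (simp add: L_def)
    then have "((\<lambda>s. c1.g (x + s *\<^sub>R u) a b) has_vector_derivative
        c2.dg (T x) (L u) (L a) (L b) + c2.g (T x) (T2 u a) (L b) + c2.g (T x) (L a) (T2 u b)) (at 0)"
      by (rule has_vector_derivative_transform_within_open[OF _ I]) (simp add: I_def iso)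
    then show ?thesis unfolding c1.dg_def by (subst dir_deriv_def) (rule vector_derivative_at)
  qed
  have sym: "T2 a b = T2 b a" for a b
    unfolding T2_def by (rule dir_deriv_commute[OF D(1) T(1) x])
  have "T2 v v + c2.\<Gamma> (T x) (L v) (L v) = L (c1.\<Gamma> x v v)"
  proof (rule c2.g_nondegenerate[OF xU(2)])
    fix a
    obtain e where a: "a = L e" using surj by blast
    have "c2.g (T x) (T2 v v + c2.\<Gamma> (T x) (L v) (L v)) a
       = c2.g (T x) (T2 v v) (L e) + c2.dg (T x) (L v) (L v) (L e) - c2.dg (T x) (L e) (L v) (L v) / 2"
      by (simp add: a ginner_simps c2.g_christoffel[OF xU(2)])
    also have "\<dots> = c1.g x (c1.\<Gamma> x v v) e"
      unfolding c1.g_christoffel[OF xU(1)] key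
      using sym[of v e] c2.symG[OF xU(2), of "T2 e v" "L v"] by (simp add: field_simps)
    also have "\<dots> = c2.g (T x) (L (c1.\<Gamma> x v v)) a" unfolding a L_def by (rule iso[OF x, symmetric])
    finally show "c2.g (T x) (T2 v v + c2.\<Gamma> (T x) (L v) (L v)) a = c2.g (T x) (L (c1.\<Gamma> x v v)) a" .
  qed
  then show ?thesis by (simp add: T2_def L_def)
qed

section \<open>Geodesics across charts and the exponential map\<close>

abbreviation cinv :: "('a, 'n::finite) chart \<Rightarrow> real^'n \<Rightarrow> 'a" where
  "cinv c \<equiv> inv_into (cdom c) (cmap c)"

lemma chart_facts:
  assumes M: "smooth_manifold M" and c: "c \<in> atlas M"
  shows "openin (mtop M) (cdom c)" "open (cmap c ` cdom c)" "inj_on (cmap c) (cdom c)"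
    "continuous_map (top_of_set (cmap c ` cdom c)) (mtop M) (cinv c)"
    "continuous_map (subtopology (mtop M) (cdom c)) euclidean (cmap c)"
    "S \<subseteq> cdom c \<Longrightarrow> openin (mtop M) S \<Longrightarrow> open (cmap c ` S)"
proof -
  show 1: "openin (mtop M) (cdom c)" and 2: "open (cmap c ` cdom c)"
    using M c unfolding smooth_manifold_def by blast+
  have h: "homeomorphic_map (subtopology (mtop M) (cdom c)) (top_of_set (cmap c ` cdom c)) (cmap c)"
    using M c unfolding smooth_manifold_def by blast
  have sub: "cdom c \<subseteq> topspace (mtop M)" using 1 openin_subset by blast
  then have ts: "topspace (subtopology (mtop M) (cdom c)) = cdom c" by auto
  show inj: "inj_on (cmap c) (cdom c)"
    using homeomorphic_imp_injective_map[OF h] ts by simp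
  show "continuous_map (subtopology (mtop M) (cdom c)) euclidean (cmap c)"
    using homeomorphic_imp_continuous_map[OF h] continuous_map_in_subtopology by blast
  obtain f where f: "homeomorphic_maps (subtopology (mtop M) (cdom c)) (top_of_set (cmap c ` cdom c)) (cmap c) f"
    using h homeomorphic_map_maps by blast
  have eq: "f y = cinv c y" if y: "y \<in> cmap c ` cdom c" for y
  proof -
    obtain p where p: "p \<in> cdom c" "y = cmap c p" using y by blast
    have "f y = p" using f p ts unfolding homeomorphic_maps_def by simp
    then show ?thesis using inv_into_f_f[OF inj p(1)] p by simp
  qed
  have "continuous_map (top_of_set (cmap c ` cdom c)) (mtop M) f"
    using f continuous_map_into_fulltopology unfolding homeomorphic_maps_def by blast
  then show "continuous_map (top_of_set (cmap c ` cdom c)) (mtop M) (cinv c)"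
    by (rule continuous_map_eq) (use eq in auto)
  assume S: "S \<subseteq> cdom c" "openin (mtop M) S"
  then have "openin (subtopology (mtop M) (cdom c)) S" by (simp add: openin_subtopology_alt inf.absorb_iff2) blast
  then have "openin (top_of_set (cmap c ` cdom c)) (cmap c ` S)"
    using homeomorphic_imp_open_map[OF h] unfolding open_map_def by blast
  then show "open (cmap c ` S)" using 2 openin_open_trans by blast
qed

lemma riemannian_chart_metric:
  assumes "riemannian_manifold M" "c \<in> atlas M"
  shows "chart_metric (cmap c ` cdom c) (gmat M c)"
proof
  have sm: "smooth_manifold M" using assms by (simp add: riemannian_manifold_def)
  show "open (cmap c ` cdom c)" by (rule chart_facts(2)[OF sm assms(2)])
qed (use assms in \<open>auto simp: riemannian_manifold_def\<close>)

lemma continuous_map_open_preimage: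
  assumes "continuous_map (top_of_set I) X f" "open I" "openin X S"
  shows "open {t \<in> I. f t \<in> S}"
  using openin_continuous_map_preimage[OF assms(1,3)] assms(2) openin_open_trans by auto

text \<open>\<open>geodesic_on\<close> demands the equation in every chart that the curve meets. The
  transformation rule for \<Gamma> carries it over from c, the velocity being pushed forward by the
  transition map.\<close>

lemma chart_solution_geodesic_on:
  fixes M :: "('a, 'n::finite) manifold"
  assumes M: "riemannian_manifold M" and c: "c \<in> atlas M" and I: "open I" "is_interval I"
    and xU: "\<And>t. t \<in> I \<Longrightarrow> x t \<in> cmap c ` cdom c"
    and x: "\<And>t. t \<in> I \<Longrightarrow> (x has_vector_derivative y t) (at t)"
    and y: "\<And>t. t \<in> I \<Longrightarrow> (y has_vector_derivative - christoffel (gmat M c) (x t) (y t) (y t)) (at t)"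
  shows "geodesic_on M I (\<lambda>t. cinv c (x t))"
  unfolding geodesic_on_def
proof (intro conjI ballI)
  have sm: "smooth_manifold M" using M by (simp add: riemannian_manifold_def)
  interpret c1: chart_metric "cmap c ` cdom c" "gmat M c" by (rule riemannian_chart_metric[OF M c])
  show "open I" "is_interval I" by (rule I)+
  have xc: "continuous_on I x"
    using x has_vector_derivative_continuous continuous_at_imp_continuous_on by blast
  have "continuous_map (top_of_set I) (top_of_set (cmap c ` cdom c)) x"
    using xc xU by (auto simp: continuous_map_in_subtopology)
  then show cont: "continuous_map (top_of_set I) (mtop M) (\<lambda>t. cinv c (x t))"
    using continuous_map_compose[OF _ chart_facts(4)[OF sm c], of "top_of_set I" x] unfolding o_def by blast
  fix d assume d: "d \<in> atlas M"
  interpret c2: chart_metric "cmap d ` cdom d" "gmat M d" by (rule riemannian_chart_metric[OF M d])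
  define T where "T = transition c d"
  define D where "D = cmap c ` (cdom c \<inter> cdom d)"
  have inj: "inj_on (cmap c) (cdom c)" by (rule chart_facts(3)[OF sm c])
  have D: "open D" "D \<subseteq> cmap c ` cdom c"
    unfolding D_def using chart_facts(6)[OF sm c] chart_facts(1)[OF sm c] chart_facts(1)[OF sm d]
    by (auto simp: openin_Int)
  have T: "smooth_on D T" using sm c d unfolding smooth_manifold_def D_def T_def by blast
  have Tp: "T (cmap c p) = cmap d p" if "p \<in> cdom c" for p
    using inv_into_f_f[OF inj that] by (simp add: T_def transition_def)
  have TD: "T ` D \<subseteq> cmap d ` cdom d" using Tp by (auto simp: D_def)
  have iso: "ginner (gmat M d) (T x) (dir_deriv T x v) (dir_deriv T x w) = ginner (gmat M c) x v w" if "x \<in> D" for x v w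
  proof -
    obtain p where p: "p \<in> cdom c \<inter> cdom d" "x = cmap c p" using \<open>x \<in> D\<close> by (auto simp: D_def)
    have "ginner (gmat M d) (cmap d p) (dir_deriv T (cmap c p) v) (dir_deriv T (cmap c p) w) = ginner (gmat M c) (cmap c p) v w"
      using M c d p(1) unfolding riemannian_manifold_def T_def by blast
    then show ?thesis using p Tp[of p] by simp
  qed
  let ?\<gamma> = "\<lambda>t. cinv c (x t)"
  define J where "J = {t \<in> I. ?\<gamma> t \<in> cdom d}"
  have J: "open J" unfolding J_def by (rule continuous_map_open_preimage[OF cont I(1) chart_facts(1)[OF sm d]])
  have xD: "x t \<in> D" if "t \<in> J" for t
  proof -
    have "x t = cmap c (?\<gamma> t)" "?\<gamma> t \<in> cdom c"
      using xU[of t] that by (auto simp: J_def f_inv_into_f inv_into_into)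
    then show ?thesis using that unfolding D_def J_def by blast
  qed
  show "\<exists>v. \<forall>t\<in>I. ?\<gamma> t \<in> cdom d \<longrightarrow>
       ((cmap d \<circ> ?\<gamma>) has_vector_derivative v t) (at t) \<and>
       (v has_vector_derivative - christoffel (gmat M d) (cmap d (?\<gamma> t)) (v t) (v t)) (at t)"
  proof (intro exI[of _ "\<lambda>t. dir_deriv T (x t) (y t)"] ballI impI conjI)
    fix t assume t: "t \<in> I" "?\<gamma> t \<in> cdom d"
    then have tJ: "t \<in> J" by (simp add: J_def)
    have Teq: "(cmap d \<circ> ?\<gamma>) = (\<lambda>s. T (x s))" by (auto simp: T_def transition_def)
    show "((cmap d \<circ> ?\<gamma>) has_vector_derivative dir_deriv T (x t) (y t)) (at t)"
      unfolding Teq by (rule has_vector_derivative_compose_dir[of T _ x, OF smooth_on_has_derivative[OF T D(1) xD[OF tJ]] x[OF t(1)]])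
    have "((\<lambda>s. dir_deriv T (x s) (y s)) has_vector_derivative
        dir_deriv (\<lambda>z. dir_deriv T z (y t)) (x t) (y t) + dir_deriv T (x t) (- christoffel (gmat M c) (x t) (y t) (y t))) (at t)"
      by (rule dir_deriv_along[OF D(1) T J tJ xD x[OF t(1)] y[OF t(1)]])
    moreover have "dir_deriv (\<lambda>z. dir_deriv T z (y t)) (x t) (y t) + dir_deriv T (x t) (- christoffel (gmat M c) (x t) (y t) (y t))
       = - christoffel (gmat M d) (T (x t)) (dir_deriv T (x t) (y t)) (dir_deriv T (x t) (y t))"
      using christoffel_transformation[OF c1.chart_metric_axioms c2.chart_metric_axioms D T TD iso xD[OF tJ], of "y t"]
        linear_neg[OF smooth_on_linear_dir_deriv[OF T D(1) xD[OF tJ]], of "christoffel (gmat M c) (x t) (y t) (y t)"]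
      by (simp add: algebra_simps)
    ultimately show "((\<lambda>t. dir_deriv T (x t) (y t)) has_vector_derivative
       - christoffel (gmat M d) (cmap d (?\<gamma> t)) (dir_deriv T (x t) (y t)) (dir_deriv T (x t) (y t))) (at t)"
      using Teq by (simp add: fun_eq_iff)
  qed
qed

text \<open>\<open>exp_map\<close> refers to the endpoint of any geodesic with the given initial
  data, including one that might leave the chart. The times in [0, 1] at which position and velocity
  agree form a closed and open set. Closedness takes two stages, since the velocity \<open>v\<close>
  is controlled only while the curve lies in the chart: coincidence of positions is closed by the
  Hausdorff property, and agreement of velocities is closed within it. Openness is
  \<open>local_uniqueness\<close> for the spray.\<close>

lemma geodesic_unique:
  fixes M :: "('a, 'n::finite) manifold"
  assumes M: "riemannian_manifold M" and c: "c \<in> atlas M" and I: "open I" "is_interval I" "{0..1} \<subseteq> I"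
    and xU: "\<And>t. t \<in> I \<Longrightarrow> x t \<in> cmap c ` cdom c"
    and x: "\<And>t. t \<in> I \<Longrightarrow> (x has_vector_derivative y t) (at t)"
    and y: "\<And>t. t \<in> I \<Longrightarrow> (y has_vector_derivative - christoffel (gmat M c) (x t) (y t) (y t)) (at t)"
    and \<beta>: "geodesic_on M J \<beta>" "{0..1} \<subseteq> J" "\<beta> 0 = cinv c (x 0)"
    and \<beta>0: "((cmap c \<circ> \<beta>) has_vector_derivative y 0) (at 0)"
  shows "\<beta> 1 = cinv c (x 1)"
proof -
  have sm: "smooth_manifold M" using M by (simp add: riemannian_manifold_def)
  interpret c1: chart_metric "cmap c ` cdom c" "gmat M c" by (rule riemannian_chart_metric[OF M c])
  let ?U = "cmap c ` cdom c"
  define \<gamma> where "\<gamma> = (\<lambda>t. cinv c (x t))"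
  have \<gamma>: "cmap c (\<gamma> t) = x t" "\<gamma> t \<in> cdom c" if "t \<in> I" for t
    using xU[OF that] by (auto simp: \<gamma>_def f_inv_into_f inv_into_into)
  have inj: "inj_on (cmap c) (cdom c)" by (rule chart_facts(3)[OF sm c])
  have g\<gamma>: "geodesic_on M I \<gamma>" unfolding \<gamma>_def by (rule chart_solution_geodesic_on[OF M c I(1,2) xU x y])
  then have c\<gamma>: "continuous_map (top_of_set I) (mtop M) \<gamma>" by (simp add: geodesic_on_def)
  have J: "open J" and c\<beta>: "continuous_map (top_of_set J) (mtop M) \<beta>" using \<beta>(1) by (auto simp: geodesic_on_def)
  obtain v where v: "\<And>t. t \<in> J \<Longrightarrow> \<beta> t \<in> cdom c \<Longrightarrow> ((cmap c \<circ> \<beta>) has_vector_derivative v t) (at t)"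
     "\<And>t. t \<in> J \<Longrightarrow> \<beta> t \<in> cdom c \<Longrightarrow> (v has_vector_derivative - christoffel (gmat M c) (cmap c (\<beta> t)) (v t) (v t)) (at t)"
    using \<beta>(1) c unfolding geodesic_on_def by blast
  define E where "E = {t \<in> {0..1}. \<beta> t = \<gamma> t}"
  define S where "S = {t \<in> E. v t - y t = 0}"
  have EI: "t \<in> I" "t \<in> J" "\<beta> t \<in> cdom c" if "t \<in> E" for t
    using that I(3) \<beta>(2) \<gamma>(2)[of t] by (auto simp: E_def)
  have "closedin (top_of_set {0..1}) {t \<in> topspace (top_of_set {0..1}). \<beta> t = \<gamma> t}"
  proof (rule closedin_continuous_maps_eq)
    show "Hausdorff_space (mtop M)" using sm by (simp add: smooth_manifold_def)
    show "continuous_map (top_of_set {0..1}) (mtop M) \<beta>" "continuous_map (top_of_set {0..1}) (mtop M) \<gamma>"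
      using continuous_map_from_subtopology_mono c\<beta> c\<gamma> I(3) \<beta>(2) by blast+
  qed
  then have cE: "closedin (top_of_set {0..1}) E" by (simp add: E_def)
  have "continuous_on E (\<lambda>t. v t - y t)"
    by (intro continuous_intros continuous_at_imp_continuous_on ballI has_vector_derivative_continuous[OF v(2)]
         has_vector_derivative_continuous[OF y]) (use EI in auto)
  then have "closedin (top_of_set E) S"
    unfolding S_def by (rule continuous_closedin_preimage_constant)
  then have clS: "closedin (top_of_set {0..1}) S" using cE closedin_trans by blast
  have opS: "openin (top_of_set {0..1}) S"
    unfolding openin_euclidean_subtopology_iff
  proof (intro conjI ballI)
    show "S \<subseteq> {0..1}" by (auto simp: S_def E_def)
    fix t assume "t \<in> S"
    then have tE: "t \<in> E" and vt: "v t = y t" by (auto simp: S_def)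
    have oI: "open (I \<inter> {s \<in> J. \<beta> s \<in> cdom c})"
      using continuous_map_open_preimage[OF c\<beta> J chart_facts(1)[OF sm c]] I(1) by blast
    moreover have "t \<in> I \<inter> {s \<in> J. \<beta> s \<in> cdom c}" using EI[OF tE] by blast
    ultimately obtain d where d: "d > 0" "ball t d \<subseteq> I \<inter> {s \<in> J. \<beta> s \<in> cdom c}" using openE by blast
    have din: "t + s \<in> I" "t + s \<in> J" "\<beta> (t + s) \<in> cdom c" if "\<bar>s\<bar> < d" for s
    proof -
      have "t + s \<in> ball t d" using that by (simp add: dist_norm)
      then show "t + s \<in> I" "t + s \<in> J" "\<beta> (t + s) \<in> cdom c" using d(2) by auto
    qed
    define z where "z s = (x (t + s), y (t + s))" for s
    define w where "w s = (cmap c (\<beta> (t + s)), v (t + s))" for s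
    have ck: "Ck_on (Suc 0) (?U \<times> UNIV) c1.geo" using c1.smooth_geo by (simp only: smooth_on_def)
    have oW: "open (?U \<times> (UNIV :: (real^'n) set))" by (simp add: open_Times c1.openU)
    obtain \<delta> where \<delta>: "\<delta> > 0" "\<And>s. \<bar>s\<bar> < \<delta> \<Longrightarrow> z s = w s"
    proof (rule local_uniqueness[OF oW ck, of z w d])
      show "z 0 \<in> ?U \<times> UNIV" using xU EI[OF tE] by (simp add: z_def)
      show "w 0 = z 0" using tE EI[OF tE] \<gamma> vt by (simp add: z_def w_def E_def)
      show "(z has_vector_derivative c1.geo (z s)) (at s)" if "\<bar>s\<bar> < d" for s
        unfolding z_def c1.geo_def fst_conv snd_conv
        by (intro has_vector_derivative_Pair has_vector_derivative_time_shift x y din[OF that])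
      show "(w has_vector_derivative c1.geo (w s)) (at s)" if "\<bar>s\<bar> < d" for s
        unfolding w_def c1.geo_def fst_conv snd_conv
        by (intro has_vector_derivative_Pair has_vector_derivative_time_shift v(1)[unfolded o_def] v(2) din[OF that])
    qed (use d in auto)
    show "\<exists>e>0. \<forall>x'\<in>{0..1}. dist x' t < e \<longrightarrow> x' \<in> S"
    proof (intro exI[of _ "min \<delta> d"] conjI ballI impI)
      show "0 < min \<delta> d" using \<delta> d by simp
      fix s assume s: "s \<in> {0..1}" "dist s t < min \<delta> d"
      then have 1: "\<bar>s - t\<bar> < \<delta>" "\<bar>s - t\<bar> < d" by (auto simp: dist_real_def)
      have "z (s - t) = w (s - t)" by (rule \<delta>(2)[OF 1(1)])
      then have "x s = cmap c (\<beta> s)" "v s = y s" by (auto simp: z_def w_def)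
      moreover have "s \<in> I" "\<beta> s \<in> cdom c" using din[OF 1(2)] by auto
      ultimately have "\<beta> s = \<gamma> s" using \<gamma> inj by (metis inj_onD)
      then show "s \<in> S" using s \<open>v s = y s\<close> by (simp add: S_def E_def)
    qed
  qed
  have E0: "0 \<in> E" using \<beta>(3) by (simp add: E_def \<gamma>_def)
  have "v 0 = y 0" using vector_derivative_unique_at[OF v(1)[OF EI(2,3)[OF E0]] \<beta>0] .
  then have "0 \<in> S" using E0 by (simp add: S_def)
  have "connected {0..1::real}" by simp
  then have "S = {} \<or> S = {0..1}" using clS opS unfolding connected_clopen by blast
  then have "1 \<in> S" using \<open>0 \<in> S\<close> by auto
  then show ?thesis by (simp add: S_def E_def \<gamma>_def)
qed

lemma exp_map_eq:
  fixes M :: "('a, 'n::finite) manifold"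
  assumes M: "riemannian_manifold M" and c: "c \<in> atlas M" and I: "open I" "is_interval I" "{0..1} \<subseteq> I"
    and xU: "\<And>t. t \<in> I \<Longrightarrow> x t \<in> cmap c ` cdom c"
    and x: "\<And>t. t \<in> I \<Longrightarrow> (x has_vector_derivative y t) (at t)"
    and y: "\<And>t. t \<in> I \<Longrightarrow> (y has_vector_derivative - christoffel (gmat M c) (x t) (y t) (y t)) (at t)"
    and Q: "Q \<in> cdom c" "x 0 = cmap c Q"
  shows "exp_map M c Q (y 0) = cinv c (x 1)"
  unfolding exp_map_def
proof (rule the_equality)
  have sm: "smooth_manifold M" using M by (simp add: riemannian_manifold_def)
  have Q0: "cinv c (x 0) = Q" unfolding Q(2) by (rule inv_into_f_f[OF chart_facts(3)[OF sm c] Q(1)])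
  have 0: "0 \<in> I" using I(3) by auto
  have "((cmap c \<circ> (\<lambda>t. cinv c (x t))) has_vector_derivative y 0) (at 0)"
    by (rule has_vector_derivative_transform_within_open[OF x[OF 0] I(1) 0]) (use xU in \<open>simp add: f_inv_into_f\<close>)
  then show "\<exists>I' \<gamma>. geodesic_on M I' \<gamma> \<and> {0..1} \<subseteq> I' \<and> \<gamma> 0 = Q \<and>
       ((cmap c \<circ> \<gamma>) has_vector_derivative y 0) (at 0) \<and> cinv c (x 1) = \<gamma> 1"
    using chart_solution_geodesic_on[OF M c I(1,2) xU x y] I(3) Q0 by blast
  fix q assume "\<exists>I \<gamma>. geodesic_on M I \<gamma> \<and> {0..1} \<subseteq> I \<and> \<gamma> 0 = Q \<and>
       ((cmap c \<circ> \<gamma>) has_vector_derivative y 0) (at 0) \<and> q = \<gamma> 1"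
  then obtain J \<beta> where "geodesic_on M J \<beta>" "{0..1} \<subseteq> J" "\<beta> 0 = Q"
    "((cmap c \<circ> \<beta>) has_vector_derivative y 0) (at 0)" "q = \<beta> 1" by blast
  then show "q = cinv c (x 1)" using geodesic_unique[OF M c I xU x y, of J \<beta>] Q0 by simp
qed

text \<open>The geodesic with initial velocity \<open>s *\<^sub>R y 0\<close> is t \<mapsto> x (s
  t), so the point x s is reached at time 1.\<close>

lemma exp_map_chart_solution:
  fixes M :: "('a, 'n::finite) manifold"
  assumes M: "riemannian_manifold M" and c: "c \<in> atlas M"
    and xU: "\<And>t. \<bar>t\<bar> < d \<Longrightarrow> x t \<in> cmap c ` cdom c"
    and x: "\<And>t. \<bar>t\<bar> < d \<Longrightarrow> (x has_vector_derivative y t) (at t)"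
    and y: "\<And>t. \<bar>t\<bar> < d \<Longrightarrow> (y has_vector_derivative - christoffel (gmat M c) (x t) (y t) (y t)) (at t)"
    and Q: "Q \<in> cdom c" "x 0 = cmap c Q" and s: "\<bar>s\<bar> < d"
  shows "exp_map M c Q (s *\<^sub>R y 0) = cinv c (x s)" "cmap c (exp_map M c Q (s *\<^sub>R y 0)) = x s"
proof -
  interpret c1: chart_metric "cmap c ` cdom c" "gmat M c" by (rule riemannian_chart_metric[OF M c])
  \<comment> \<open>For s = 0 this is the whole line, which avoids a case distinction.\<close>
  define I where "I = {t. \<bar>s * t\<bar> < d}"
  have I: "open I" unfolding I_def by (intro open_Collect_less continuous_intros)
  have "convex I"
  proof -
    have "I = (\<lambda>t. s * t) -` {-d<..<d}" by (auto simp: I_def)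
    moreover have "convex ((\<lambda>t. s * t) -` {-d<..<d})"
      by (intro convex_linear_vimage) (auto intro: bounded_linear.linear bounded_linear_mult_right)
    ultimately show ?thesis by simp
  qed
  then have I2: "is_interval I" by (simp add: is_interval_convex_1)
  have I3: "{0..1} \<subseteq> I"
  proof
    fix t :: real assume "t \<in> {0..1}"
    then have "\<bar>s * t\<bar> \<le> \<bar>s\<bar> * 1" unfolding abs_mult by (intro mult_left_mono) auto
    then show "t \<in> I" using s by (simp add: I_def)
  qed
  have "exp_map M c Q (s *\<^sub>R y (s * 0)) = cinv c (x (s * 1))"
  proof (rule exp_map_eq[OF M c I I2 I3, where x="\<lambda>t. x (s * t)" and y="\<lambda>t. s *\<^sub>R y (s * t)"])
    fix t assume "t \<in> I"
    then have t: "\<bar>s * t\<bar> < d" by (simp add: I_def)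
    show "x (s * t) \<in> cmap c ` cdom c" by (rule xU[OF t])
    show "((\<lambda>t. x (s * t)) has_vector_derivative s *\<^sub>R y (s * t)) (at t)" by (rule has_vector_derivative_time_scale[OF x[OF t]])
    show "((\<lambda>t. s *\<^sub>R y (s * t)) has_vector_derivative
      - christoffel (gmat M c) (x (s * t)) (s *\<^sub>R y (s * t)) (s *\<^sub>R y (s * t))) (at t)"
      using bounded_linear.has_vector_derivative[OF bounded_linear_scaleR_right has_vector_derivative_time_scale[OF y[OF t]], of s]
      by (simp add: c1.christoffel_simps[OF xU[OF t]])
  qed (use Q in auto)
  then show "exp_map M c Q (s *\<^sub>R y 0) = cinv c (x s)" by simp
  then show "cmap c (exp_map M c Q (s *\<^sub>R y 0)) = x s" using xU[OF s] by (simp add: f_inv_into_f)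
qed

section \<open>Jacobi fields in a parallel frame\<close>

text \<open>Bootstrapping: if z has k derivatives, then so has \<open>f (z t)\<close>, which is the
  derivative of z.\<close>

lemma smooth_solution:
  fixes f :: "'e::euclidean_space \<Rightarrow> 'e"
  assumes S: "open S" and f: "smooth_on S f" and zS: "z ` I \<subseteq> S"
    and z: "\<And>t. t \<in> I \<Longrightarrow> (z has_vector_derivative f (z t)) (at t)"
  shows "smooth_curve I z"
  unfolding smooth_curve_def
proof
  fix k show "kdiff k I z"
  proof (induction k)
    case (Suc k)
    then show ?case using kdiff_compose[OF S zS f Suc] z by (auto intro!: exI[of _ "\<lambda>t. f (z t)"])
  qed simp
qed

lemma smooth_linear_solution:
  assumes p: "bounded_bilinear p" and N: "smooth_curve I N"
    and Z: "\<And>t. t \<in> I \<Longrightarrow> (Z has_vector_derivative p (N t) (Z t)) (at t)"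
  shows "smooth_curve I Z"
  unfolding smooth_curve_def
proof
  fix k show "kdiff k I Z"
  proof (induction k)
    case (Suc k)
    have "kdiff k I N" using N by (simp add: smooth_curve_def)
    then show ?case using kdiff_bilinear[OF p _ Suc] Z by (auto intro!: exI[of _ "\<lambda>t. p (N t) (Z t)"])
  qed simp
qed

text \<open>The bilinear map p covers multiplication by the coefficient from the left as well as
  from the right, as needed for a frame and for its inverse.\<close>

lemma linear_ode_existence:
  fixes p :: "'a::real_normed_vector \<Rightarrow> 'e::euclidean_space \<Rightarrow> 'e"
  assumes p: "bounded_bilinear p" and N: "continuous_on {-d<..<d} N" and d: "d > 0"
  shows "\<exists>d'>0. d' \<le> d \<and> (\<exists>Z. Z 0 = z0 \<and> (\<forall>t. \<bar>t\<bar> < d' \<longrightarrow> (Z has_vector_derivative p (N t) (Z t)) (at t)))"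
proof -
  have Nc: "continuous_on {-(d/2)..d/2} N" by (rule continuous_on_subset[OF N]) (use d in auto)
  obtain B where B: "\<And>t. t \<in> {-(d/2)..d/2} \<Longrightarrow> norm (N t) \<le> B" "B \<ge> 0"
    using compact_imp_bounded[OF compact_continuous_image[OF Nc compact_Icc]] d
    unfolding bounded_iff by (metis (no_types, lifting) abs_ge_self imageI norm_ge_zero order_trans linear)
  obtain K where K: "\<And>a b. norm (p a b) \<le> norm a * norm b * K" "K > 0"
    using bounded_bilinear.pos_bounded[OF p] by blast
  define L where "L = B * K"
  have L: "L \<ge> 0" using B K by (simp add: L_def)
  define d' where "d' = min (d/2) (1 / (8 * (L + 1)))"
  have d': "d' > 0" "d' \<le> d/2" using d L by (auto simp: d'_def)
  have "d' * (L + 1) \<le> 1 / (8 * (L + 1)) * (L + 1)" using L by (intro mult_right_mono) (auto simp: d'_def)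
  also have "\<dots> = 1/8" using L by (simp add: field_simps)
  finally have d'L: "4 * d' * L < 1" using d'(1) by (simp add: algebra_simps)
  have "\<exists>Z. Z 0 = z0 \<and> (\<forall>t\<in>{-d'<..<d'}. (Z has_vector_derivative p (N t) (Z t)) (at t))"
  proof (rule picard_existence[OF d'(1) L d'L])
    have "continuous_on ({-d'..d'} \<times> UNIV) (\<lambda>x. N (fst x))"
      by (rule continuous_on_compose2[OF Nc]) (use d' in \<open>auto intro!: continuous_intros\<close>)
    then show "continuous_on ({-d'..d'} \<times> UNIV) (\<lambda>(t, z). p (N t) z)"
      unfolding split_def by (intro bounded_bilinear.continuous_on[OF p] continuous_intros)
    show "norm (p (N t) z - p (N t) w) \<le> L * norm (z - w)" if "t \<in> {-d'..d'}" for t z w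
    proof -
      have "p (N t) z - p (N t) w = p (N t) (z - w)" by (simp add: bounded_bilinear.diff_right[OF p])
      also have "norm \<dots> \<le> norm (N t) * norm (z - w) * K" by (rule K)
      also have "\<dots> \<le> B * norm (z - w) * K"
        using B(1)[of t] that d' K by (intro mult_right_mono) auto
      finally show ?thesis by (simp add: L_def ac_simps)
    qed
  qed
  then show ?thesis using d' d by (intro exI[of _ d']) (auto simp: abs_less_iff minus_less_iff)
qed

lemma has_vector_derivative_columns:
  fixes f :: "'n::finite \<Rightarrow> real \<Rightarrow> real^'m"
  assumes "\<And>j. (f j has_vector_derivative f' j) F"
  shows "((\<lambda>t. (\<chi> i j. f j t $ i) :: real^'n^'m) has_vector_derivative (\<chi> i j. f' j $ i)) F"
proof -
  let ?L = "\<lambda>j (v::real^'m). (\<chi> i k. if k = j then v $ i else 0) :: real^'n^'m"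
  have bl: "bounded_linear (?L j)" for j
    unfolding linear_conv_bounded_linear[symmetric] by (auto simp: linear_iff vec_eq_iff)
  have eq: "(\<Sum>j\<in>UNIV. ?L j (h j)) = (\<chi> i j. h j $ i)" for h
    by (simp add: vec_eq_iff sum.delta)
  have "((\<lambda>t. \<Sum>j\<in>UNIV. ?L j (f j t)) has_vector_derivative (\<Sum>j\<in>UNIV. ?L j (f' j))) F"
    by (intro has_vector_derivative_sum bounded_linear.has_vector_derivative[OF bl] assms)
  then show ?thesis unfolding eq .
qed

lemma matrix_mult_linear: "linear f \<Longrightarrow> matrix f *v v = f v" for f :: "real^'n \<Rightarrow> real^'m"
  by (simp add: matrix_works linear_matrix_vector_mul_eq)

lemma kdiff_shift: "kdiff k I h \<Longrightarrow> (\<And>s. s \<in> J \<Longrightarrow> t + s \<in> I) \<Longrightarrow> kdiff k J (\<lambda>s. h (t + s))"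
proof (induction k arbitrary: h)
  case (Suc k)
  then obtain h' where h': "\<forall>t\<in>I. (h has_vector_derivative h' t) (at t)" "kdiff k I h'" by auto
  have "\<forall>s\<in>J. ((\<lambda>s. h (t + s)) has_vector_derivative h' (t + s)) (at s)"
    using h'(1) Suc.prems(2) by (auto intro: has_vector_derivative_time_shift)
  moreover have "kdiff k J (\<lambda>s. h' (t + s))" using Suc.IH[OF h'(2)] Suc.prems(2) by blast
  ultimately show ?case by (auto intro!: exI[of _ "\<lambda>s. h' (t + s)"])
qed simp

lemma smooth_curve_shift: "smooth_curve I h \<Longrightarrow> (\<And>s. s \<in> J \<Longrightarrow> t + s \<in> I) \<Longrightarrow> smooth_curve J (\<lambda>s. h (t + s))"
  unfolding smooth_curve_def by (intro allI, rule kdiff_shift) auto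

lemma smooth_second_order_linear:
  assumes R: "smooth_curve J R" and A: "\<And>s. s \<in> J \<Longrightarrow> (A has_vector_derivative C s) (at s)"
    and C: "\<And>s. s \<in> J \<Longrightarrow> (C has_vector_derivative - (R s ** A s :: real^'n^'n)) (at s)"
  shows "smooth_curve J A"
proof -
  have "kdiff k J A \<and> kdiff k J C" for k
  proof (induction k)
    case (Suc k)
    have "kdiff k J (\<lambda>s. - (R s ** A s))"
      using R Suc by (intro kdiff_bounded_linear[OF bounded_linear_minus[OF bounded_linear_ident]]
        kdiff_bilinear[OF bounded_bilinear_matrix_mult]) (auto simp: smooth_curve_def)
    then have "kdiff (Suc k) J C" using C by (auto intro!: exI[of _ "\<lambda>s. - (R s ** A s)"])
    moreover have "kdiff (Suc k) J A" using Suc A by (auto intro!: exI[of _ C])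
    ultimately show ?case by blast
  qed simp
  then show ?thesis by (simp add: smooth_curve_def)
qed

context chart_metric
begin

lemma smooth_curve_christoffel:
  assumes xU: "x ` I \<subseteq> U" and I: "open I" and x: "smooth_curve I x" and v: "smooth_curve I v" and w: "smooth_curve I w"
  shows "smooth_curve I (\<lambda>t. \<Gamma> (x t) (v t) (w t))"
proof -
  have "smooth_curve I (\<lambda>t. \<Sum>i\<in>UNIV. \<Sum>j\<in>UNIV. (v t $ i) *\<^sub>R (w t $ j) *\<^sub>R \<Gamma> (x t) (axis i 1) (axis j 1))"
    by (intro smooth_curve_sum smooth_curve_bilinear[OF bounded_bilinear_scaleR] smooth_curve_vec_nth v w
        smooth_curve_compose[OF openU xU smooth_christoffel x])
  then show ?thesis
    by (rule smooth_curve_cong[OF _ I]) (rule christoffel_expansion[symmetric], use xU in auto)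
qed

lemma smooth_curve_Rc:
  assumes xU: "x ` I \<subseteq> U" and I: "open I" and x: "smooth_curve I x" and y: "smooth_curve I y"
  shows "smooth_curve I (\<lambda>t. Rc (x t) v (y t) (y t))"
proof -
  have "smooth_curve I (\<lambda>t. \<Sum>i\<in>UNIV. (y t $ i) *\<^sub>R (\<Sum>j\<in>UNIV. (y t $ j) *\<^sub>R Rc (x t) v (axis i 1) (axis j 1)))"
    by (intro smooth_curve_sum smooth_curve_bilinear[OF bounded_bilinear_scaleR] smooth_curve_vec_nth y
        smooth_curve_compose[OF openU xU smooth_Rc x])
  then show ?thesis
  proof (rule smooth_curve_cong[OF _ I])
    fix t assume "t \<in> I"
    then have t: "x t \<in> U" using xU by auto
    show "(\<Sum>i\<in>UNIV. (y t $ i) *\<^sub>R (\<Sum>j\<in>UNIV. (y t $ j) *\<^sub>R Rc (x t) v (axis i 1) (axis j 1))) = Rc (x t) v (y t) (y t)"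
      by (simp only: linear_axis_expansion[OF Rc_linear(3)[OF t], symmetric]
          linear_axis_expansion[OF Rc_linear(2)[OF t], symmetric])
  qed
qed

end

text \<open>The columns of \<open>E t\<close> are the parallel transports of the coordinate vectors
  at x 0, and \<open>F t\<close> is the inverse frame, introduced through its own linear equation so
  that its derivative is at hand. The frame need not be orthonormal: the traces and the ratio of
  determinants in question do not depend on the basis.\<close>

locale framed_geodesic = chart_metric U G for U :: "(real^'n::finite) set" and G +
  fixes d :: real and x y :: "real \<Rightarrow> real^'n" and E F :: "real \<Rightarrow> real^'n^'n"
  assumes d: "d > 0" and xU: "\<bar>t\<bar> < d \<Longrightarrow> x t \<in> U"
    and x': "\<bar>t\<bar> < d \<Longrightarrow> (x has_vector_derivative y t) (at t)"
    and y': "\<bar>t\<bar> < d \<Longrightarrow> (y has_vector_derivative - \<Gamma> (x t) (y t) (y t)) (at t)"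
    and E': "\<bar>t\<bar> < d \<Longrightarrow> (E has_vector_derivative - (matrix (\<Gamma> (x t) (y t)) ** E t)) (at t)"
    and F': "\<bar>t\<bar> < d \<Longrightarrow> (F has_vector_derivative F t ** matrix (\<Gamma> (x t) (y t))) (at t)"
    and E0: "E 0 = mat 1" and FE: "\<bar>t\<bar> < d \<Longrightarrow> F t ** E t = mat 1"
begin

abbreviation "I \<equiv> {-d<..<d}"

lemma xI: "x ` I \<subseteq> U" using xU by auto

lemma EF: "\<bar>t\<bar> < d \<Longrightarrow> E t ** F t = mat 1"
  using FE matrix_left_right_inverse by blast

lemma smooth_xy: "smooth_curve I x" "smooth_curve I y"
proof -
  have "smooth_curve I (\<lambda>t. (x t, y t))"
  proof (rule smooth_solution[OF _ smooth_geo])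
    show "open (U \<times> (UNIV :: (real^'n) set))" by (simp add: open_Times openU)
    show "(\<lambda>t. (x t, y t)) ` I \<subseteq> U \<times> UNIV" using xU by auto
    show "((\<lambda>t. (x t, y t)) has_vector_derivative geo (x t, y t)) (at t)" if "t \<in> I" for t
      unfolding geo_def fst_conv snd_conv using that by (intro has_vector_derivative_Pair x' y') auto
  qed
  from smooth_curve_bounded_linear[OF bounded_linear_fst this] smooth_curve_bounded_linear[OF bounded_linear_snd this]
  show "smooth_curve I x" "smooth_curve I y" by simp_all
qed

lemma smooth_connection: "smooth_curve I (\<lambda>t. matrix (\<Gamma> (x t) (y t)))"
proof (intro smooth_curve_vec)
  fix i j
  have "smooth_curve I (\<lambda>t. \<Gamma> (x t) (y t) (axis j 1) $ i)"
    by (intro smooth_curve_vec_nth smooth_curve_christoffel[OF xI] smooth_xy smooth_curve_const) auto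
  then show "smooth_curve I (\<lambda>t. matrix (\<Gamma> (x t) (y t)) $ i $ j)" by (simp add: matrix_def)
qed

lemma smooth_EF: "smooth_curve I E" "smooth_curve I F"
proof -
  have b1: "bounded_bilinear (\<lambda>A B. - (A ** B) :: real^'n^'n)"
    unfolding bilinear_conv_bounded_bilinear[symmetric]
    by (auto simp: bilinear_def linear_iff matrix_mult_linear_simps)
  have b2: "bounded_bilinear (\<lambda>A B. B ** A :: real^'n^'n)"
    by (rule bounded_bilinear.flip[OF bounded_bilinear_matrix_mult])
  show "smooth_curve I E"
    by (rule smooth_linear_solution[OF b1 smooth_connection E']) auto
  show "smooth_curve I F"
    by (rule smooth_linear_solution[OF b2 smooth_connection F']) auto
qed

text \<open>The Jacobi operator of the velocity \<open>y t\<close>, read in the parallel frame;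
  ordinary derivatives of this matrix curve therefore represent covariant derivatives.\<close>

definition R :: "real \<Rightarrow> real^'n^'n" where
  "R t = F t ** matrix (\<lambda>v. Rc (x t) v (y t) (y t)) ** E t"

lemma smooth_R: "smooth_curve I R"
proof -
  have "smooth_curve I (\<lambda>t. matrix (\<lambda>v. Rc (x t) v (y t) (y t)))"
  proof (intro smooth_curve_vec)
    fix i j
    have "smooth_curve I (\<lambda>t. Rc (x t) (axis j 1) (y t) (y t) $ i)"
      by (intro smooth_curve_vec_nth smooth_curve_Rc[OF xI] smooth_xy) auto
    then show "smooth_curve I (\<lambda>t. matrix (\<lambda>v. Rc (x t) v (y t) (y t)) $ i $ j)" by (simp add: matrix_def)
  qed
  then show ?thesis unfolding R_def
    by (intro smooth_curve_bilinear[OF bounded_bilinear_matrix_mult] smooth_EF)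
qed

lemma parallel_E:
  assumes t: "\<bar>t\<bar> < d"
  shows "((\<lambda>s. E s *v v) has_vector_derivative - \<Gamma> (x t) (y t) (E t *v v)) (at t)"
proof -
  have "((\<lambda>s. E s *v v) has_vector_derivative - (matrix (\<Gamma> (x t) (y t)) ** E t) *v v) (at t)"
    by (rule bounded_linear.has_vector_derivative[OF
          bounded_bilinear.bounded_linear_left[OF bounded_bilinear_matrix_vector_mult] E'[OF t]])
  then show ?thesis
    by (simp add: bounded_bilinear.minus_left[OF bounded_bilinear_matrix_vector_mult]
        matrix_vector_mul_assoc[symmetric] matrix_mult_linear[OF christoffel_linear_right[OF xU[OF t]]])
qed

text \<open>Parallel transport is isometric: by metric compatibility the derivative along the curve
  vanishes.\<close>

lemma g_frame:
  assumes t: "\<bar>t\<bar> < d"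
  shows "g (x t) (E t *v v) (E t *v w) = g (x 0) v w"
proof -
  have *: "((\<lambda>s. g (x s) (E s *v v) (E s *v w)) has_vector_derivative 0) (at s)" if s: "\<bar>s\<bar> < d" for s
    using g_along[OF xU[OF s] x'[OF s] parallel_E[OF s] parallel_E[OF s], of v w]
      metric_compatible[OF xU[OF s], of "y s" "E s *v v" "E s *v w"]
    by (simp add: ginner_simps)
  have **: "((\<lambda>s. g (x s) (E s *v v) (E s *v w)) has_vector_derivative 0) (at s within I)" if "s \<in> I" for s
    by (rule has_vector_derivative_at_within[OF *]) (use that in auto)
  obtain c where "\<And>s. s \<in> I \<Longrightarrow> g (x s) (E s *v v) (E s *v w) = c"
    using has_vector_derivative_zero_constant[OF convex_real_interval(8) **] by blast
  from this[of t] this[of 0] show ?thesis using t d by (auto simp: E0 abs_less_iff minus_less_iff)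
qed

text \<open>The Gram matrix of the metric in the parallel frame is constant. Taking determinants
  expresses the metric factor of the volume density through \<open>det (F t)\<close>, ready to be
  multiplied with the differential of the exponential map.\<close>

lemma det_G_frame:
  assumes t: "\<bar>t\<bar> < d"
  shows "det (G (x t)) = det (G (x 0)) * (det (F t))\<^sup>2"
proof -
  have "transpose (E t) ** G (x t) ** E t = G (x 0)"
  proof (rule matrix_eq[THEN iffD2], rule allI)
    fix w
    have "v \<bullet> ((transpose (E t) ** G (x t) ** E t) *v w) = v \<bullet> (G (x 0) *v w)" for v
      using g_frame[OF t, of v w] dot_lmul_matrix[of v "transpose (E t)" "G (x t) *v (E t *v w)"]
      by (simp add: ginner_def matrix_vector_mul_assoc[symmetric])
    then show "(transpose (E t) ** G (x t) ** E t) *v w = G (x 0) *v w"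
      using vector_eq_ldot by blast
  qed
  then have "det (E t) * det (G (x t)) * det (E t) = det (G (x 0))"
    by (metis det_mul det_transpose)
  moreover have "det (F t) * det (E t) = 1" using FE[OF t] by (metis det_mul det_I)
  moreover have "det (E t) * det (G (x t)) * det (E t) * (det (F t))\<^sup>2 = (det (F t) * det (E t))\<^sup>2 * det (G (x t))"
    by (simp add: power2_eq_square)
  ultimately show ?thesis by simp
qed

text \<open>Here a is a solution of the linearised geodesic equation and b its coordinate
  derivative, so b + \<Gamma>(y, a) is the covariant derivative of a. Multiplication by F turns
  covariant into ordinary differentiation, and the equation becomes u'' = - R u for u = F a. The
  shift by t0 lets the fields start at any point of the geodesic.\<close>

lemma jacobi_field_frame:
  assumes s: "\<bar>t0 + s\<bar> < d"
    and a: "(a has_vector_derivative b s) (at s)"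
    and b: "(b has_vector_derivative - (d\<Gamma> (x (t0 + s)) (a s) (y (t0 + s)) (y (t0 + s))
        + 2 *\<^sub>R \<Gamma> (x (t0 + s)) (y (t0 + s)) (b s))) (at s)"
  shows "((\<lambda>s. F (t0 + s) *v a s) has_vector_derivative
      F (t0 + s) *v (b s + \<Gamma> (x (t0 + s)) (y (t0 + s)) (a s))) (at s)"
    and "((\<lambda>s. F (t0 + s) *v (b s + \<Gamma> (x (t0 + s)) (y (t0 + s)) (a s))) has_vector_derivative
      - (R (t0 + s) *v (F (t0 + s) *v a s))) (at s)"
proof -
  let ?x = "x (t0 + s)" and ?y = "y (t0 + s)" and ?F = "F (t0 + s)"
  note xt = xU[OF s]
  have mN: "matrix (\<Gamma> ?x ?y) *v v = \<Gamma> ?x ?y v" for v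
    by (rule matrix_mult_linear[OF christoffel_linear_right[OF xt]])
  have dF: "((\<lambda>s. F (t0 + s)) has_vector_derivative ?F ** matrix (\<Gamma> ?x ?y)) (at s)"
    by (rule has_vector_derivative_time_shift[OF F'[OF s]])
  note mv = bounded_bilinear.has_vector_derivative[OF bounded_bilinear_matrix_vector_mult]
  show "((\<lambda>s. F (t0 + s) *v a s) has_vector_derivative ?F *v (b s + \<Gamma> ?x ?y (a s))) (at s)"
    using mv[OF dF a] by (simp add: matrix_vector_mul_assoc[symmetric] mN matrix_vector_right_distrib)
  define J where "J = {s. \<bar>t0 + s\<bar> < d}"
  have J: "open J" "s \<in> J" using s by (auto simp: J_def intro!: open_Collect_less continuous_intros)
  have dx: "((\<lambda>s. x (t0 + s)) has_vector_derivative ?y) (at s)"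
    and dy: "((\<lambda>s. y (t0 + s)) has_vector_derivative - \<Gamma> ?x ?y ?y) (at s)"
    by (intro has_vector_derivative_time_shift x' y' s)+
  have dN: "((\<lambda>s. \<Gamma> (x (t0 + s)) (y (t0 + s)) (a s)) has_vector_derivative
      d\<Gamma> ?x ?y ?y (a s) + \<Gamma> ?x (- \<Gamma> ?x ?y ?y) (a s) + \<Gamma> ?x ?y (b s)) (at s)"
    by (rule christoffel_along[OF J _ dx dy a]) (simp add: J_def xU)
  have "((\<lambda>s. F (t0 + s) *v (b s + \<Gamma> (x (t0 + s)) (y (t0 + s)) (a s))) has_vector_derivative
     ?F *v (- (d\<Gamma> ?x (a s) ?y ?y + 2 *\<^sub>R \<Gamma> ?x ?y (b s))
        + (d\<Gamma> ?x ?y ?y (a s) + \<Gamma> ?x (- \<Gamma> ?x ?y ?y) (a s) + \<Gamma> ?x ?y (b s)))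
     + (?F ** matrix (\<Gamma> ?x ?y)) *v (b s + \<Gamma> ?x ?y (a s))) (at s)"
    by (intro mv dF has_vector_derivative_add b dN)
  also have "?F *v (- (d\<Gamma> ?x (a s) ?y ?y + 2 *\<^sub>R \<Gamma> ?x ?y (b s))
        + (d\<Gamma> ?x ?y ?y (a s) + \<Gamma> ?x (- \<Gamma> ?x ?y ?y) (a s) + \<Gamma> ?x ?y (b s)))
     + (?F ** matrix (\<Gamma> ?x ?y)) *v (b s + \<Gamma> ?x ?y (a s))
     = ?F *v (- Rc ?x (a s) ?y ?y)"
  proof -
    \<comment> \<open>Symmetry of \<Gamma> and of \<open>d\<Gamma>\<close> in the last two arguments
      leaves exactly the terms of \<open>Rc\<close>, with a in the first slot.\<close>
    have "- (d\<Gamma> ?x (a s) ?y ?y + 2 *\<^sub>R \<Gamma> ?x ?y (b s))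
        + (d\<Gamma> ?x ?y ?y (a s) + \<Gamma> ?x (- \<Gamma> ?x ?y ?y) (a s) + \<Gamma> ?x ?y (b s)) + \<Gamma> ?x ?y (b s + \<Gamma> ?x ?y (a s)) = - Rc ?x (a s) ?y ?y"
      using christoffel_sym[OF xt, of "\<Gamma> ?x ?y ?y" "a s"] christoffel_sym[OF xt, of "a s" ?y]
        dchristoffel_sym[OF xt, of ?y "a s" ?y]
      by (simp add: christoffel_simps[OF xt] Rc_def scaleR_2)
    then show ?thesis
      by (simp only: matrix_vector_mul_assoc[symmetric] mN matrix_vector_right_distrib[symmetric])
  qed
  also have "?F *v (- Rc ?x (a s) ?y ?y) = - (R (t0 + s) *v (?F *v a s))"
  proof -
    have "R (t0 + s) *v (?F *v a s) = ?F *v (matrix (\<lambda>v. Rc ?x v ?y ?y) *v ((E (t0 + s) ** ?F) *v a s))"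
      by (simp add: R_def matrix_vector_mul_assoc matrix_mul_assoc)
    also have "\<dots> = ?F *v Rc ?x (a s) ?y ?y"
      by (simp add: EF[OF s] matrix_mult_linear[OF Rc_linear(1)[OF xt]])
    finally show ?thesis by (simp add: bounded_bilinear.minus_right[OF bounded_bilinear_matrix_vector_mult])
  qed
  finally show "((\<lambda>s. F (t0 + s) *v (b s + \<Gamma> (x (t0 + s)) (y (t0 + s)) (a s))) has_vector_derivative
      - (R (t0 + s) *v (F (t0 + s) *v a s))) (at s)" .
qed

end

lemma framed_geodesic_exists:
  assumes "chart_metric U G" and x0: "x0 \<in> U"
  obtains d x y E F where "framed_geodesic U G d x y E F" "x 0 = x0" "y 0 = \<xi>"
proof -
  interpret chart_metric U G by fact
  have oW: "open (U \<times> (UNIV :: (real^'a) set))" by (simp add: open_Times openU)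
  have ck: "Ck_on (Suc 0) (U \<times> UNIV) geo" using smooth_geo by (simp only: smooth_on_def)
  have p: "(x0, \<xi>) \<in> U \<times> UNIV" using x0 by simp
  obtain d e \<Phi> where d: "d > 0" "e > (0::real)"
    and \<Phi>: "\<And>q. norm (q - (x0, \<xi>)) < e \<Longrightarrow> \<Phi> q 0 = q"
      "\<And>q t. norm (q - (x0, \<xi>)) < e \<Longrightarrow> \<bar>t\<bar> < d \<Longrightarrow> \<Phi> q t \<in> U \<times> UNIV"
      "\<And>q t. norm (q - (x0, \<xi>)) < e \<Longrightarrow> \<bar>t\<bar> < d \<Longrightarrow> (\<Phi> q has_vector_derivative geo (\<Phi> q t)) (at t)"
    by (rule local_flow[OF oW p ck], rule that)
  define z where "z = \<Phi> (x0, \<xi>)"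
  define x where "x = (\<lambda>t. fst (z t))"
  define y where "y = (\<lambda>t. snd (z t))"
  have z0: "z 0 = (x0, \<xi>)" using \<Phi>(1)[of "(x0, \<xi>)"] d by (simp add: z_def)
  have xU: "x t \<in> U" if "\<bar>t\<bar> < d" for t
    using \<Phi>(2)[of "(x0, \<xi>)" t] d that by (auto simp: z_def x_def)
  have z': "(z has_vector_derivative geo (z t)) (at t)" if "\<bar>t\<bar> < d" for t
    using \<Phi>(3)[of "(x0, \<xi>)" t] d that by (simp add: z_def)
  have x': "(x has_vector_derivative y t) (at t)" if "\<bar>t\<bar> < d" for t
    using bounded_linear.has_vector_derivative[OF bounded_linear_fst z'[OF that]] by (simp add: x_def y_def geo_def)
  have y': "(y has_vector_derivative - \<Gamma> (x t) (y t) (y t)) (at t)" if "\<bar>t\<bar> < d" for t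
    using bounded_linear.has_vector_derivative[OF bounded_linear_snd z'[OF that]] by (simp add: x_def y_def geo_def)
  let ?N = "\<lambda>t. matrix (\<Gamma> (x t) (y t))"
  have sm: "smooth_curve {-d<..<d} z"
  proof (rule smooth_solution[OF oW smooth_geo])
    show "z ` {-d<..<d} \<subseteq> U \<times> UNIV"
    proof
      fix q assume "q \<in> z ` {-d<..<d}"
      then obtain t where "q = z t" "\<bar>t\<bar> < d" by auto
      then show "q \<in> U \<times> UNIV" using xU[of t] by (simp add: x_def mem_Times_iff)
    qed
    show "(z has_vector_derivative geo (z t)) (at t)" if "t \<in> {-d<..<d}" for t
      by (rule z') (use that in auto)
  qed
  have sx: "smooth_curve {-d<..<d} x" "smooth_curve {-d<..<d} y"
    unfolding x_def y_def
    by (intro smooth_curve_bounded_linear[OF bounded_linear_fst] smooth_curve_bounded_linear[OF bounded_linear_snd] sm)+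
  have N: "continuous_on {-d<..<d} ?N"
  proof (intro smooth_curve_continuous_on smooth_curve_vec)
    fix i j
    have "smooth_curve {-d<..<d} (\<lambda>t. \<Gamma> (x t) (y t) (axis j 1) $ i)"
      by (intro smooth_curve_vec_nth smooth_curve_christoffel sx smooth_curve_const) (use xU in auto)
    then show "smooth_curve {-d<..<d} (\<lambda>t. ?N t $ i $ j)" by (simp add: matrix_def)
  qed simp
  have b1: "bounded_bilinear (\<lambda>A B. - (A ** B) :: real^'a^'a)"
    unfolding bilinear_conv_bounded_bilinear[symmetric]
    by (auto simp: bilinear_def linear_iff matrix_mult_linear_simps)
  have b2: "bounded_bilinear (\<lambda>A B. B ** A :: real^'a^'a)"
    by (rule bounded_bilinear.flip[OF bounded_bilinear_matrix_mult])
  obtain d1 E where d1: "d1 > 0" "d1 \<le> d" and E: "E 0 = mat 1"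
     "\<And>t. \<bar>t\<bar> < d1 \<Longrightarrow> (E has_vector_derivative - (?N t ** E t)) (at t)"
    using linear_ode_existence[OF b1 N d(1), of "mat 1"] by blast
  obtain d2 F where d2: "d2 > 0" "d2 \<le> d" and F: "F 0 = mat 1"
     "\<And>t. \<bar>t\<bar> < d2 \<Longrightarrow> (F has_vector_derivative F t ** ?N t) (at t)"
    using linear_ode_existence[OF b2 N d(1), of "mat 1"] by blast
  define d3 where "d3 = min d1 d2"
  have d3: "d3 > 0" "d3 \<le> d" "d3 \<le> d1" "d3 \<le> d2" using d1 d2 by (auto simp: d3_def)
  \<comment> \<open>The two linear equations are adjoint to each other, so the product is
    constant.\<close>
  have FE0: "((\<lambda>t. F t ** E t) has_vector_derivative 0) (at t within {-d3<..<d3})" if t: "t \<in> {-d3<..<d3}" for t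
  proof -
    have "((\<lambda>t. F t ** E t) has_vector_derivative F t ** (- (?N t ** E t)) + (F t ** ?N t) ** E t) (at t)"
      by (rule bounded_bilinear.has_vector_derivative[OF bounded_bilinear_matrix_mult F(2) E(2)]) (use t d3 in auto)
    then have "((\<lambda>t. F t ** E t) has_vector_derivative 0) (at t)"
      by (simp add: matrix_mult_linear_simps matrix_mul_assoc)
    then show "((\<lambda>t. F t ** E t) has_vector_derivative 0) (at t within {-d3<..<d3})"
      by (rule has_vector_derivative_at_within)
  qed
  obtain cc where cc: "\<And>t. t \<in> {-d3<..<d3} \<Longrightarrow> F t ** E t = cc"
    using has_vector_derivative_zero_constant[OF convex_real_interval(8) FE0] by blast
  have FE: "F t ** E t = mat 1" if "\<bar>t\<bar> < d3" for t
    using cc[of t] cc[of 0] that d3 E(1) F(1) by (auto simp: abs_less_iff minus_less_iff)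
  have "framed_geodesic U G d3 x y E F"
    by unfold_locales (use d3 xU x' y' E F FE in auto)
  then show thesis by (rule that) (simp_all add: x_def y_def z0)
qed

text \<open>Varying the initial velocity by (\<tau>/s) u and running the flow for time s changes the
  argument of the exponential map by \<tau> u. Its differential at s times the velocity is thus a
  Jacobi field divided by s. Read in the parallel frame at both ends it becomes \<open>B s\<close>,
  and the two metric factors of the density turn into determinants of the frame. The starting time
  t0 is free, so that the result can be used all along the geodesic.\<close>

lemma volume_density_frame:
  fixes M :: "('a, 'n::finite) manifold"
  assumes M: "riemannian_manifold M" and c: "c \<in> atlas M"
    and fg: "framed_geodesic (cmap c ` cdom c) (gmat M c) d x y E F" and t0: "\<bar>t0\<bar> < d"
  obtains \<delta> B where "\<delta> > 0" "\<And>s. \<bar>s\<bar> < \<delta> \<Longrightarrow> \<bar>t0 + s\<bar> < d"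
    "smooth_curve {-\<delta><..<\<delta>} B" "B 0 = mat 1"
    "\<And>s. \<bar>s\<bar> < \<delta> \<Longrightarrow> volume_density M c (cinv c (x t0)) (s *\<^sub>R y t0) = \<bar>det (B s)\<bar>"
    "\<And>s. \<bar>s\<bar> < \<delta> \<Longrightarrow> s *\<^sub>R vderiv (vderiv B) s + 2 *\<^sub>R vderiv B s
       = - (s *\<^sub>R (framed_geodesic.R (gmat M c) x y E F (t0 + s) ** B s))"
proof -
  let ?U = "cmap c ` cdom c"
  interpret framed_geodesic ?U "gmat M c" d x y E F by (rule fg)
  define Q where "Q = cinv c (x t0)"
  have Q: "Q \<in> cdom c" "cmap c Q = x t0"
    using xU[OF t0] by (auto simp: Q_def inv_into_into f_inv_into_f)
  have oW: "open (?U \<times> (UNIV :: (real^'n) set))" by (simp add: open_Times openU)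
  have ck: "Ck_on (Suc 0) (?U \<times> UNIV) geo" using smooth_geo by (simp only: smooth_on_def)
  define p where "p = (x t0, y t0)"
  have p: "p \<in> ?U \<times> UNIV" using xU[OF t0] by (simp add: p_def)
  obtain d1 e \<Phi> where d1: "d1 > 0" "e > 0"
    and \<Phi>: "\<And>q. norm (q - p) < e \<Longrightarrow> \<Phi> q 0 = q"
      "\<And>q t. norm (q - p) < e \<Longrightarrow> \<bar>t\<bar> < d1 \<Longrightarrow> \<Phi> q t \<in> ?U \<times> UNIV"
      "\<And>q t. norm (q - p) < e \<Longrightarrow> \<bar>t\<bar> < d1 \<Longrightarrow> (\<Phi> q has_vector_derivative geo (\<Phi> q t)) (at t)"
    and Zex: "\<And>u. \<exists>Z. Z 0 = u \<and> (\<forall>t. \<bar>t\<bar> < d1 \<longrightarrow> (Z has_vector_derivative dir_deriv geo (\<Phi> p t) (Z t)) (at t) \<and>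
        ((\<lambda>\<sigma>. \<Phi> (p + \<sigma> *\<^sub>R u) t) has_vector_derivative Z t) (at 0))"
    by (rule local_flow[OF oW p ck], rule that)
  have exp_sol: "cmap c (exp_map M c Q (s *\<^sub>R snd (z 0))) = fst (z s)"
    if z: "\<And>t. \<bar>t\<bar> < r \<Longrightarrow> z t \<in> ?U \<times> UNIV" "\<And>t. \<bar>t\<bar> < r \<Longrightarrow> (z has_vector_derivative geo (z t)) (at t)"
      "fst (z 0) = x t0" "\<bar>s\<bar> < r" for z r s
  proof (rule exp_map_chart_solution(2)[OF M c, where x="\<lambda>t. fst (z t)" and y="\<lambda>t. snd (z t)", OF _ _ _ Q(1) _ z(4)])
    fix t assume t: "\<bar>t\<bar> < r"
    show "fst (z t) \<in> ?U" using z(1)[OF t] by auto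
    show "((\<lambda>t. fst (z t)) has_vector_derivative snd (z t)) (at t)"
      using bounded_linear.has_vector_derivative[OF bounded_linear_fst z(2)[OF t]] by (simp add: geo_def)
    show "((\<lambda>t. snd (z t)) has_vector_derivative - \<Gamma> (fst (z t)) (snd (z t)) (snd (z t))) (at t)"
      using bounded_linear.has_vector_derivative[OF bounded_linear_snd z(2)[OF t]] by (simp add: geo_def)
  qed (use Q z in auto)
  define \<delta> where "\<delta> = min d1 (d - \<bar>t0\<bar>)"
  have \<delta>: "\<delta> > 0" "\<delta> \<le> d1" using d1 t0 by (auto simp: \<delta>_def)
  have td: "\<bar>t0 + s\<bar> < d" if "\<bar>s\<bar> < \<delta>" for s using that by (auto simp: \<delta>_def)
  have pp: "norm (p - p) < e" using d1 by simp
  have exp_x: "cmap c (exp_map M c Q (s *\<^sub>R y t0)) = x (t0 + s)" if "\<bar>s\<bar> < \<delta>" for s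
  proof -
    have "cmap c (exp_map M c Q (s *\<^sub>R snd (x (t0 + 0), y (t0 + 0)))) = fst (x (t0 + s), y (t0 + s))"
    proof (rule exp_sol[where z="\<lambda>s. (x (t0 + s), y (t0 + s))" and r=\<delta>, OF _ _ _ that])
      fix s assume s: "\<bar>s\<bar> < \<delta>"
      show "(x (t0 + s), y (t0 + s)) \<in> ?U \<times> UNIV" using xU[OF td[OF s]] by simp
      show "((\<lambda>s. (x (t0 + s), y (t0 + s))) has_vector_derivative geo (x (t0 + s), y (t0 + s))) (at s)"
        unfolding geo_def fst_conv snd_conv
        by (intro has_vector_derivative_Pair has_vector_derivative_time_shift x' y' td s)
    qed simp
    then show ?thesis by simp
  qed
  have exp_\<Phi>: "cmap c (exp_map M c Q (s *\<^sub>R \<eta>)) = fst (\<Phi> (x t0, \<eta>) s)"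
    if "norm ((x t0, \<eta>) - p) < e" "\<bar>s\<bar> < d1" for \<eta> s
    using exp_sol[of d1 "\<Phi> (x t0, \<eta>)" s] \<Phi>[OF that(1)] that by auto
  \<comment> \<open>Flow and geodesic have the same initial data, and both compute the same value of
    \<open>exp_map\<close>. Their positions therefore agree, and then, by differentiation, their
    velocities.\<close>
  have fst\<Phi>: "fst (\<Phi> p s) = x (t0 + s)" if "\<bar>s\<bar> < \<delta>" for s
    using exp_\<Phi>[of "y t0" s] exp_x[OF that] that \<delta> d1 by (simp add: p_def)
  have \<Phi>p: "\<Phi> p s = (x (t0 + s), y (t0 + s))" if s: "\<bar>s\<bar> < \<delta>" for s
  proof -
    have "((\<lambda>s. fst (\<Phi> p s)) has_vector_derivative snd (\<Phi> p s)) (at s)"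
      using bounded_linear.has_vector_derivative[OF bounded_linear_fst \<Phi>(3)[OF pp, of s]] s \<delta> by (simp add: geo_def)
    then have "((\<lambda>s. x (t0 + s)) has_vector_derivative snd (\<Phi> p s)) (at s)"
      by (rule has_vector_derivative_transform_within_open[where S="{-\<delta><..<\<delta>}"]) (use s fst\<Phi> in auto)
    moreover have "((\<lambda>s. x (t0 + s)) has_vector_derivative y (t0 + s)) (at s)"
      by (rule has_vector_derivative_time_shift[OF x'[OF td[OF s]]])
    ultimately have "snd (\<Phi> p s) = y (t0 + s)" by (rule vector_derivative_unique_at)
    then show ?thesis using fst\<Phi>[OF s] by (simp add: prod_eq_iff)
  qed
  obtain Z where Z0: "\<And>u. Z u 0 = (0, u)"
    and Z': "\<And>u t. \<bar>t\<bar> < d1 \<Longrightarrow> (Z u has_vector_derivative dir_deriv geo (\<Phi> p t) (Z u t)) (at t)"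
    and Z\<Phi>: "\<And>u t. \<bar>t\<bar> < d1 \<Longrightarrow> ((\<lambda>\<sigma>. \<Phi> (p + \<sigma> *\<^sub>R (0, u)) t) has_vector_derivative Z u t) (at 0)"
    using Zex[of "(0, _)"] by metis
  define a where "a u s = fst (Z u s)" for u s
  define b where "b u s = snd (Z u s)" for u s
  have Zab: "Z u s = (a u s, b u s)" for u s by (simp add: a_def b_def)
  have Z'': "(Z u has_vector_derivative (b u s, - (d\<Gamma> (x (t0 + s)) (a u s) (y (t0 + s)) (y (t0 + s))
        + 2 *\<^sub>R \<Gamma> (x (t0 + s)) (y (t0 + s)) (b u s)))) (at s)" if s: "\<bar>s\<bar> < \<delta>" for u s
    using Z'[of s u] s \<delta> by (simp add: \<Phi>p[OF s] Zab dir_deriv_geo[OF xU[OF td[OF s]]])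
  have a': "(a u has_vector_derivative b u s) (at s)" if s: "\<bar>s\<bar> < \<delta>" for u s
    using bounded_linear.has_vector_derivative[OF bounded_linear_fst Z''[OF s]] by (simp add: a_def[abs_def])
  have b': "(b u has_vector_derivative - (d\<Gamma> (x (t0 + s)) (a u s) (y (t0 + s)) (y (t0 + s))
        + 2 *\<^sub>R \<Gamma> (x (t0 + s)) (y (t0 + s)) (b u s))) (at s)" if s: "\<bar>s\<bar> < \<delta>" for u s
    using bounded_linear.has_vector_derivative[OF bounded_linear_snd Z''[OF s, of u]] by (simp add: b_def[abs_def])
  let ?e = "\<lambda>j. axis j 1 :: real^'n"
  define D where "D s = matrix (dir_deriv (cmap c \<circ> exp_map M c Q) (s *\<^sub>R y t0))" for s
  \<comment> \<open>Division by s says nothing at s = 0; there the differential is read off from the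
    geodesics issuing in every direction u.\<close>
  have D0: "D 0 = mat 1"
  proof -
    have "dir_deriv (cmap c \<circ> exp_map M c Q) 0 u = u" for u
    proof -
      have pu: "(x t0, u) \<in> ?U \<times> UNIV" using xU[OF t0] by simp
      obtain d2 e2 \<Psi> where d2: "d2 > 0" "e2 > (0::real)"
        and \<Psi>: "\<And>q. norm (q - (x t0, u)) < e2 \<Longrightarrow> \<Psi> q 0 = q"
          "\<And>q t. norm (q - (x t0, u)) < e2 \<Longrightarrow> \<bar>t\<bar> < d2 \<Longrightarrow> \<Psi> q t \<in> ?U \<times> UNIV"
          "\<And>q t. norm (q - (x t0, u)) < e2 \<Longrightarrow> \<bar>t\<bar> < d2 \<Longrightarrow> (\<Psi> q has_vector_derivative geo (\<Psi> q t)) (at t)"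
        by (rule local_flow[OF oW pu ck], rule that)
      define z where "z = \<Psi> (x t0, u)"
      have z: "z 0 = (x t0, u)" "\<And>t. \<bar>t\<bar> < d2 \<Longrightarrow> z t \<in> ?U \<times> UNIV"
          "\<And>t. \<bar>t\<bar> < d2 \<Longrightarrow> (z has_vector_derivative geo (z t)) (at t)"
        using \<Psi>[of "(x t0, u)"] d2 by (auto simp: z_def)
      have eq: "fst (z s) = cmap c (exp_map M c Q (0 + s *\<^sub>R u))" if "\<bar>s\<bar> < d2" for s
        using exp_sol[of d2 z s, OF z(2,3) _ that] z(1) by simp
      have "((\<lambda>s. fst (z s)) has_vector_derivative u) (at 0)"
        using bounded_linear.has_vector_derivative[OF bounded_linear_fst z(3)[of 0]] d2 by (simp add: geo_def z(1))
      then have "((\<lambda>s. (cmap c \<circ> exp_map M c Q) (0 + s *\<^sub>R u)) has_vector_derivative u) (at 0)"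
        by (rule has_vector_derivative_transform_within_open[where S="{-d2<..<d2}"]) (use d2 eq in auto)
      then show ?thesis unfolding dir_deriv_def by (rule vector_derivative_at)
    qed
    then show ?thesis by (simp add: D_def matrix_def mat_def vec_eq_iff axis_def)
  qed
  have Ds: "dir_deriv (cmap c \<circ> exp_map M c Q) (s *\<^sub>R y t0) u = (1/s) *\<^sub>R a u s" if s: "\<bar>s\<bar> < \<delta>" "s \<noteq> 0" for s u
  proof -
    have "((\<lambda>\<sigma>. fst (\<Phi> (p + \<sigma> *\<^sub>R (0, u)) s)) has_vector_derivative a u s) (at ((1/s) * 0))"
      using bounded_linear.has_vector_derivative[OF bounded_linear_fst Z\<Phi>[of s u]] s \<delta> by (simp add: a_def)
    from has_vector_derivative_time_scale[OF this]
    have "((\<lambda>\<tau>. fst (\<Phi> (p + ((1/s) * \<tau>) *\<^sub>R (0, u)) s)) has_vector_derivative (1/s) *\<^sub>R a u s) (at 0)" .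
    then have "((\<lambda>\<tau>. (cmap c \<circ> exp_map M c Q) (s *\<^sub>R y t0 + \<tau> *\<^sub>R u)) has_vector_derivative (1/s) *\<^sub>R a u s) (at 0)"
    proof (rule has_vector_derivative_transform_within_open[where S="{\<tau>. norm (((1/s) * \<tau>) *\<^sub>R (0::real^'n, u)) < e}"])
      show "open {\<tau>. norm (((1/s) * \<tau>) *\<^sub>R (0::real^'n, u)) < e}"
        by (intro open_Collect_less continuous_intros)
      show "0 \<in> {\<tau>. norm (((1/s) * \<tau>) *\<^sub>R (0::real^'n, u)) < e}" using d1 by simp
      fix \<tau> assume "\<tau> \<in> {\<tau>. norm (((1/s) * \<tau>) *\<^sub>R (0::real^'n, u)) < e}"
      then have n: "norm ((x t0, y t0 + ((1/s) * \<tau>) *\<^sub>R u) - p) < e" by (simp add: p_def)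
      have "s *\<^sub>R (y t0 + ((1/s) * \<tau>) *\<^sub>R u) = s *\<^sub>R y t0 + \<tau> *\<^sub>R u" using s by (simp add: scaleR_add_right)
      then show "fst (\<Phi> (p + ((1/s) * \<tau>) *\<^sub>R (0, u)) s) = (cmap c \<circ> exp_map M c Q) (s *\<^sub>R y t0 + \<tau> *\<^sub>R u)"
        using exp_\<Phi>[OF n, of s] s \<delta> by (simp add: p_def)
    qed
    then show ?thesis unfolding dir_deriv_def by (rule vector_derivative_at)
  qed
  define A1 :: "real \<Rightarrow> real^'n^'n" where "A1 s = (\<chi> i j. (F (t0 + s) *v a (?e j) s) $ i)" for s
  define C1 :: "real \<Rightarrow> real^'n^'n" where "C1 s = (\<chi> i j. (F (t0 + s) *v (b (?e j) s + \<Gamma> (x (t0 + s)) (y (t0 + s)) (a (?e j) s))) $ i)" for s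
  \<comment> \<open>The Jacobi fields start with the coordinate vectors as derivatives. Right
    multiplication by \<open>E t0\<close> expresses them in the frame at t0 and normalises the
    initial derivative to \<open>F t0 ** E t0 = mat 1\<close>.\<close>
  define A where "A s = A1 s ** E t0" for s
  define C where "C s = C1 s ** E t0" for s
  let ?J = "{-\<delta><..<\<delta>}"
  have Jd: "\<bar>s\<bar> < \<delta>" if "s \<in> ?J" for s using that by auto
  have bE: "bounded_linear (\<lambda>X. X ** E t0)"
    by (rule bounded_bilinear.bounded_linear_left[OF bounded_bilinear_matrix_mult])
  have A1': "(A1 has_vector_derivative C1 s) (at s)" if s: "s \<in> ?J" for s
    unfolding A1_def C1_def
    by (intro has_vector_derivative_columns jacobi_field_frame(1) td[OF Jd[OF s]] a'[OF Jd[OF s]] b'[OF Jd[OF s]])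
  have C1': "(C1 has_vector_derivative - (R (t0 + s) ** A1 s)) (at s)" if s: "s \<in> ?J" for s
  proof -
    have "(C1 has_vector_derivative (\<chi> i j. (- (R (t0 + s) *v (F (t0 + s) *v a (?e j) s))) $ i)) (at s)"
      unfolding C1_def
      by (intro has_vector_derivative_columns jacobi_field_frame(2) td[OF Jd[OF s]] a'[OF Jd[OF s]] b'[OF Jd[OF s]])
    moreover have "(\<chi> i j. (- (R (t0 + s) *v (F (t0 + s) *v a (?e j) s))) $ i) = - (R (t0 + s) ** A1 s)"
      by (simp add: vec_eq_iff A1_def matrix_matrix_mult_def matrix_vector_mult_def)
    ultimately show ?thesis by simp
  qed
  have A': "(A has_vector_derivative C s) (at s)" if s: "s \<in> ?J" for s
    unfolding A_def C_def by (rule bounded_linear.has_vector_derivative[OF bE A1'[OF s]])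
  have C': "(C has_vector_derivative - (R (t0 + s) ** A s)) (at s)" if s: "s \<in> ?J" for s
    using bounded_linear.has_vector_derivative[OF bE C1'[OF s]]
    unfolding A_def C_def by (simp add: matrix_mult_linear_simps matrix_mul_assoc)
  have sR: "smooth_curve ?J (\<lambda>s. R (t0 + s))"
    by (rule smooth_curve_shift[OF smooth_R]) (use td[OF Jd] in force)
  have sA: "smooth_curve ?J A" by (rule smooth_second_order_linear[OF sR A' C'])
  have A0: "A 0 = 0"
  proof -
    have "A1 0 = 0" using Z0 by (simp add: A1_def a_def vec_eq_iff)
    then show ?thesis by (simp add: A_def matrix_mult_linear_simps)
  qed
  have C0: "C 0 = mat 1"
  proof -
    have "F t0 *v ?e j = column j (F t0)" for j by (simp add: matrix_vector_mult_basis)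
    then have "C1 0 = F t0"
      using Z0 by (simp add: C1_def a_def b_def christoffel_simps[OF xU[OF t0]] column_def vec_eq_iff)
    then show ?thesis using FE[OF t0] by (simp add: C_def)
  qed
  obtain B where sB: "smooth_curve ?J B" and AB: "\<And>s. \<bar>s\<bar> < \<delta> \<Longrightarrow> A s = s *\<^sub>R B s"
    by (rule smooth_curve_divide_by_time[OF sA A0 \<delta>(1)], rule that)
  note B' = smooth_curve_imp(2)[OF sB open_greaterThanLessThan]
  note B'' = smooth_curve_imp(2)[OF smooth_curve_imp(1)[OF sB open_greaterThanLessThan] open_greaterThanLessThan]
  have CB: "C s = B s + s *\<^sub>R vderiv B s" if s: "s \<in> ?J" for s
  proof -
    have "((\<lambda>s. s *\<^sub>R B s) has_vector_derivative s *\<^sub>R vderiv B s + 1 *\<^sub>R B s) (at s)"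
      by (intro has_vector_derivative_scaleR DERIV_ident B' s)
    then have "(A has_vector_derivative s *\<^sub>R vderiv B s + 1 *\<^sub>R B s) (at s)"
      by (rule has_vector_derivative_transform_within_open[OF _ open_greaterThanLessThan s]) (use AB in auto)
    from vector_derivative_unique_at[OF A'[OF s] this] show ?thesis by simp
  qed
  have B0: "B 0 = mat 1" using CB[of 0] C0 \<delta> by simp
  \<comment> \<open>Differentiating A = s B twice gives A'' = s B'' + 2 B'.\<close>
  have ode: "s *\<^sub>R vderiv (vderiv B) s + 2 *\<^sub>R vderiv B s = - (s *\<^sub>R (R (t0 + s) ** B s))" if s: "\<bar>s\<bar> < \<delta>" for s
  proof -
    have sJ: "s \<in> ?J" using s by auto
    have "((\<lambda>s. B s + s *\<^sub>R vderiv B s) has_vector_derivative vderiv B s + (s *\<^sub>R vderiv (vderiv B) s + 1 *\<^sub>R vderiv B s)) (at s)"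
      by (intro has_vector_derivative_add has_vector_derivative_scaleR DERIV_ident B' B'' sJ)
    then have "(C has_vector_derivative vderiv B s + (s *\<^sub>R vderiv (vderiv B) s + 1 *\<^sub>R vderiv B s)) (at s)"
      by (rule has_vector_derivative_transform_within_open[OF _ open_greaterThanLessThan sJ]) (simp add: CB)
    from vector_derivative_unique_at[OF C'[OF sJ] this]
    show ?thesis by (simp add: AB[OF s] matrix_mult_linear_simps scaleR_2 add_ac)
  qed
  have FDE: "F (t0 + s) ** D s ** E t0 = B s" if s: "\<bar>s\<bar> < \<delta>" for s
  proof (cases "s = 0")
    case True
    then show ?thesis using FE[OF t0] by (simp add: D0 B0)
  next
    case False
    have "F (t0 + s) ** D s = (1/s) *\<^sub>R A1 s"
      by (simp add: D_def matrix_def A1_def Ds[OF s False] vec_eq_iff matrix_matrix_mult_def matrix_vector_mult_def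
          sum_distrib_left ac_simps)
    then have "F (t0 + s) ** D s ** E t0 = (1/s) *\<^sub>R A s" by (simp add: A_def matrix_mult_linear_simps)
    then show ?thesis using False by (simp add: AB[OF s])
  qed
  have vol: "volume_density M c Q (s *\<^sub>R y t0) = \<bar>det (B s)\<bar>" if s: "\<bar>s\<bar> < \<delta>" for s
  proof -
    let ?\<kappa> = "det (gmat M c (x 0))"
    have k: "sqrt ?\<kappa> \<noteq> 0" using det_G_nonzero[of "x 0"] xU[of 0] d by simp
    have "det (F t0) * det (E t0) = 1" using FE[OF t0] by (metis det_mul det_I)
    then have f0: "det (E t0) = 1 / det (F t0)" by (metis inverse_eq_divide inverse_unique)
    have "volume_density M c Q (s *\<^sub>R y t0)
      = sqrt (det (gmat M c (x (t0 + s)))) * \<bar>det (D s)\<bar> / sqrt (det (gmat M c (x t0)))"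
      by (simp add: volume_density_def vol_density_def exp_x[OF s] Q D_def)
    \<comment> \<open>The determinant of the metric at x 0 cancels between numerator and
      denominator.\<close>
    also have "\<dots> = \<bar>det (F (t0 + s))\<bar> * \<bar>det (D s)\<bar> / \<bar>det (F t0)\<bar>"
      using k by (simp add: det_G_frame[OF td[OF s]] det_G_frame[OF t0] real_sqrt_mult)
    also have "\<dots> = \<bar>det (F (t0 + s) ** D s ** E t0)\<bar>"
      by (simp add: det_mul f0 abs_mult)
    finally show ?thesis by (simp add: FDE[OF s])
  qed
  show thesis
    by (rule that[of \<delta> B]) (use \<delta> td sB B0 vol ode in \<open>auto simp: Q_def\<close>)
qed

section \<open>Taylor coefficients of the volume density\<close>

lemma nderiv_time_mult:
  assumes I: "open I" and f: "smooth_curve I f" and s: "s \<in> I"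
  shows "nderiv (Suc k) (\<lambda>s. s *\<^sub>R f s) s = s *\<^sub>R nderiv (Suc k) f s + real (Suc k) *\<^sub>R nderiv k f s"
  using s
proof (induction k arbitrary: s)
  case 0
  have "((\<lambda>s. s *\<^sub>R f s) has_vector_derivative s *\<^sub>R nderiv (Suc 0) f s + 1 *\<^sub>R f s) (at s)"
    using nderiv_has[OF f I 0, of 0] by (intro has_vector_derivative_scaleR DERIV_ident) simp
  then show ?case by (simp add: nderiv_Suc vector_derivative_at)
next
  case (Suc k)
  have "((\<lambda>s. s *\<^sub>R nderiv (Suc k) f s + real (Suc k) *\<^sub>R nderiv k f s) has_vector_derivative
     (s *\<^sub>R nderiv (Suc (Suc k)) f s + 1 *\<^sub>R nderiv (Suc k) f s) + real (Suc k) *\<^sub>R nderiv (Suc k) f s) (at s)"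
    by (intro has_vector_derivative_add has_vector_derivative_scaleR DERIV_ident
        bounded_linear.has_vector_derivative[OF bounded_linear_scaleR_right] nderiv_has[OF f I Suc.prems])
  then have "(nderiv (Suc k) (\<lambda>s. s *\<^sub>R f s) has_vector_derivative
     (s *\<^sub>R nderiv (Suc (Suc k)) f s + 1 *\<^sub>R nderiv (Suc k) f s) + real (Suc k) *\<^sub>R nderiv (Suc k) f s) (at s)"
    by (rule has_vector_derivative_transform_within_open[OF _ I Suc.prems]) (simp only: Suc.IH)
  then have "nderiv (Suc (Suc k)) (\<lambda>s. s *\<^sub>R f s) s
     = (s *\<^sub>R nderiv (Suc (Suc k)) f s + 1 *\<^sub>R nderiv (Suc k) f s) + real (Suc k) *\<^sub>R nderiv (Suc k) f s"
    by (subst nderiv_Suc) (rule vector_derivative_at)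
  then show ?case by (simp add: algebra_simps scaleR_2)
qed

lemma nderiv_shift: "nderiv k (\<lambda>s. h (t + s)) s = nderiv k h (t + s)"
proof (induction k arbitrary: s)
  case (Suc k)
  have iff: "((\<lambda>s. f (t + s)) has_vector_derivative D) (at s) \<longleftrightarrow> (f has_vector_derivative D) (at (t + s))"
    for f :: "real \<Rightarrow> 'a" and D
    using has_vector_derivative_time_shift[of f D t s]
      has_vector_derivative_time_shift[of "\<lambda>s. f (t + s)" D "-t" "t + s"] by auto
  have "nderiv k (\<lambda>s. h (t + s)) = (\<lambda>s. nderiv k h (t + s))" using Suc by blast
  then show ?case unfolding nderiv_Suc by (simp add: vector_derivative_def iff)
qed simp

lemma nderiv_even_function:
  fixes h :: "real \<Rightarrow> real"
  assumes \<delta>: "\<delta> > 0" and h: "smooth_curve {-\<delta><..<\<delta>} h" and even: "\<And>s. \<bar>s\<bar> < \<delta> \<Longrightarrow> h (- s) = h s"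
  shows "nderiv (2 * k + 1) h 0 = 0"
proof -
  have *: "\<forall>s. \<bar>s\<bar> < \<delta> \<longrightarrow> nderiv k h (- s) = (- 1) ^ k * nderiv k h s" for k
  proof (induction k)
    case (Suc k)
    show ?case
    proof (intro allI impI)
      fix s :: real assume s: "\<bar>s\<bar> < \<delta>"
      then have sI: "- s \<in> {-\<delta><..<\<delta>}" "s \<in> {-\<delta><..<\<delta>}" by auto
      have "(nderiv k h has_vector_derivative nderiv (Suc k) h (- s)) (at (-1 * s))"
        using nderiv_has[OF h open_greaterThanLessThan sI(1), of k] by simp
      from has_vector_derivative_time_scale[OF this]
      have "((\<lambda>s. nderiv k h (- s)) has_vector_derivative - nderiv (Suc k) h (- s)) (at s)" by simp
      then have "((\<lambda>s. (- 1) ^ k * nderiv k h s) has_vector_derivative - nderiv (Suc k) h (- s)) (at s)"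
        by (rule has_vector_derivative_transform_within_open[OF _ open_greaterThanLessThan sI(2)]) (use Suc in auto)
      moreover have "((\<lambda>s. (- 1) ^ k * nderiv k h s) has_vector_derivative (- 1) ^ k * nderiv (Suc k) h s) (at s)"
        by (intro has_vector_derivative_mult_right nderiv_has[OF h open_greaterThanLessThan sI(2)])
      ultimately have "- nderiv (Suc k) h (- s) = (- 1) ^ k * nderiv (Suc k) h s"
        by (rule vector_derivative_unique_at)
      then show "nderiv (Suc k) h (- s) = (- 1) ^ Suc k * nderiv (Suc k) h s" by simp
    qed
  qed (use even in simp)
  have "nderiv (2 * k + 1) h 0 = - nderiv (2 * k + 1) h 0"
    using *[of "2 * k + 1"] \<delta> by (auto dest: spec[of _ 0])
  then show ?thesis by simp
qed

text \<open>With \<open>V = B' B\<inverse>\<close> the equation for \<open>B\<close> becomes the Riccati equation \<open>s V' + 2 V + s (V\<^sup>2 + R) = 0\<close>,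
  which determines the derivatives \<open>v k\<close> of \<open>V\<close> at \<open>0\<close> recursively.\<close>

lemma density_derivatives:
  fixes B Rs :: "real \<Rightarrow> real^'n^'n" and \<phi> :: "real \<Rightarrow> real"
  assumes \<delta>: "\<delta> > 0" and sB: "smooth_curve {-\<delta><..<\<delta>} B" and B0: "B 0 = mat 1"
    and sR: "smooth_curve {-\<delta><..<\<delta>} Rs"
    and \<phi>: "\<And>s. \<bar>s\<bar> < \<delta> \<Longrightarrow> \<phi> s = \<bar>det (B s)\<bar>"
    and ode: "\<And>s. \<bar>s\<bar> < \<delta> \<Longrightarrow> s *\<^sub>R vderiv (vderiv B) s + 2 *\<^sub>R vderiv B s = - (s *\<^sub>R (Rs s ** B s))"
  obtains \<delta>' v where "0 < \<delta>'" "smooth_curve {-\<delta>'<..<\<delta>'} \<phi>" "v 0 = 0" "\<phi> 0 = 1"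
    "\<And>k. real (k + 3) *\<^sub>R v (Suc k) = - (real (Suc k) *\<^sub>R (nderiv k Rs 0 + (\<Sum>i\<le>k. real (k choose i) *\<^sub>R (v i ** v (k - i)))))"
    "\<And>k. nderiv (Suc k) \<phi> 0 = (\<Sum>i\<le>k. real (k choose i) * (nderiv i \<phi> 0 * trace (v (k - i))))"
proof -
  let ?I = "{-\<delta><..<\<delta>}"
  have sdet: "smooth_curve ?I (\<lambda>s. det (B s))"
    by (intro smooth_curve_det smooth_curve_vec_nth sB)
  have "isCont (\<lambda>s. det (B s)) 0"
    using smooth_curve_continuous_on[OF sdet] \<delta> by (simp add: continuous_on_eq_continuous_at)
  then obtain e where e: "e > 0" "\<And>s. dist s 0 < e \<Longrightarrow> dist (det (B s)) (det (B 0)) < 1"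
    unfolding continuous_at_eps_delta by (metis zero_less_one)
  \<comment> \<open>On this interval \<open>det (B s)\<close> differs by less than 1 from its value
    1 at 0, hence is positive: the absolute value disappears and \<open>B s\<close> is
    invertible.\<close>
  define r where "r = min \<delta> e"
  let ?J = "{-r<..<r}"
  have r: "r > 0" "?J \<subseteq> ?I" using \<delta> e by (auto simp: r_def)
  have pos: "det (B s) > 0" if "s \<in> ?J" for s
    using e(2)[of s] that B0 by (simp add: r_def dist_real_def abs_less_iff) linarith
  have J0: "0 \<in> ?J" using r by simp
  have oJ: "open ?J" by simp
  note sBJ = smooth_curve_subset[OF sB r(2)] and sRJ = smooth_curve_subset[OF sR r(2)]
  have \<phi>J: "\<phi> s = det (B s)" if "s \<in> ?J" for s using \<phi>[of s] pos[OF that] that by (auto simp: r_def)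
  have s\<phi>: "smooth_curve ?J \<phi>"
    by (rule smooth_curve_cong[OF smooth_curve_subset[OF sdet r(2)] oJ]) (simp add: \<phi>J)
  let ?Bi = "\<lambda>s. matrix_inv (B s)"
  define V where "V s = vderiv B s ** ?Bi s" for s
  have nz: "det (B s) \<noteq> 0" if "s \<in> ?J" for s using pos[OF that] by simp
  have sBi: "smooth_curve ?J ?Bi" by (rule smooth_curve_matrix_inv[OF oJ sBJ nz])
  have sB': "smooth_curve ?J (vderiv B)" by (rule smooth_curve_imp(1)[OF sBJ oJ])
  have sV: "smooth_curve ?J V"
    unfolding V_def by (intro smooth_curve_bilinear[OF bounded_bilinear_matrix_mult] sB' sBi)
  have sV': "smooth_curve ?J (vderiv V)" by (rule smooth_curve_imp(1)[OF sV oJ])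
  have sVR: "smooth_curve ?J (\<lambda>s. V s ** V s + Rs s)"
    by (intro smooth_curve_add smooth_curve_bilinear[OF bounded_bilinear_matrix_mult] sV sRJ)
  have V': "vderiv V s = vderiv (vderiv B) s ** ?Bi s - V s ** V s" if s: "s \<in> ?J" for s
  proof -
    have "(V has_vector_derivative vderiv B s ** - (?Bi s ** vderiv B s ** ?Bi s) + vderiv (vderiv B) s ** ?Bi s) (at s)"
      unfolding V_def
      by (intro bounded_bilinear.has_vector_derivative[OF bounded_bilinear_matrix_mult]
          smooth_curve_imp(2)[OF sB' oJ s] matrix_inv_derivative[OF oJ s sBJ nz] smooth_curve_imp(2)[OF sBJ oJ s])
    then have "vderiv V s = vderiv B s ** - (?Bi s ** vderiv B s ** ?Bi s) + vderiv (vderiv B) s ** ?Bi s"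
      by (rule vector_derivative_at)
    then show ?thesis by (simp add: V_def matrix_mult_linear_simps matrix_mul_assoc)
  qed
  \<comment> \<open>Kept multiplied by s, because in the divided form V would carry the coefficient
    2/s, singular at 0.\<close>
  have riccati: "s *\<^sub>R (vderiv V s + (V s ** V s + Rs s)) + 2 *\<^sub>R V s = 0" if s: "s \<in> ?J" for s
  proof -
    have "(s *\<^sub>R vderiv (vderiv B) s + 2 *\<^sub>R vderiv B s) ** ?Bi s = - (s *\<^sub>R (Rs s ** B s)) ** ?Bi s"
      using ode[of s] s by (auto simp: r_def)
    then have "s *\<^sub>R (vderiv (vderiv B) s ** ?Bi s) + 2 *\<^sub>R V s = - (s *\<^sub>R Rs s)"
      by (simp add: matrix_mult_linear_simps V_def matrix_mul_assoc[symmetric] matrix_inv_mult nz[OF s])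
    then show ?thesis unfolding V'[OF s] by (simp add: algebra_simps)
  qed
  define v where "v k = nderiv k V 0" for k
  have b2: "bounded_linear (\<lambda>X::real^'n^'n. 2 *\<^sub>R X)" by (rule bounded_linear_scaleR_right)
  have sW: "smooth_curve ?J (\<lambda>s. vderiv V s + (V s ** V s + Rs s))"
    by (intro smooth_curve_add sV' sVR)
  have v0: "v 0 = 0" using riccati[OF J0] by (simp add: v_def)
  \<comment> \<open>The derivative of order k + 1 at 0: the factor s leaves k + 1 times the k-th
    derivative of the bracket, and 2 V contributes 2 more, so \<open>v (Suc k)\<close> gets the
    coefficient k + 3.\<close>
  have rec: "real (k + 3) *\<^sub>R v (Suc k) = - (real (Suc k) *\<^sub>R (nderiv k Rs 0 + (\<Sum>i\<le>k. real (k choose i) *\<^sub>R (v i ** v (k - i)))))" for k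
  proof -
    have "nderiv (Suc k) (\<lambda>s. s *\<^sub>R (vderiv V s + (V s ** V s + Rs s)) + 2 *\<^sub>R V s) 0 = nderiv (Suc k) (\<lambda>s. 0 :: real^'n^'n) 0"
      by (rule nderiv_cong[OF oJ riccati J0])
    also have "nderiv (Suc k) (\<lambda>s. 0 :: real^'n^'n) 0 = 0"
    proof -
      have "nderiv k (\<lambda>s. 0 :: real^'n^'n) = (\<lambda>s. 0)" for k
        by (induction k) (simp_all add: nderiv_Suc)
      then show ?thesis by simp
    qed
    also have "nderiv (Suc k) (\<lambda>s. s *\<^sub>R (vderiv V s + (V s ** V s + Rs s)) + 2 *\<^sub>R V s) 0
      = nderiv (Suc k) (\<lambda>s. s *\<^sub>R (vderiv V s + (V s ** V s + Rs s))) 0 + nderiv (Suc k) (\<lambda>s. 2 *\<^sub>R V s) 0"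
      by (intro nderiv_add[OF oJ _ _ J0] smooth_curve_bilinear[OF bounded_bilinear_scaleR] smooth_curve_id sW
          smooth_curve_bounded_linear[OF b2] sV)
    also have "nderiv (Suc k) (\<lambda>s. s *\<^sub>R (vderiv V s + (V s ** V s + Rs s))) 0
      = real (Suc k) *\<^sub>R nderiv k (\<lambda>s. vderiv V s + (V s ** V s + Rs s)) 0"
      using nderiv_time_mult[OF oJ sW J0] by simp
    also have "nderiv k (\<lambda>s. vderiv V s + (V s ** V s + Rs s)) 0 = v (Suc k) + (nderiv k (\<lambda>s. V s ** V s) 0 + nderiv k Rs 0)"
      by (simp add: nderiv_add[OF oJ sV' sVR J0] v_def nderiv_Suc'
          nderiv_add[OF oJ smooth_curve_bilinear[OF bounded_bilinear_matrix_mult sV sV] sRJ J0])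
    also have "nderiv k (\<lambda>s. V s ** V s) 0 = (\<Sum>i\<le>k. real (k choose i) *\<^sub>R (v i ** v (k - i)))"
      unfolding v_def by (rule leibniz_bilinear[OF bounded_bilinear_matrix_mult oJ sV sV J0])
    also have "nderiv (Suc k) (\<lambda>s. 2 *\<^sub>R V s) 0 = 2 *\<^sub>R v (Suc k)"
      unfolding v_def by (rule nderiv_bounded_linear[OF oJ b2 sV J0])
    finally have eq: "real (Suc k) *\<^sub>R (v (Suc k) + ((\<Sum>i\<le>k. real (k choose i) *\<^sub>R (v i ** v (k - i))) + nderiv k Rs 0))
       + 2 *\<^sub>R v (Suc k) = 0" .
    have "real (k + 3) *\<^sub>R v (Suc k) = real (Suc k) *\<^sub>R v (Suc k) + 2 *\<^sub>R v (Suc k)"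
      by (simp add: scaleR_add_left[symmetric])
    also have "\<dots> = - (real (Suc k) *\<^sub>R (nderiv k Rs 0 + (\<Sum>i\<le>k. real (k choose i) *\<^sub>R (v i ** v (k - i)))))"
      by (rule eq_neg_iff_add_eq_0[THEN iffD2]) (use eq in \<open>simp add: scaleR_add_right add_ac\<close>)
    finally show ?thesis .
  qed
  \<comment> \<open>Jacobi's formula: the logarithmic derivative of the determinant is the trace of
    V.\<close>
  have \<phi>': "vderiv \<phi> s = \<phi> s * trace (V s)" if s: "s \<in> ?J" for s
  proof -
    have "((\<lambda>s. det (B s)) has_vector_derivative det (B s) * trace (V s)) (at s)"
      unfolding V_def by (rule det_derivative[OF smooth_curve_imp(2)[OF sBJ oJ s] nz[OF s]])
    then have "(\<phi> has_vector_derivative det (B s) * trace (V s)) (at s)"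
      by (rule has_vector_derivative_transform_within_open[OF _ oJ s]) (simp add: \<phi>J)
    then show ?thesis using \<phi>J[OF s] by (simp add: vector_derivative_at)
  qed
  have rec\<phi>: "nderiv (Suc k) \<phi> 0 = (\<Sum>i\<le>k. real (k choose i) * (nderiv i \<phi> 0 * trace (v (k - i))))" for k
  proof -
    have str: "smooth_curve ?J (\<lambda>s. trace (V s))" by (rule smooth_curve_bounded_linear[OF bounded_linear_trace sV])
    have "nderiv (Suc k) \<phi> 0 = nderiv k (\<lambda>s. \<phi> s * trace (V s)) 0"
      unfolding nderiv_Suc' by (rule nderiv_cong[OF oJ \<phi>' J0])
    also have "\<dots> = (\<Sum>i\<le>k. real (k choose i) *\<^sub>R (nderiv i \<phi> 0 * nderiv (k - i) (\<lambda>s. trace (V s)) 0))"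
      by (rule leibniz_bilinear[OF bounded_bilinear_mult oJ s\<phi> str J0])
    also have "\<dots> = (\<Sum>i\<le>k. real (k choose i) * (nderiv i \<phi> 0 * trace (v (k - i))))"
      by (simp add: nderiv_bounded_linear[OF oJ bounded_linear_trace sV J0] v_def)
    finally show ?thesis .
  qed
  show thesis
    by (rule that[of r v]) (use r s\<phi> v0 rec rec\<phi> \<phi>J[OF J0] B0 in \<open>auto\<close>)
qed

text \<open>The matrices \<open>v k\<close> are solved for explicitly up to k = 5. For k = 6 and k =
  7 the trace of the quadratic sum suffices, where cyclicity merges the products of
  \<open>v i\<close> and \<open>v j\<close> in either order and thus doubles the binomial
  coefficients.\<close>

lemma riccati_traces:
  fixes v r :: "nat \<Rightarrow> real^'n^'n"
  assumes v0: "v 0 = 0"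
    and rec: "\<And>k. real (k + 3) *\<^sub>R v (Suc k) = - (real (Suc k) *\<^sub>R (r k + (\<Sum>i\<le>k. real (k choose i) *\<^sub>R (v i ** v (k - i)))))"
  defines "t1 \<equiv> \<lambda>i. trace (r i)" and "t2 \<equiv> \<lambda>i j. trace (r i ** r j)"
    and "t3 \<equiv> \<lambda>i j k. trace (r i ** r j ** r k)"
  shows "trace (v 1) = - (1/3) * t1 0"
    "trace (v 2) = - (1/2) * t1 1"
    "trace (v 3) = - (3/5) * t1 2 - (2/15) * t2 0 0"
    "trace (v 4) = - (2/3) * t1 3 - (2/3) * t2 0 1"
    "trace (v 5) = - (5/7) * t1 4 - (8/7) * t2 0 2 - (15/14) * t2 1 1 - (16/63) * t3 0 0 0"
    "trace (v 6) = - (3/4) * t1 5 - (5/3) * t2 0 3 - (9/2) * t2 1 2 - (8/3) * t3 0 0 1"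
    "trace (v 7) = - (7/9) * t1 6 - (20/9) * t2 0 4 - (70/9) * t2 1 3 - (28/5) * t2 2 2
       - (272/45) * t3 0 0 2 - (100/9) * t3 0 1 1 - (16/15) * trace (r 0 ** r 0 ** r 0 ** r 0)"
proof -
  have solve: "v (Suc k) = - ((real (Suc k) / real (k + 3)) *\<^sub>R (r k + (\<Sum>i\<le>k. real (k choose i) *\<^sub>R (v i ** v (k - i)))))" for k
  proof -
    have "v (Suc k) = (1 / real (k + 3)) *\<^sub>R (real (k + 3) *\<^sub>R v (Suc k))" by simp
    also have "\<dots> = - ((real (Suc k) / real (k + 3)) *\<^sub>R (r k + (\<Sum>i\<le>k. real (k choose i) *\<^sub>R (v i ** v (k - i)))))"
      unfolding rec by simp
    finally show ?thesis .
  qed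
  note S = matrix_mult_linear_simps scaleR_add_right scaleR_diff_right scaleR_minus_right scaleR_scaleR matrix_mul_assoc
  have v1: "v 1 = - (1/3) *\<^sub>R r 0" using solve[of 0] by (simp add: v0 S)
  have v2: "v 2 = - (1/2) *\<^sub>R r 1" using solve[of 1] by (simp add: v0 S eval_nat_numeral)
  have v3': "v 3 = - (3/5) *\<^sub>R (r 2 + 2 *\<^sub>R (v 1 ** v 1))"
    using solve[of 2] by (simp add: v0 S eval_nat_numeral)
  have v4': "v 4 = - (2/3) *\<^sub>R (r 3 + 3 *\<^sub>R (v 1 ** v 2) + 3 *\<^sub>R (v 2 ** v 1))"
    using solve[of 3] by (simp add: v0 S eval_nat_numeral)
  have v5': "v 5 = - (5/7) *\<^sub>R (r 4 + 4 *\<^sub>R (v 1 ** v 3) + 6 *\<^sub>R (v 2 ** v 2) + 4 *\<^sub>R (v 3 ** v 1))"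
    using solve[of 4] by (simp add: v0 S eval_nat_numeral)
  have v6': "v 6 = - (3/4) *\<^sub>R (r 5 + 5 *\<^sub>R (v 1 ** v 4) + 10 *\<^sub>R (v 2 ** v 3) + 10 *\<^sub>R (v 3 ** v 2) + 5 *\<^sub>R (v 4 ** v 1))"
    using solve[of 5] by (simp add: v0 S eval_nat_numeral)
  have v7': "v 7 = - (7/9) *\<^sub>R (r 6 + 6 *\<^sub>R (v 1 ** v 5) + 15 *\<^sub>R (v 2 ** v 4) + 20 *\<^sub>R (v 3 ** v 3)
      + 15 *\<^sub>R (v 4 ** v 2) + 6 *\<^sub>R (v 5 ** v 1))"
    using solve[of 6] by (simp add: v0 S eval_nat_numeral)
  have v3: "v 3 = - (3/5) *\<^sub>R r 2 - (2/15) *\<^sub>R (r 0 ** r 0)"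
    unfolding v3' v1 by (simp add: S)
  have v4: "v 4 = - (2/3) *\<^sub>R r 3 - (1/3) *\<^sub>R (r 0 ** r 1) - (1/3) *\<^sub>R (r 1 ** r 0)"
    unfolding v4' v1 v2 by (simp add: S)
  have v5: "v 5 = - (5/7) *\<^sub>R r 4 - (4/7) *\<^sub>R (r 0 ** r 2) - (4/7) *\<^sub>R (r 2 ** r 0)
      - (15/14) *\<^sub>R (r 1 ** r 1) - (16/63) *\<^sub>R (r 0 ** r 0 ** r 0)"
    unfolding v5' v1 v2 v3 by (simp add: S vec_eq_iff)
  have c2: "trace (v i ** v j) = trace (v j ** v i)" for i j by (rule trace_mul_sym)
  have c3: "trace (X ** Y ** Z) = trace (Z ** X ** Y)" for X Y Z :: "real^'n^'n"
    using trace_mul_sym[of "X ** Y" Z] by (simp add: matrix_mul_assoc)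
  \<comment> \<open>Fixed instances of cyclicity, oriented towards words with non-decreasing
    indices; as a general rewrite rule cyclicity would not terminate.\<close>
  note cyc = c3[of "r 0" "r 1" "r 0"] c3[of "r 1" "r 0" "r 0"] c3[of "r 0" "r 2" "r 0"] c3[of "r 2" "r 0" "r 0"]
    c3[of "r 1" "r 0" "r 1"] c3[of "r 1" "r 1" "r 0"] trace_mul_sym[of "r 1" "r 0"] trace_mul_sym[of "r 2" "r 0"]
  note T = trace_linear_simps t1_def t2_def t3_def S
  show "trace (v 1) = - (1/3) * t1 0" unfolding v1 by (simp add: T)
  show "trace (v 2) = - (1/2) * t1 1" unfolding v2 by (simp add: T)
  show "trace (v 3) = - (3/5) * t1 2 - (2/15) * t2 0 0" unfolding v3 by (simp add: T)
  show "trace (v 4) = - (2/3) * t1 3 - (2/3) * t2 0 1" unfolding v4 using cyc by (simp add: T)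
  show "trace (v 5) = - (5/7) * t1 4 - (8/7) * t2 0 2 - (15/14) * t2 1 1 - (16/63) * t3 0 0 0"
    unfolding v5 using cyc by (simp add: T)
  have "trace (v 6) = - (3/4) * (t1 5 + 10 * trace (v 1 ** v 4) + 20 * trace (v 2 ** v 3))"
    unfolding v6' using c2[of 4 1] c2[of 3 2] by (simp add: trace_linear_simps t1_def algebra_simps)
  also have "trace (v 1 ** v 4) = (2/9) * t2 0 3 + (2/9) * t3 0 0 1"
    unfolding v1 v4 using cyc by (simp add: T)
  also have "trace (v 2 ** v 3) = (3/10) * t2 1 2 + (1/15) * t3 0 0 1"
    unfolding v2 v3 using cyc by (simp add: T)
  finally show "trace (v 6) = - (3/4) * t1 5 - (5/3) * t2 0 3 - (9/2) * t2 1 2 - (8/3) * t3 0 0 1"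
    by (simp add: algebra_simps)
  have "trace (v 7) = - (7/9) * (t1 6 + 12 * trace (v 1 ** v 5) + 30 * trace (v 2 ** v 4) + 20 * trace (v 3 ** v 3))"
    unfolding v7' using c2[of 5 1] c2[of 4 2] by (simp add: trace_linear_simps t1_def algebra_simps)
  also have "trace (v 1 ** v 5) = (5/21) * t2 0 4 + (8/21) * t3 0 0 2 + (5/14) * t3 0 1 1
      + (16/189) * trace (r 0 ** r 0 ** r 0 ** r 0)"
    unfolding v1 v5 using cyc by (simp add: T)
  also have "trace (v 2 ** v 4) = (1/3) * t2 1 3 + (1/3) * t3 0 1 1"
    unfolding v2 v4 using cyc by (simp add: T)
  also have "trace (v 3 ** v 3) = (9/25) * t2 2 2 + (4/25) * t3 0 0 2 + (4/225) * trace (r 0 ** r 0 ** r 0 ** r 0)"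
    unfolding v3 using cyc by (simp add: T)
  finally show "trace (v 7) = - (7/9) * t1 6 - (20/9) * t2 0 4 - (70/9) * t2 1 3 - (28/5) * t2 2 2
       - (272/45) * t3 0 0 2 - (100/9) * t3 0 1 1 - (16/15) * trace (r 0 ** r 0 ** r 0 ** r 0)"
    by (simp add: algebra_simps)
qed

text \<open>Since q 1 and \<tau> 0 vanish, few products survive in each sum. The lower q are left
  unexpanded on the right, so that in a harmonic space the odd ones can be set to zero
  directly.\<close>

lemma density_recursion:
  fixes q \<tau> :: "nat \<Rightarrow> real"
  assumes q0: "q 0 = 1" and \<tau>0: "\<tau> 0 = 0"
    and rec: "\<And>k. q (Suc k) = (\<Sum>i\<le>k. real (k choose i) * (q i * \<tau> (k - i)))"
  shows "q 1 = 0" "q 2 = \<tau> 1" "q 3 = \<tau> 2" "q 4 = \<tau> 3 + 3 * q 2 * \<tau> 1" "q 5 = \<tau> 4 + 6 * q 2 * \<tau> 2 + 4 * q 3 * \<tau> 1"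
    "q 6 = \<tau> 5 + 10 * q 2 * \<tau> 3 + 10 * q 3 * \<tau> 2 + 5 * q 4 * \<tau> 1"
    "q 7 = \<tau> 6 + 15 * q 2 * \<tau> 4 + 20 * q 3 * \<tau> 3 + 15 * q 4 * \<tau> 2 + 6 * q 5 * \<tau> 1"
    "q 8 = \<tau> 7 + 21 * q 2 * \<tau> 5 + 35 * q 3 * \<tau> 4 + 35 * q 4 * \<tau> 3 + 21 * q 5 * \<tau> 2 + 7 * q 6 * \<tau> 1"
proof -
  show q1: "q 1 = 0" using rec[of 0] \<tau>0 by simp
  show "q 2 = \<tau> 1" using rec[of 1] q0 \<tau>0 q1 by (simp add: eval_nat_numeral)
  show "q 3 = \<tau> 2" using rec[of 2] q0 \<tau>0 q1 by (simp add: eval_nat_numeral)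
  show "q 4 = \<tau> 3 + 3 * q 2 * \<tau> 1" using rec[of 3] q0 \<tau>0 q1 by (simp add: eval_nat_numeral)
  show "q 5 = \<tau> 4 + 6 * q 2 * \<tau> 2 + 4 * q 3 * \<tau> 1" using rec[of 4] q0 \<tau>0 q1 by (simp add: eval_nat_numeral)
  show "q 6 = \<tau> 5 + 10 * q 2 * \<tau> 3 + 10 * q 3 * \<tau> 2 + 5 * q 4 * \<tau> 1"
    using rec[of 5] q0 \<tau>0 q1 by (simp add: eval_nat_numeral)
  show "q 7 = \<tau> 6 + 15 * q 2 * \<tau> 4 + 20 * q 3 * \<tau> 3 + 15 * q 4 * \<tau> 2 + 6 * q 5 * \<tau> 1"
    using rec[of 6] q0 \<tau>0 q1 by (simp add: eval_nat_numeral)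
  show "q 8 = \<tau> 7 + 21 * q 2 * \<tau> 5 + 35 * q 3 * \<tau> 4 + 35 * q 4 * \<tau> 3 + 21 * q 5 * \<tau> 2 + 7 * q 6 * \<tau> 1"
    using rec[of 7] q0 \<tau>0 q1 by (simp add: eval_nat_numeral)
qed

section \<open>Harmonic spaces\<close>

context framed_geodesic
begin

lemma tensor_field_iterated: "tensor_field (4 + k) ((cov_deriv G ^^ k) (riemann_tensor G))"
proof (induction k)
  case (Suc k)
  from tensor_field_cov_deriv[OF Suc] show ?case by simp
qed (simp add: tensor_field_riemann)

text \<open>All arguments are parallel along the geodesic, its velocity included, so each
  differentiation of R in the frame is a covariant differentiation of the curvature tensor in
  direction \<open>y t\<close>, appended at the end of the list. The metric on the left stays at x 0
  because the frame transports it isometrically.\<close>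

lemma curvature_derivatives:
  assumes "\<bar>t\<bar> < d"
  shows "g (x 0) (nderiv k R t *v v) w
    = (cov_deriv G ^^ k) (riemann_tensor G) (x t) ([E t *v v, y t, y t, E t *v w] @ replicate k (y t))"
  using assms
proof (induction k arbitrary: t)
  case 0
  have "E t *v (R t *v v) = (E t ** F t) *v (matrix (\<lambda>v. Rc (x t) v (y t) (y t)) *v (E t *v v))"
    by (simp add: R_def matrix_vector_mul_assoc matrix_mul_assoc)
  also have "\<dots> = Rc (x t) (E t *v v) (y t) (y t)"
    by (simp add: EF[OF 0] matrix_mult_linear[OF Rc_linear(1)[OF xU[OF 0]]])
  finally show ?case
    using g_frame[OF 0, of "R t *v v" w] by (simp add: riemann_tensor_eq[OF xU[OF 0]])
next
  case (Suc k)
  define T where "T = (cov_deriv G ^^ k) (riemann_tensor G)"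
  define Ws where "Ws = [\<lambda>s. E s *v v, y, y, \<lambda>s. E s *v w] @ replicate k y"
  have tI: "t \<in> I" using Suc.prems by auto
  have Ws: "length Ws = 4 + k" by (simp add: Ws_def)
  have W: "(W has_vector_derivative - \<Gamma> (x t) (y t) (W t)) (at t)" if "W \<in> set Ws" for W
    using that parallel_E[OF Suc.prems] y'[OF Suc.prems] by (auto simp: Ws_def)
  have map: "map (\<lambda>W. W s) Ws = [E s *v v, y s, y s, E s *v w] @ replicate k (y s)" for s
    by (simp add: Ws_def)
  have "((\<lambda>s. T (x s) (map (\<lambda>W. W s) Ws)) has_vector_derivative
     cov_deriv G T (x t) (map (\<lambda>W. W t) Ws @ [y t])) (at t)"
    by (rule tensor_along_parallel[OF tensor_field_iterated[of k, folded T_def] open_greaterThanLessThan tI _ x'[OF Suc.prems] Ws])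
       (use xU W Ws in auto)
  then have 1: "((\<lambda>s. g (x 0) (nderiv k R s *v v) w) has_vector_derivative
     cov_deriv G T (x t) (map (\<lambda>W. W t) Ws @ [y t])) (at t)"
    by (rule has_vector_derivative_transform_within_open[OF _ open_greaterThanLessThan tI])
       (use Suc.IH in \<open>auto simp: map T_def\<close>)
  have "bounded_linear (\<lambda>A. g (x 0) (A *v v) w)"
    unfolding linear_conv_bounded_linear[symmetric]
    using linear_compose[OF bounded_linear.linear[OF bounded_bilinear.bounded_linear_left[OF bounded_bilinear_matrix_vector_mult]] ginner_linear_left]
    by (simp add: o_def)
  from bounded_linear.has_vector_derivative[OF this nderiv_has[OF smooth_R open_greaterThanLessThan tI]]
  have "((\<lambda>s. g (x 0) (nderiv k R s *v v) w) has_vector_derivative g (x 0) (nderiv (Suc k) R t *v v) w) (at t)" .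
  from vector_derivative_unique_at[OF this 1] show ?case
    by (simp add: T_def map replicate_append_same)
qed

end

text \<open>At t = 0 the frame is the identity matrix, so \<open>curvature_derivatives\<close>
  becomes the equation that describes \<open>jacobi_op\<close>; nondegeneracy of the metric makes
  the description unique.\<close>

lemma jacobi_op_eq_nderiv:
  fixes M :: "('a, 'n::finite) manifold"
  assumes fg: "framed_geodesic (cmap c ` cdom c) (gmat M c) d x y E F" and x0: "x 0 = cmap c P" and y0: "y 0 = \<xi>"
  shows "jacobi_op M c P k \<xi> = nderiv k (framed_geodesic.R (gmat M c) x y E F) 0"
proof -
  interpret framed_geodesic "cmap c ` cdom c" "gmat M c" d x y E F by (rule fg)
  have d0: "\<bar>0\<bar> < d" using d by simp
  show ?thesis unfolding jacobi_op_def
  proof (rule the_equality)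
    show "\<forall>v w. ginner (gmat M c) (cmap c P) (nderiv k R 0 *v v) w =
       (cov_deriv (gmat M c) ^^ k) (riemann_tensor (gmat M c)) (cmap c P) ([v, \<xi>, \<xi>, w] @ replicate k \<xi>)"
      using curvature_derivatives[OF d0, of k] by (simp add: x0 y0 E0)
    then have *: "ginner (gmat M c) (cmap c P) (nderiv k R 0 *v v) w =
       (cov_deriv (gmat M c) ^^ k) (riemann_tensor (gmat M c)) (cmap c P) ([v, \<xi>, \<xi>, w] @ replicate k \<xi>)" for v w by blast
    fix A :: "real^'n^'n"
    assume A: "\<forall>v w. ginner (gmat M c) (cmap c P) (A *v v) w =
       (cov_deriv (gmat M c) ^^ k) (riemann_tensor (gmat M c)) (cmap c P) ([v, \<xi>, \<xi>, w] @ replicate k \<xi>)"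
    have "A *v v = nderiv k R 0 *v v" for v
      by (rule g_nondegenerate[OF xU[OF d0]]) (simp add: x0 A *)
    then show "A = nderiv k R 0" by (simp add: matrix_eq)
  qed
qed

text \<open>Opposite vectors have equal length, so harmonicity makes the density even in s. As it is
  assumed at every point of the manifold, the base point may be any point of the geodesic, while
  \<open>r\<close> always refers to the one frame along it.\<close>

lemma harmonic_density:
  fixes M :: "('a, 'n::finite) manifold"
  assumes H: "harmonic_space M" and c: "c \<in> atlas M"
    and fg: "framed_geodesic (cmap c ` cdom c) (gmat M c) d x y E F" and t0: "\<bar>t0\<bar> < d"
  defines "\<phi> \<equiv> \<lambda>s. volume_density M c (cinv c (x t0)) (s *\<^sub>R y t0)"
    and "r \<equiv> \<lambda>k. nderiv k (framed_geodesic.R (gmat M c) x y E F) t0"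
  obtains v where "v 0 = 0" "\<phi> 0 = 1"
    "\<And>k. real (k + 3) *\<^sub>R v (Suc k) = - (real (Suc k) *\<^sub>R (r k + (\<Sum>i\<le>k. real (k choose i) *\<^sub>R (v i ** v (k - i)))))"
    "\<And>k. nderiv (Suc k) \<phi> 0 = (\<Sum>i\<le>k. real (k choose i) * (nderiv i \<phi> 0 * trace (v (k - i))))"
    "\<And>k. nderiv (2 * k + 1) \<phi> 0 = 0"
proof -
  interpret framed_geodesic "cmap c ` cdom c" "gmat M c" d x y E F by (rule fg)
  have M: "riemannian_manifold M" using H by (simp add: harmonic_space_def)
  then have sm: "smooth_manifold M" by (simp add: riemannian_manifold_def)
  define Q where "Q = cinv c (x t0)"
  have Q: "Q \<in> cdom c" using xU[OF t0] by (auto simp: Q_def inv_into_into)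
  obtain \<delta> B where \<delta>: "\<delta> > 0" and td: "\<And>s. \<bar>s\<bar> < \<delta> \<Longrightarrow> \<bar>t0 + s\<bar> < d"
    and B: "smooth_curve {-\<delta><..<\<delta>} B" "B 0 = mat 1"
    and vol: "\<And>s. \<bar>s\<bar> < \<delta> \<Longrightarrow> \<phi> s = \<bar>det (B s)\<bar>"
    and ode: "\<And>s. \<bar>s\<bar> < \<delta> \<Longrightarrow> s *\<^sub>R vderiv (vderiv B) s + 2 *\<^sub>R vderiv B s = - (s *\<^sub>R (R (t0 + s) ** B s))"
    unfolding \<phi>_def by (rule volume_density_frame[OF M c fg t0], rule that[unfolded \<phi>_def])
  have sR: "smooth_curve {-\<delta><..<\<delta>} (\<lambda>s. R (t0 + s))"
  proof (rule smooth_curve_shift[OF smooth_R])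
    fix s assume "s \<in> {-\<delta><..<\<delta>}"
    then have "\<bar>t0 + s\<bar> < d" by (intro td) auto
    then show "t0 + s \<in> I" by auto
  qed
  obtain \<delta>' v where \<delta>': "0 < \<delta>'" "smooth_curve {-\<delta>'<..<\<delta>'} \<phi>" and v: "v 0 = 0" "\<phi> 0 = 1"
    "\<And>k. real (k + 3) *\<^sub>R v (Suc k) = - (real (Suc k) *\<^sub>R (nderiv k (\<lambda>s. R (t0 + s)) 0 + (\<Sum>i\<le>k. real (k choose i) *\<^sub>R (v i ** v (k - i)))))"
    "\<And>k. nderiv (Suc k) \<phi> 0 = (\<Sum>i\<le>k. real (k choose i) * (nderiv i \<phi> 0 * trace (v (k - i))))"
    by (rule density_derivatives[OF \<delta> B sR vol ode], assumption, assumption, rule that)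
  have "Q \<in> topspace (mtop M)" using Q chart_facts(1)[OF sm c] openin_subset by blast
  moreover have "c \<in> charts_at M Q" using c Q by (simp add: charts_at_def)
  ultimately obtain \<epsilon> f where \<epsilon>: "\<epsilon> > 0" and f: "\<And>\<xi>. gnorm M c Q \<xi> < \<epsilon> \<Longrightarrow> volume_density M c Q \<xi> = f (gnorm M c Q \<xi>)"
    using H unfolding harmonic_space_def by blast
  \<comment> \<open>The summand 1 makes division by n safe when the velocity is zero.\<close>
  define n where "n = gnorm M c Q (y t0) + 1"
  have "ginner (gmat M c) (cmap c Q) (y t0) (y t0) \<ge> 0"
    using posG[of "cmap c Q" "y t0"] Q by (cases "y t0 = 0") (auto simp: ginner_simps intro: less_imp_le)
  then have n: "n \<ge> 1" "gnorm M c Q (y t0) \<le> n" by (simp_all add: n_def gnorm_def)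
  have gs: "gnorm M c Q (s *\<^sub>R y t0) = \<bar>s\<bar> * gnorm M c Q (y t0)" for s
    by (simp add: gnorm_def ginner_simps real_sqrt_mult mult.assoc[symmetric])
  define e where "e = min \<delta>' (\<epsilon> / n)"
  have e: "e > 0" "e \<le> \<delta>'" using \<delta>' \<epsilon> n by (auto simp: e_def)
  have even: "\<phi> (- s) = \<phi> s" if s: "\<bar>s\<bar> < e" for s
  proof -
    have "\<bar>s\<bar> * gnorm M c Q (y t0) \<le> \<bar>s\<bar> * n" using n by (intro mult_left_mono) auto
    also have "\<dots> < \<epsilon>" using s n by (simp add: e_def field_simps)
    finally have "\<bar>s\<bar> * gnorm M c Q (y t0) < \<epsilon>" .
    then show ?thesis
      using f[of "s *\<^sub>R y t0"] f[of "(- s) *\<^sub>R y t0"] unfolding gs \<phi>_def Q_def[symmetric] by simp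
  qed
  have odd: "nderiv (2 * k + 1) \<phi> 0 = 0" for k
    by (rule nderiv_even_function[OF e(1) smooth_curve_subset[OF \<delta>'(2)] even]) (use e in auto)
  have "nderiv k (\<lambda>s. R (t0 + s)) 0 = r k" for k unfolding r_def nderiv_shift by simp
  with v odd show thesis by (intro that[of v]) auto
qed

text \<open>Everything is now reduced to numbers: traces of words in the derivatives of R at time t.
  Since t ranges over an interval, the three vanishing conditions on \<tau> may afterwards be
  differentiated.\<close>

lemma harmonic_density_values:
  fixes M :: "('a, 'n::finite) manifold"
  assumes H: "harmonic_space M" and c: "c \<in> atlas M"
    and fg: "framed_geodesic (cmap c ` cdom c) (gmat M c) d x y E F" and t: "\<bar>t\<bar> < d"
  defines "q \<equiv> \<lambda>k. nderiv k (\<lambda>s. volume_density M c (cinv c (x t)) (s *\<^sub>R y t)) 0"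
    and "r \<equiv> \<lambda>k. nderiv k (framed_geodesic.R (gmat M c) x y E F) t"
  obtains \<tau> :: "nat \<Rightarrow> real" where "\<And>k. q (2 * k + 1) = 0"
    "q 2 = \<tau> 1" "q 4 = \<tau> 3 + 3 * q 2 * \<tau> 1" "q 6 = \<tau> 5 + 10 * q 2 * \<tau> 3 + 5 * q 4 * \<tau> 1"
    "q 8 = \<tau> 7 + 21 * q 2 * \<tau> 5 + 35 * q 4 * \<tau> 3 + 7 * q 6 * \<tau> 1"
    "\<tau> 2 = 0" "\<tau> 4 = 0" "\<tau> 6 = 0"
    "\<tau> 1 = - (1/3) * trace (r 0)"
    "\<tau> 2 = - (1/2) * trace (r 1)"
    "\<tau> 3 = - (3/5) * trace (r 2) - (2/15) * trace (r 0 ** r 0)"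
    "\<tau> 4 = - (2/3) * trace (r 3) - (2/3) * trace (r 0 ** r 1)"
    "\<tau> 5 = - (5/7) * trace (r 4) - (8/7) * trace (r 0 ** r 2) - (15/14) * trace (r 1 ** r 1) - (16/63) * trace (r 0 ** r 0 ** r 0)"
    "\<tau> 6 = - (3/4) * trace (r 5) - (5/3) * trace (r 0 ** r 3) - (9/2) * trace (r 1 ** r 2) - (8/3) * trace (r 0 ** r 0 ** r 1)"
    "\<tau> 7 = - (7/9) * trace (r 6) - (20/9) * trace (r 0 ** r 4) - (70/9) * trace (r 1 ** r 3) - (28/5) * trace (r 2 ** r 2)
       - (272/45) * trace (r 0 ** r 0 ** r 2) - (100/9) * trace (r 0 ** r 1 ** r 1) - (16/15) * trace (r 0 ** r 0 ** r 0 ** r 0)"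
proof -
  obtain v where v0: "v 0 = 0" and q0: "q 0 = 1"
    and rec: "\<And>k. real (k + 3) *\<^sub>R v (Suc k) = - (real (Suc k) *\<^sub>R (r k + (\<Sum>i\<le>k. real (k choose i) *\<^sub>R (v i ** v (k - i)))))"
    and recq: "\<And>k. q (Suc k) = (\<Sum>i\<le>k. real (k choose i) * (q i * trace (v (k - i))))"
    and odd: "\<And>k. q (2 * k + 1) = 0"
    unfolding q_def r_def nderiv_0 by (rule harmonic_density[OF H c fg t], rule that[unfolded q_def r_def nderiv_0])
  have t0: "trace (v 0) = 0" by (simp add: v0 trace_linear_simps)
  note D = density_recursion[of q "\<lambda>k. trace (v k)", OF q0 t0 recq]
  note T = riccati_traces[OF v0 rec]
  have q3: "q 3 = 0" and q5: "q 5 = 0" and q7: "q 7 = 0"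
    using odd[of 1] odd[of 2] odd[of 3] by simp_all
  \<comment> \<open>In q 3, q 5 and q 7 each product contains an odd q or an even \<tau> already
    known to vanish, so the zeros pass to \<tau> 2, \<tau> 4 and \<tau> 6 in turn.\<close>
  have \<tau>2: "trace (v 2) = 0" using D(3) q3 by simp
  have \<tau>4: "trace (v 4) = 0" using D(5) q5 q3 \<tau>2 by simp
  have \<tau>6: "trace (v 6) = 0" using D(7) q7 q5 q3 \<tau>2 \<tau>4 by simp
  show thesis
    by (rule that[of "\<lambda>k. trace (v k)", OF odd D(2,4) _ _ \<tau>2 \<tau>4 \<tau>6 T])
       (use D(6,8) q3 q5 in simp_all)
qed

theorem theorem1p4:
  fixes M :: "('a, 'n::finite) manifold" and P :: 'a and c :: "('a, 'n) chart"
    and \<xi> :: "real ^ 'n"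
    and H :: "nat \<Rightarrow> real" and J J1 J2 :: "real ^ 'n ^ 'n"
  assumes "harmonic_space M"
    and "P \<in> topspace (mtop M)"
    and "c \<in> charts_at M P"
  defines "H \<equiv> \<lambda>k. taylor_H M c P k \<xi>"
    and "J \<equiv> jacobi_op M c P 0 \<xi>"
    and "J1 \<equiv> jacobi_op M c P 1 \<xi>"
    and "J2 \<equiv> jacobi_op M c P 2 \<xi>"
  shows "(\<forall>k\<ge>1. H (2 * k + 1) = 0) \<and>
    H 2 = - (1/6) * trace J \<and>
    H 4 = (1/72) * (trace J)\<^sup>2 - (1/180) * trace (J ** J) \<and>
    H 6 = - ((trace J) ^ 3 / 1296) + trace J * trace (J ** J) / 1080
          - trace (J ** J ** J) / 2835 + trace (J1 ** J1) / 10080 \<and>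
    H 8 = (trace J) ^ 4 / 31104 - (trace J)\<^sup>2 * trace (J ** J) / 12960
          + trace J * trace (J ** J ** J) / 17010 - trace J * trace (J1 ** J1) / 60480
          + (trace (J ** J))\<^sup>2 / 64800 - trace (J ** J ** J ** J) / 37800
          - trace (J ** J ** J2) / 340200 + trace (J ** J1 ** J1) / 54432
          - trace (J2 ** J2) / 907200"
proof -
  note harm = \<open>harmonic_space M\<close>
  have M: "riemannian_manifold M" using harm by (simp add: harmonic_space_def)
  then have sm: "smooth_manifold M" by (simp add: riemannian_manifold_def)
  have c: "c \<in> atlas M" "P \<in> cdom c" using assms(3) by (auto simp: charts_at_def)
  obtain d x y E F where fg: "framed_geodesic (cmap c ` cdom c) (gmat M c) d x y E F"
    and x0: "x 0 = cmap c P" and y0: "y 0 = \<xi>"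
    by (rule framed_geodesic_exists[OF riemannian_chart_metric[OF M c(1)], of "cmap c P" \<xi>, OF imageI[OF c(2)]], rule that)
  interpret framed_geodesic "cmap c ` cdom c" "gmat M c" d x y E F by (rule fg)
  define r where "r k = nderiv k R" for k
  have r_eq: "J = r 0 0" "J1 = r 1 0" "J2 = r 2 0"
    unfolding J_def J1_def J2_def r_def by (rule jacobi_op_eq_nderiv[OF fg x0 y0])+
  have d0: "\<bar>0\<bar> < d" and I0: "0 \<in> I" using d by auto
  have P0: "cinv c (x 0) = P" unfolding x0 by (rule inv_into_f_f[OF chart_facts(3)[OF sm c(1)] c(2)])
  define q where "q k = nderiv k (\<lambda>s. volume_density M c P (s *\<^sub>R \<xi>)) 0" for k
  have Hq: "H k = q k / fact k" for k
    unfolding H_def taylor_H_def taylor_term_eq_nderiv q_def ..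
  note vals = harmonic_density_values[OF harm c(1) fg, folded r_def]
  have r': "(r k has_vector_derivative r (Suc k) t) (at t)" if "t \<in> I" for k t
    unfolding r_def by (rule nderiv_has[OF smooth_R open_greaterThanLessThan that])
  note tr = bounded_linear.has_vector_derivative[OF bounded_linear_trace]
  note mm = bounded_bilinear.has_vector_derivative[OF bounded_bilinear_matrix_mult]
  \<comment> \<open>The means of elimination: an expression that vanishes along the whole geodesic
    has zero derivative.\<close>
  have zero: "D = 0" if "(h has_vector_derivative D) (at t)" "\<And>s. s \<in> I \<Longrightarrow> h s = 0" "t \<in> I" for h and D :: real and t
  proof -
    have "(h has_vector_derivative 0) (at t)"
      by (rule has_vector_derivative_transform_within_open[OF has_vector_derivative_const open_greaterThanLessThan that(3)])
         (simp add: that(2))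
    with that(1) show ?thesis by (rule vector_derivative_unique_at)
  qed
  \<comment> \<open>This is \<open>\<tau> 2 = 0\<close> at an arbitrary time; the traces of all
    higher derivatives then vanish by differentiation.\<close>
  have tr1: "trace (r 1 t) = 0" if "t \<in> I" for t
    by (rule vals[of t]) (use that in auto)
  have trk: "trace (r (Suc k) t) = 0" if "t \<in> I" for k t
    using that
  proof (induction k arbitrary: t)
    case (Suc k)
    show ?case by (rule zero[OF tr[OF r'[OF Suc.prems]] Suc.IH Suc.prems])
  qed (simp add: tr1[unfolded One_nat_def])
  have tr0: "trace (r k t) = 0" if "t \<in> I" "k > 0" for k t
    using trk[OF that(1), of "k - 1"] that(2) by simp
  \<comment> \<open>This is \<open>\<tau> 4 = 0\<close>, from which Tr R''' has already dropped
    out.\<close>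
  have r01: "trace (r 0 t ** r 1 t) = 0" if t: "t \<in> I" for t
  proof -
    have "trace (r 3 t) + trace (r 0 t ** r 1 t) = 0"
      by (rule vals[of t]) (use t in auto)
    then show ?thesis using tr0[OF t, of 3] by simp
  qed
  have sym: "trace (X ** Y) = trace (Y ** X)" for X Y :: "real^'n^'n" by (rule trace_mul_sym)
  \<comment> \<open>The first of three successive derivatives of Tr (R R') = 0; symmetry of the
    trace of a product merges the mixed terms.\<close>
  have r02: "trace (r 0 t ** r 2 t) + trace (r 1 t ** r 1 t) = 0" if t: "t \<in> I" for t
    using zero[OF tr[OF mm[OF r'[OF t, of 0] r'[OF t, of 1]]] _ t] r01
    by (simp add: trace_linear_simps numeral_2_eq_2)
  have r03: "trace (r 0 t ** r 3 t) + 3 * trace (r 1 t ** r 2 t) = 0" if t: "t \<in> I" for t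
    using zero[OF has_vector_derivative_add[OF tr[OF mm[OF r'[OF t, of 0] r'[OF t, of 2]]] tr[OF mm[OF r'[OF t, of 1] r'[OF t, of 1]]]] _ t] r02
      sym[of "r 2 t" "r 1 t"]
    by (simp add: trace_linear_simps eval_nat_numeral)
  have r04: "trace (r 0 t ** r 4 t) + 4 * trace (r 1 t ** r 3 t) + 3 * trace (r 2 t ** r 2 t) = 0" if t: "t \<in> I" for t
    using zero[OF has_vector_derivative_add[OF tr[OF mm[OF r'[OF t, of 0] r'[OF t, of 3]]]
        has_vector_derivative_mult_right[OF tr[OF mm[OF r'[OF t, of 1] r'[OF t, of 2]]], of 3]] _ t] r03
    by (simp add: trace_linear_simps eval_nat_numeral)
  \<comment> \<open>The relation of weight 7, that is \<open>\<tau> 6 = 0\<close> up to sign, after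
    the trace of the fifth derivative has dropped out.\<close>
  have r7: "(5/3) * trace (r 0 t ** r 3 t) + (9/2) * trace (r 1 t ** r 2 t) + (8/3) * trace (r 0 t ** r 0 t ** r 1 t) = 0"
    if t: "t \<in> I" for t
  proof -
    have "(3/4) * trace (r 5 t) + (5/3) * trace (r 0 t ** r 3 t) + (9/2) * trace (r 1 t ** r 2 t) + (8/3) * trace (r 0 t ** r 0 t ** r 1 t) = 0"
      by (rule vals[of t]) (use t in auto)
    then show ?thesis using tr0[OF t, of 5] by simp
  qed
  \<comment> \<open>Its derivative at 0. In the cubic term Tr (R R R'), the two contributions that
    differentiate a factor R agree by cyclicity, whence the factor 2.\<close>
  have r8: "(5/3) * (trace (r 0 0 ** r 4 0) + trace (r 1 0 ** r 3 0)) + (9/2) * (trace (r 1 0 ** r 3 0) + trace (r 2 0 ** r 2 0))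
      + (8/3) * (trace (r 0 0 ** r 0 0 ** r 2 0) + 2 * trace (r 0 0 ** r 1 0 ** r 1 0)) = 0"
    using zero[OF has_vector_derivative_add[OF has_vector_derivative_add[OF
        has_vector_derivative_mult_right[OF tr[OF mm[OF r'[OF I0, of 0] r'[OF I0, of 3]]], of "5/3"]
        has_vector_derivative_mult_right[OF tr[OF mm[OF r'[OF I0, of 1] r'[OF I0, of 2]]], of "9/2"]]
        has_vector_derivative_mult_right[OF tr[OF mm[OF mm[OF r'[OF I0, of 0] r'[OF I0, of 0]] r'[OF I0, of 1]]], of "8/3"]] _ I0]
      r7 sym[of "r 1 0 ** r 0 0" "r 1 0"] sym[of "r 1 0" "r 0 0 ** r 1 0"]
    by (simp add: trace_linear_simps matrix_mult_linear_simps matrix_mul_assoc eval_nat_numeral)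
  obtain \<tau> :: "nat \<Rightarrow> real" where odd: "\<And>k. q (2 * k + 1) = 0"
    and q: "q 2 = \<tau> 1" "q 4 = \<tau> 3 + 3 * q 2 * \<tau> 1" "q 6 = \<tau> 5 + 10 * q 2 * \<tau> 3 + 5 * q 4 * \<tau> 1"
      "q 8 = \<tau> 7 + 21 * q 2 * \<tau> 5 + 35 * q 4 * \<tau> 3 + 7 * q 6 * \<tau> 1"
    and \<tau>: "\<tau> 1 = - (1/3) * trace (r 0 0)"
    "\<tau> 3 = - (3/5) * trace (r 2 0) - (2/15) * trace (r 0 0 ** r 0 0)"
    "\<tau> 5 = - (5/7) * trace (r 4 0) - (8/7) * trace (r 0 0 ** r 2 0) - (15/14) * trace (r 1 0 ** r 1 0) - (16/63) * trace (r 0 0 ** r 0 0 ** r 0 0)"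
    "\<tau> 7 = - (7/9) * trace (r 6 0) - (20/9) * trace (r 0 0 ** r 4 0) - (70/9) * trace (r 1 0 ** r 3 0) - (28/5) * trace (r 2 0 ** r 2 0)
       - (272/45) * trace (r 0 0 ** r 0 0 ** r 2 0) - (100/9) * trace (r 0 0 ** r 1 0 ** r 1 0) - (16/15) * trace (r 0 0 ** r 0 0 ** r 0 0 ** r 0 0)"
    by (rule vals[OF d0, unfolded P0 y0, folded q_def]) (rule that)
  define a where "a = trace (r 0 0)"
  define b where "b = trace (r 0 0 ** r 0 0)"
  define c' where "c' = trace (r 0 0 ** r 0 0 ** r 0 0)"
  define e where "e = trace (r 1 0 ** r 1 0)"
  define f where "f = trace (r 0 0 ** r 0 0 ** r 2 0)"
  define h where "h = trace (r 0 0 ** r 1 0 ** r 1 0)"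
  define m where "m = trace (r 2 0 ** r 2 0)"
  define n where "n = trace (r 0 0 ** r 0 0 ** r 0 0 ** r 0 0)"
  have t1: "\<tau> 1 = - (1/3) * a" using \<tau>(1) by (simp add: a_def)
  have t3: "\<tau> 3 = - (2/15) * b" using \<tau>(2) tr0[OF I0, of 2] by (simp add: b_def)
  \<comment> \<open>By \<open>r02\<close> the trace of R R'' is - e, and 8/7 - 15/14 = 1/14.\<close>
  have t5: "\<tau> 5 = (1/14) * e - (16/63) * c'"
    using \<tau>(3) tr0[OF I0, of 4] r02[OF I0] by (simp add: e_def c'_def field_simps)
  \<comment> \<open>With A = Tr (R R'''') and X = Tr (R' R'''), eliminating A by \<open>r04\<close>
    from \<open>r8\<close> leaves -(1/2) (X + m) + (8/3) (f + 2 h) = 0.\<close>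
  have r13: "trace (r 1 0 ** r 3 0) = (16/3) * (f + 2 * h) - m"
  proof -
    have "X = (16/3) * (f + 2 * h) - m"
      if "(5/3) * (A + X) + (9/2) * (X + m) + (8/3) * (f + 2 * h) = 0" "A + 4 * X + 3 * m = 0" for A X :: real
      using that by algebra
    from this[OF r8[folded f_def h_def m_def] r04[OF I0, folded m_def]] show ?thesis .
  qed
  \<comment> \<open>Replacing A by -4 X - 3 m turns the quadratic traces into (10/9) X + (16/15) m;
    inserting \<open>r13\<close> for X then gives the coefficients of f, h and m.\<close>
  have t7: "\<tau> 7 = - (16/135) * f + (20/27) * h - (2/45) * m - (16/15) * n"
  proof -
    have "- (7/9) * 0 - (20/9) * A - (70/9) * X - (28/5) * m - (272/45) * f - (100/9) * h - (16/15) * n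
        = - (16/135) * f + (20/27) * h - (2/45) * m - (16/15) * n"
      if "A + 4 * X + 3 * m = 0" "X = (16/3) * (f + 2 * h) - m" for A X :: real
    proof -
      have "A = - 4 * X - 3 * m" using that(1) by simp
      then show ?thesis unfolding that(2) by (simp add: field_simps)
    qed
    from this[OF r04[OF I0, folded m_def] r13] show ?thesis
      using \<tau>(4) tr0[OF I0, of 6] unfolding f_def[symmetric] h_def[symmetric] m_def[symmetric] n_def[symmetric] by simp
  qed
  show ?thesis
    unfolding r_eq a_def[symmetric] b_def[symmetric] c'_def[symmetric] e_def[symmetric] f_def[symmetric]
      h_def[symmetric] m_def[symmetric] n_def[symmetric]
  proof (intro conjI allI impI)
    show "H (2 * k + 1) = 0" for k using odd[of k] by (simp add: Hq)
    have q2: "q 2 = - (1/3) * a" using q(1) t1 by simp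
    have q4: "q 4 = a\<^sup>2 / 3 - (2/15) * b" using q(2) q2 t1 t3 by (simp add: power2_eq_square)
    have q6: "q 6 = (1/14) * e - (16/63) * c' + (2/3) * a * b - (5/9) * a ^ 3"
      using q(3) q2 q4 t1 t3 t5 by (simp add: power2_eq_square power3_eq_cube algebra_simps)
    show "H 2 = - (1/6) * a" using q2 by (simp add: Hq fact_numeral)
    show "H 4 = (1/72) * a\<^sup>2 - (1/180) * b" using q4 by (simp add: Hq fact_numeral)
    show "H 6 = - (a ^ 3 / 1296) + a * b / 1080 - c' / 2835 + e / 10080" using q6 by (simp add: Hq fact_numeral)
    \<comment> \<open>Division by 8! = 40320 turns the coefficients of \<open>t7\<close> into those
      of the last four terms, for instance (16/15) / 40320 = 1/37800; the other terms come from the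
      products of lower q and \<tau>.\<close>
    show "H 8 = a ^ 4 / 31104 - a\<^sup>2 * b / 12960 + a * c' / 17010 - a * e / 60480 + b\<^sup>2 / 64800 - n / 37800
        - f / 340200 + h / 54432 - m / 907200"
      using q(4) q2 q4 q6 t1 t3 t5 t7
      by (simp add: Hq fact_numeral power2_eq_square power3_eq_cube power4_eq_xxxx algebra_simps)
  qed
qed

end
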